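(* Let $0<\xi\le1$, $\alpha\ge0$, $\gamma>0$, and let $\nu\ge\mu\ge1$ satisfy $\mu+\nu=\alpha-\gamma$ and $\mu\nu=\gamma$. Let $$0\le\sigma\le\frac12\left(\frac{1/\mu-1/\nu}{1+1/\mu-1/\nu}\right).$$ Let $\lambda$ be a non-negative real-valued integrable function on $[0,1]$, twice differentiable on $(0,1)$, with $\int_0^1\lambda(t)\,dt=1$ and $\lambda(1)=0$. Let $\beta<1$ be defined by $$\frac{\beta}{1-\beta}=-\int_0^1\lambda(t)\bigl((1-\xi)g(t)+\xi(2q(t)-1)\bigr)\,dt .$$ If $$\frac{t\lambda''(t)}{\lambda'(t)}\ \ge\ \left(\frac1\xi-2+\frac2\mu-\frac1\nu\right)+\frac{1-2\sigma}{\log(1/t)},\qquad t\in(0,1),$$ then $V_\lambda(\mathcal W_\beta(\alpha,\gamma))\subset M(\sigma,\xi)$.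
   Context: $\mathbb D=\{z\in\mathbb C:|z|<1\}$. $\mathcal A$ is the class of analytic functions $f$ on $\mathbb D$ with $f(0)=f'(0)-1=0$. The Pascu class $M(\sigma,\xi)$ of $\xi$-convex functions of order $\sigma$ ($0\le\sigma<1$, $0\le\xi\le1$) is the class of $f\in\mathcal A$ with $$\mathrm{Re}\,\frac{\xi z(zf'(z))'+(1-\xi)zf'(z)}{\xi zf'(z)+(1-\xi)f(z)}>\sigma,\quad z\in\mathbb D,$$ equivalently $\xi zf'+(1-\xi)f$ is starlike of order $\sigma$. For $\alpha,\gamma\ge0$ and $\beta<1$, $\mathcal W_\beta(\alpha,\gamma)$ is the class of $f\in\mathcal A$ for which there is $\phi\in\mathbb R$ with $$\mathrm{Re}\left(e^{i\phi}\left((1-\alpha+2\gamma)\tfrac{f(z)}{z}+(\alpha-2\gamma)f'(z)+\gamma zf''(z)-\beta\right)\right)>0,\quad z\in\mathbb D.$$ The integral operator is $V_\lambda(f)(z)=\int_0^1\lambda(t)\frac{f(tz)}{t}\,dt$ for $f\in\mathcal A$, and $V_\lambda(\mathcal W_\beta(\alpha,\gamma))$ is the set of all $V_\lambda(f)$ with $f\in\mathcal W_\beta(\alpha,\gamma)$. The functions $g,q$ on $[0,1]$ are $$g(t)=\frac{2}{\mu\nu}\int_0^1\!\!\int_0^1\frac{1-\sigma(1+swt)}{(1-\sigma)(1+swt)^2}s^{1/\mu-1}w^{1/\nu-1}\,ds\,dw-1,$$ $$q(t)=\frac{1}{\mu\nu}\int_0^1\!\!\int_0^1\frac{1-\sig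ma-(1+\sigma)swt}{(1-\sigma)(1+swt)^3}s^{1/\mu-1}w^{1/\nu-1}\,ds\,dw.$$
   Formalization: The condition λ(1)=0 is read as a boundary value, that is, λ is also assumed left-continuous at 1 (with only a point value at 1 the claim fails for some increasing λ), and λ'(t)≠0 on (0,1), presupposed by the quotient tλ''/λ', is stated explicitly. *)

theory Defs
  imports "HOL-Analysis.Analysis"
begin

abbreviation unit_disc :: "complex set" where
  "unit_disc \<equiv> ball 0 1"

definition class_A :: "(complex \<Rightarrow> complex) set" where
  "class_A = {f. f holomorphic_on unit_disc \<and> f 0 = 0 \<and> deriv f 0 = 1}"

text \<open>
  The quotient defining the class has the form \<open>0 / 0\<close> at the origin. For \<open>f\<close> in \<open>class_A\<close> it
  extends there with the value \<open>1\<close>, whose real part exceeds every \<open>\<sigma> < 1\<close>, so only the points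
  \<open>z \<noteq> 0\<close> carry a condition. Elsewhere the denominator is required not to vanish.
\<close>

definition pascu_class :: "real \<Rightarrow> real \<Rightarrow> (complex \<Rightarrow> complex) set" where
  "pascu_class \<sigma> \<xi> = {f \<in> class_A. \<forall>z \<in> unit_disc - {0}.
     of_real \<xi> * (z * deriv f z) + of_real (1 - \<xi>) * f z \<noteq> 0 \<and>
     Re ((of_real \<xi> * (z * deriv (\<lambda>w. w * deriv f w) z) + of_real (1 - \<xi>) * (z * deriv f z))
         / (of_real \<xi> * (z * deriv f z) + of_real (1 - \<xi>) * f z)) > \<sigma>}"

text \<open>\<open>f z / z\<close> with its removable singularity at the origin filled in (for \<open>f 0 = 0\<close>).\<close>

definition over_z :: "(complex \<Rightarrow> complex) \<Rightarrow> complex \<Rightarrow> complex" where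
  "over_z f z = (if z = 0 then deriv f 0 else f z / z)"

definition W_class :: "real \<Rightarrow> real \<Rightarrow> real \<Rightarrow> (complex \<Rightarrow> complex) set" where
  "W_class \<beta> \<alpha> \<gamma> = {f \<in> class_A. \<exists>\<phi>::real. \<forall>z \<in> unit_disc.
     Re (exp (\<i> * of_real \<phi>) *
         (of_real (1 - \<alpha> + 2 * \<gamma>) * over_z f z + of_real (\<alpha> - 2 * \<gamma>) * deriv f z
          + of_real \<gamma> * z * deriv (deriv f) z - of_real \<beta>)) > 0}"

definition V_op :: "(real \<Rightarrow> real) \<Rightarrow> (complex \<Rightarrow> complex) \<Rightarrow> complex \<Rightarrow> complex" where
  "V_op lam f z = (LINT t:{0..1}|lborel. of_real (lam t) * (f (of_real t * z) / of_real t))"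

definition g_fun :: "real \<Rightarrow> real \<Rightarrow> real \<Rightarrow> real \<Rightarrow> real" where
  "g_fun \<mu> \<nu> \<sigma> t = 2 / (\<mu> * \<nu>) *
     (LINT s:{0..1}|lborel. LINT w:{0..1}|lborel.
        (1 - \<sigma> * (1 + s * w * t)) / ((1 - \<sigma>) * (1 + s * w * t)\<^sup>2)
        * s powr (1 / \<mu> - 1) * w powr (1 / \<nu> - 1)) - 1"

definition q_fun :: "real \<Rightarrow> real \<Rightarrow> real \<Rightarrow> real \<Rightarrow> real" where
  "q_fun \<mu> \<nu> \<sigma> t = 1 / (\<mu> * \<nu>) *
     (LINT s:{0..1}|lborel. LINT w:{0..1}|lborel.
        (1 - \<sigma> - (1 + \<sigma>) * s * w * t) / ((1 - \<sigma>) * (1 + s * w * t) ^ 3)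
        * s powr (1 / \<mu> - 1) * w powr (1 / \<nu> - 1))"

end

theory Submission
  imports Defs "HOL-Complex_Analysis.Cauchy_Integral_Formula" "HOL-Real_Asymp.Real_Asymp"
begin

text \<open>
  Put \<open>a = 1/\<mu>\<close>, \<open>b = 1/\<nu>\<close>, \<open>s = 1/(1 - \<sigma>)\<close>, \<open>m\<^sub>n = ab/((n + a)(n + b))\<close> and let \<open>L\<^sub>n\<close> be the
  \<open>n\<close>-th moment of \<open>\<lambda>\<close>.

  For \<open>f = \<Sum> a\<^sub>n z\<^sup>n\<close> in the class \<open>\<W>\<^sub>\<beta>(\<alpha>, \<gamma>)\<close>, the function \<open>H\<close> that takes
  its values in a half-plane with \<open>\<beta>\<close> on the boundary has coefficients \<open>h\<^sub>n = (1 + \<mu>n)(1 + \<nu>n)a\<^sub>n\<^sub>+\<^sub>1\<close>.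
  With \<open>F = V\<^sub>\<lambda>(f)\<close> and \<open>K = \<xi>zF' + (1 - \<xi>)F\<close> this gives \<open>K(z)/z = k(z)\<close> for
  \<open>k = \<Sum> (1 + \<xi>n) m\<^sub>n L\<^sub>n h\<^sub>n z\<^sup>n\<close>. Since \<open>zK'/K = 1 + zk'/k\<close>, and \<open>-1/\<kappa>\<close> runs through the
  half-plane \<open>Re \<le> \<sigma> - 1\<close> as \<open>\<kappa>\<close> runs through the closed disc with diameter \<open>[0, s]\<close> without
  its point \<open>0\<close>, starlikeness of order \<open>\<sigma>\<close> of \<open>K\<close> says that \<open>k + \<kappa>zk'\<close> has no zero for any \<open>\<kappa>\<close>
  in this disc (\<open>starlike_half_plane\<close>).

  The function \<open>k + \<kappa>zk'\<close> is the Hadamard product of \<open>H\<close> with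
  \<open>C\<^sub>\<kappa> = \<Sum> (1 + \<kappa>n)(1 + \<xi>n) m\<^sub>n L\<^sub>n z\<^sup>n\<close>. A Hadamard product is an average of \<open>H\<close> over a circle
  with the density \<open>2 Re C\<^sub>\<kappa> - 1 + \<beta>/(1 - \<beta>)\<close>; if this density is nonnegative, the product stays in
  an open half-plane with \<open>0\<close> on its boundary (\<open>half_plane_convolution_nonzero\<close>). By the choice of
  \<open>\<beta>\<close>, nonnegativity means that \<open>Re C\<^sub>\<kappa>\<close> is at least the integral of \<open>\<lambda>((1 - \<xi>)(g + 1)/2 + \<xi>q)\<close>.

  Let \<open>A\<^sub>\<kappa>(z) = \<Sum> (1 + \<kappa>n) m\<^sub>n z\<^sup>n\<close>. Then \<open>(g(t) + 1)/2 = A\<^sub>s(-t)\<close> and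
  \<open>q(t) = (t A\<^sub>s(-t))'\<close>, so with \<open>Y(t) = Re A\<^sub>\<kappa>(tz) - A\<^sub>s(-t)\<close> the required inequality states that
  the integral of \<open>\<lambda>((1 - \<xi>)Y + \<xi>(tY)')\<close> is nonnegative. The weight \<open>\<lambda>\<close> is nonnegative and
  decreasing, because it vanishes at \<open>1\<close> and its derivative has no zero; after an integration by
  parts it therefore suffices that \<open>Y \<ge> 0\<close> (\<open>weighted_g_q_integral_le\<close>).

  That \<open>Y \<ge> 0\<close> is the core (\<open>Re_mellin_series_ge\<close>). The series
  \<open>A\<^sub>\<kappa>(\<zeta>)\<close> is the mean of \<open>E\<^sub>\<kappa>(\<tau>\<zeta>)\<close>, \<open>E\<^sub>\<kappa>(y) = 1/(1 - y) + \<kappa>y/(1 - y)\<^sup>2\<close>, for an explicit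
  probability density in \<open>\<tau>\<close>. The gap between \<open>Re E\<^sub>\<kappa>(\<tau>\<zeta>)\<close> and \<open>E\<^sub>s(-\<tau>|\<zeta>|)\<close> can be negative, but
  it has an elementary lower bound that changes sign at most once, from plus to minus, as \<open>\<tau>\<close>
  increases. For such a function it suffices to test one weight, as long as the quotient of the
  density by that weight decreases in \<open>\<tau>\<close>. The weight \<open>4\<rho>(1 - \<rho>)/(1 + \<rho>)\<^sup>3\<close>, \<open>\<rho> = \<tau>|\<zeta>|\<close>, has this
  property since \<open>0 < b \<le> a \<le> 1\<close>, and in the variable \<open>r = (1 - \<rho>)/(1 + \<rho>)\<close> its integral against
  the gap is bounded below by an explicit primitive (\<open>gap_primitive_deriv_le\<close>). The bound on \<open>\<sigma>\<close>
  enters as \<open>\<sigma> \<le> 1/4\<close>, that is \<open>s \<le> 4/3\<close>.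
\<close>

section \<open>Pointwise lower bound for the starlike kernel\<close>

text \<open>
  The generating function of \<open>1 + \<kappa>n\<close>. Convolving \<open>k\<close> with it produces \<open>k + \<kappa>zk'\<close>, the function whose
  zeros decide starlikeness.
\<close>

definition starlike_kernel :: "'a::field \<Rightarrow> 'a \<Rightarrow> 'a" where
  "starlike_kernel \<kappa> \<zeta> = 1 / (1 - \<zeta>) + \<kappa> * \<zeta> / (1 - \<zeta>)\<^sup>2"

text \<open>
  For \<open>|\<zeta>| = \<rho>\<close> and \<open>Re \<zeta> = \<rho>(2k - 1)\<close> the direction of \<open>\<zeta>\<close> is recorded by \<open>k \<in> [0, 1]\<close>, and
  \<open>\<rho>\<close> is replaced by \<open>r = (1 - \<rho>)/(1 + \<rho>)\<close>. In these coordinates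
  \<open>|1 - \<zeta>|\<^sup>2 = 4 \<cdot> gap_denom k r / (1 + r)\<^sup>2\<close>, and \<open>gap_bound\<close> is the minimum over the disc
  \<open>|\<kappa> - 2/3| \<le> 2/3\<close> of \<open>Re E\<^sub>\<kappa>(\<zeta>) - E\<^sub>4\<^sub>/\<^sub>3(-\<rho>)\<close>, where \<open>E\<^sub>\<kappa>\<close> is the starlike kernel. Where it is
  not zero, its sign is that of \<open>gap_sign\<close>.
\<close>

definition gap_denom :: "real \<Rightarrow> real \<Rightarrow> real" where
  "gap_denom k r = 1 - k + k * r\<^sup>2"

definition gap_sign :: "real \<Rightarrow> real \<Rightarrow> real" where
  "gap_sign k r = r * gap_denom k r + 4/3 * (r\<^sup>2 - 1/2) + 2/3 * k * (1 - r\<^sup>2)\<^sup>2"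

definition gap_bound :: "real \<Rightarrow> real \<Rightarrow> real" where
  "gap_bound k r = k * (1 - r\<^sup>2) * gap_sign k r / (2 * (gap_denom k r)\<^sup>2)"

text \<open>
  The kernel is affine in \<open>\<kappa>\<close>, and a linear functional is minimised on a disc at the point opposite to
  its gradient.
\<close>

lemma Re_starlike_kernel_ge:
  fixes s :: real and \<kappa> \<zeta> :: complex
  assumes "norm (\<kappa> - s / 2) \<le> s / 2"
  shows "Re (starlike_kernel \<kappa> \<zeta>) \<ge> Re (1 / (1 - \<zeta>)) + s / 2 * (Re (\<zeta> / (1 - \<zeta>)\<^sup>2) - norm (\<zeta> / (1 - \<zeta>)\<^sup>2))"
proof -
  define Z where "Z = \<zeta> / (1 - \<zeta>)\<^sup>2"
  have "- Re ((\<kappa> - s / 2) * Z) \<le> norm ((\<kappa> - s / 2) * Z)"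
    using abs_Re_le_cmod[of "(\<kappa> - s / 2) * Z"] by linarith
  also have "\<dots> \<le> s / 2 * norm Z"
    unfolding norm_mult by (rule mult_right_mono[OF assms]) simp
  finally have "- Re ((\<kappa> - s / 2) * Z) \<le> s / 2 * norm Z" .
  moreover have "Re ((\<kappa> - s / 2) * Z) = Re (\<kappa> * Z) - s / 2 * Re Z"
    by (simp add: algebra_simps)
  ultimately have "Re (\<kappa> * Z) \<ge> s / 2 * (Re Z - norm Z)"
    unfolding right_diff_distrib by linarith
  moreover have "starlike_kernel \<kappa> \<zeta> = 1 / (1 - \<zeta>) + \<kappa> * Z"
    by (simp add: starlike_kernel_def Z_def)
  ultimately show ?thesis
    by (simp add: Z_def)
qed

lemma gap_denom_pos:
  assumes "0 \<le> k" "k \<le> 1" "0 < r"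
  shows "0 < gap_denom k r"
proof (cases "k = 1")
  case False
  then have "0 < 1 - k" and "0 \<le> k * r\<^sup>2"
    using assms by auto
  then show ?thesis
    by (simp add: gap_denom_def)
qed (use assms in \<open>simp add: gap_denom_def\<close>)

text \<open>
  The difference bounded in \<open>Re_starlike_kernel_ge\<close>, minus its value at \<open>-\<rho>\<close>, is an affine function
  \<open>P0 + s P1\<close> of \<open>s\<close> with \<open>P0 \<ge> 0\<close>. Hence the case \<open>s = 4/3\<close> yields all smaller \<open>s\<close>, with the factor
  \<open>3s/4\<close>.
\<close>

lemma starlike_kernel_gap:
  fixes s k r \<rho> :: real and \<kappa> \<zeta> :: complex
  assumes s: "0 \<le> s" "s \<le> 4/3" and \<kappa>: "norm (\<kappa> - s / 2) \<le> s / 2"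
    and \<zeta>: "norm \<zeta> = \<rho>" "\<rho> < 1" "Re \<zeta> = \<rho> * (2 * k - 1)"
    and k: "0 \<le> k" "k \<le> 1" and r: "r = (1 - \<rho>) / (1 + \<rho>)"
  shows "Re (starlike_kernel \<kappa> \<zeta>) - starlike_kernel s (- \<rho>) \<ge> 3 * s / 4 * gap_bound k r"
proof -
  have \<rho>0: "0 \<le> \<rho>"
    using \<zeta>(1) by auto
  have r01: "0 < r" "r \<le> 1"
    using \<rho>0 \<zeta>(2) by (auto simp: r field_simps)
  have \<rho>r: "\<rho> = (1 - r) / (1 + r)"
    using \<rho>0 by (simp add: r field_simps)
  define M where "M = gap_denom k r"
  have M0: "M > 0"
    unfolding M_def by (rule gap_denom_pos[OF k r01(1)])
  have M: "M = 1 - k + k * r\<^sup>2"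
    by (simp add: M_def gap_denom_def)
  define N where "N = (norm (1 - \<zeta>))\<^sup>2"
  have sq: "(Re \<zeta>)\<^sup>2 + (Im \<zeta>)\<^sup>2 = \<rho>\<^sup>2"
    using \<zeta>(1) by (metis cmod_power2)
  have N1: "N = 1 - 2 * Re \<zeta> + \<rho>\<^sup>2"
    unfolding N_def cmod_power2 using sq by (simp add: power2_eq_square algebra_simps)
  have N: "N = 4 * M / (1 + r)\<^sup>2"
  proof -
    have "N = (1 + \<rho>)\<^sup>2 - 4 * k * \<rho>"
      unfolding N1 \<zeta>(3) by (simp add: power2_eq_square algebra_simps)
    also have "(1 + \<rho>)\<^sup>2 - 4 * k * \<rho> = 4 * M / (1 + r)\<^sup>2"
      using r01 unfolding \<rho>r M
      by (simp add: divide_simps) (simp add: power2_eq_square algebra_simps)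
    finally show ?thesis .
  qed
  have N0: "N > 0"
    unfolding N using M0 r01 by simp
  have nz: "1 - \<zeta> \<noteq> 0"
    using N0 by (auto simp: N_def)
  have Re1: "Re (1 / (1 - \<zeta>)) = (1 - Re \<zeta>) / N"
    by (simp add: Re_divide N_def cmod_power2)
  have "\<zeta> / (1 - \<zeta>)\<^sup>2 = \<zeta> * (1 - cnj \<zeta>)\<^sup>2 / of_real (N\<^sup>2)"
  proof -
    have "complex_of_real N = (1 - \<zeta>) * (1 - cnj \<zeta>)"
      unfolding N_def using complex_norm_square[of "1 - \<zeta>"] by simp
    then have "of_real (N\<^sup>2) = (1 - \<zeta>)\<^sup>2 * (1 - cnj \<zeta>)\<^sup>2"
      by (simp add: power_mult_distrib)
    moreover have "1 - cnj \<zeta> \<noteq> 0"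
      using nz by (metis complex_cnj_cancel_iff complex_cnj_diff complex_cnj_one complex_cnj_zero)
    ultimately show ?thesis
      using nz by simp
  qed
  also have "\<zeta> * (1 - cnj \<zeta>)\<^sup>2 = \<zeta> - 2 * of_real (\<rho>\<^sup>2) + of_real (\<rho>\<^sup>2) * cnj \<zeta>"
  proof -
    have "\<zeta> * cnj \<zeta> = of_real (\<rho>\<^sup>2)"
      using \<zeta>(1) complex_norm_square[of \<zeta>] by simp
    moreover have "\<zeta> * (1 - cnj \<zeta>)\<^sup>2 = \<zeta> - 2 * (\<zeta> * cnj \<zeta>) + (\<zeta> * cnj \<zeta>) * cnj \<zeta>"
      by (simp add: power2_eq_square algebra_simps)
    ultimately show ?thesis
      by metis
  qed
  finally have "Re (\<zeta> / (1 - \<zeta>)\<^sup>2) = (Re \<zeta> * (1 + \<rho>\<^sup>2) - 2 * \<rho>\<^sup>2) / N\<^sup>2"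
    by (simp add: algebra_simps del: of_real_power)
  moreover have "norm (\<zeta> / (1 - \<zeta>)\<^sup>2) = \<rho> / N"
    using \<zeta>(1) by (simp add: norm_divide norm_power N_def)
  ultimately have Z: "Re (\<zeta> / (1 - \<zeta>)\<^sup>2) - norm (\<zeta> / (1 - \<zeta>)\<^sup>2)
      = (\<rho> * (2 * k - 1) * (1 + \<rho>\<^sup>2) - 2 * \<rho>\<^sup>2) / N\<^sup>2 - \<rho> / N"
    by (simp add: \<zeta>(3))
  define P0 where "P0 = (1 - \<rho> * (2 * k - 1)) / N - 1 / (1 + \<rho>)"
  define P1 where "P1 = 1/2 * ((\<rho> * (2 * k - 1) * (1 + \<rho>\<^sup>2) - 2 * \<rho>\<^sup>2) / N\<^sup>2 - \<rho> / N) + \<rho> / (1 + \<rho>)\<^sup>2"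
  have r1: "1 + \<rho> = 2 / (1 + r)"
    using r01 unfolding \<rho>r by (simp add: field_simps)
  have P0: "P0 = k * (1 - r\<^sup>2) * (r * M) / (2 * M\<^sup>2)"
  proof -
    have "P0 = ((1 - k * (1 - r)) * (1 + r) - (1 + r) * M) / (2 * M)"
      unfolding P0_def r1 N using r01 M0 unfolding \<rho>r
      by (simp add: divide_simps) (simp add: power2_eq_square algebra_simps)
    also have "(1 - k * (1 - r)) * (1 + r) - (1 + r) * M = k * (1 - r\<^sup>2) * r"
      unfolding M by (simp add: power2_eq_square algebra_simps)
    finally show ?thesis
      using M0 by (simp add: power2_eq_square)
  qed
  have P1: "P1 = k * (1 - r\<^sup>2) * (r\<^sup>2 - 1/2 + k * (1 - r\<^sup>2)\<^sup>2 / 2) / (2 * M\<^sup>2)"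
  proof -
    have e1: "\<rho> * (2 * k - 1) * (1 + \<rho>\<^sup>2) - 2 * \<rho>\<^sup>2
        = (1 - r) * (2 * (2 * k - 1) * (1 + r\<^sup>2) - 2 * (1 - r\<^sup>2)) / (1 + r) ^ 3"
      using r01 unfolding \<rho>r by (simp add: divide_simps) (simp add: eval_nat_numeral algebra_simps)
    have a1: "(\<rho> * (2 * k - 1) * (1 + \<rho>\<^sup>2) - 2 * \<rho>\<^sup>2) / N\<^sup>2 = 
      (1 - r\<^sup>2) * ((2 * k - 1) * (1 + r\<^sup>2) - (1 - r\<^sup>2)) / (8 * M\<^sup>2)"
      unfolding e1 N using r01 M0
      by (simp add: divide_simps) (simp add: eval_nat_numeral algebra_simps)
    have a2: "\<rho> / N = (1 - r\<^sup>2) * M / (4 * M\<^sup>2)"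
      unfolding N using r01 M0 unfolding \<rho>r
      by (simp add: divide_simps) (simp add: power2_eq_square algebra_simps)
    have a3: "\<rho> / (1 + \<rho>)\<^sup>2 = (1 - r\<^sup>2) * M\<^sup>2 / (4 * M\<^sup>2)"
      unfolding r1 using r01 M0 unfolding \<rho>r
      by (simp add: divide_simps) (simp add: power2_eq_square algebra_simps)
    have "P1 = (1 - r\<^sup>2) * ((2 * k - 1) * (1 + r\<^sup>2) - (1 - r\<^sup>2) - 2 * M + 4 * M\<^sup>2) / (16 * M\<^sup>2)"
      unfolding P1_def a1 a2 a3 using M0
      by (simp add: divide_simps) (simp add: algebra_simps)
    also have "(2 * k - 1) * (1 + r\<^sup>2) - (1 - r\<^sup>2) - 2 * M + 4 * M\<^sup>2 = 8 * k * (r\<^sup>2 - 1/2 + k * (1 - r\<^sup>2)\<^sup>2 / 2)"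
      unfolding M by (simp add: power2_eq_square field_simps)
    finally show ?thesis
      using M0 by (simp add: divide_simps)
  qed
  have "P0 \<ge> 0"
    unfolding P0 using M0 r01 k by (intro divide_nonneg_nonneg mult_nonneg_nonneg) (auto simp: power_le_one)
  \<comment> \<open>\<open>P0 + s P1\<close> is the mean of \<open>P0\<close> and \<open>P0 + 4/3 P1\<close> with weights \<open>1 - 3s/4\<close> and \<open>3s/4\<close>.\<close>
  then have "3 * s / 4 * (P0 + 4/3 * P1) \<le> P0 + s * P1"
    using s mult_right_mono[of "3 * s / 4" 1 P0] by (simp add: algebra_simps)
  moreover have "gap_bound k r = P0 + 4/3 * P1"
    unfolding gap_bound_def gap_sign_def P0 P1 M_def[symmetric] using M0
    by (simp add: divide_simps) (simp add: algebra_simps)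
  ultimately have "3 * s / 4 * gap_bound k r \<le> P0 + s * P1"
    by simp
  also have "P0 + s * P1 = Re (1 / (1 - \<zeta>)) + s / 2 * (Re (\<zeta> / (1 - \<zeta>)\<^sup>2) - norm (\<zeta> / (1 - \<zeta>)\<^sup>2))
      - (1 / (1 + \<rho>) - s * \<rho> / (1 + \<rho>)\<^sup>2)"
    unfolding Z Re1 \<zeta>(3) P0_def P1_def by (simp add: algebra_simps)
  also have "\<dots> \<le> Re (starlike_kernel \<kappa> \<zeta>) - (1 / (1 + \<rho>) - s * \<rho> / (1 + \<rho>)\<^sup>2)"
    by (rule diff_right_mono[OF Re_starlike_kernel_ge[OF \<kappa>]])
  also have "1 / (1 + \<rho>) - s * \<rho> / (1 + \<rho>)\<^sup>2 = starlike_kernel s (- \<rho>)"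
    by (simp add: starlike_kernel_def)
  finally show ?thesis .
qed

section \<open>Integrating the gap against a comparison weight\<close>

text \<open>
  Since \<open>r\<close> decreases when \<open>\<rho>\<close> increases, this makes the gap change sign at most once along a ray,
  from plus to minus.
\<close>

lemma gap_sign_mono:
  assumes k: "0 \<le> k" "k \<le> 1" and r: "0 < r1" "r1 \<le> r2" "r2 \<le> 1"
  shows "gap_sign k r1 \<le> gap_sign k r2"
proof -
  have sq: "r1\<^sup>2 \<le> r2\<^sup>2" "r2\<^sup>2 \<le> 1"
    using r by (auto intro: power_mono power_le_one)
  have "gap_denom k r1 \<le> gap_denom k r2"
    using sq k by (simp add: gap_denom_def mult_left_mono)
  then have 1: "r1 * gap_denom k r1 \<le> r2 * gap_denom k r2"
    using r gap_denom_pos[OF k, of r1] by (intro mult_mono) auto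
  have "k * (2 - r1\<^sup>2 - r2\<^sup>2) \<le> 1 * 2"
    using k sq by (intro mult_mono) auto
  then have "0 \<le> (r2\<^sup>2 - r1\<^sup>2) * (1 - k * (2 - r1\<^sup>2 - r2\<^sup>2) / 2)"
    using sq by (intro mult_nonneg_nonneg) auto
  also have "\<dots> = (r2\<^sup>2 - 1/2 + k * (1 - r2\<^sup>2)\<^sup>2 / 2) - (r1\<^sup>2 - 1/2 + k * (1 - r1\<^sup>2)\<^sup>2 / 2)"
    by (simp add: power2_eq_square field_simps)
  finally show ?thesis
    using 1 unfolding gap_sign_def by (simp add: field_simps)
qed

definition radial :: "real \<Rightarrow> real" where
  "radial \<rho> = (1 - \<rho>) / (1 + \<rho>)"

text \<open>
  In terms of \<open>\<rho>\<close> this is \<open>4\<rho>(1 - \<rho>)/(1 + \<rho>)\<^sup>3\<close>.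
\<close>

definition base_weight :: "real \<Rightarrow> real" where
  "base_weight \<rho> = radial \<rho> * (1 - (radial \<rho>)\<^sup>2)"

lemma radial_bounds:
  assumes "0 \<le> \<rho>" "\<rho> < 1"
  shows "0 < radial \<rho>" "radial \<rho> \<le> 1"
  using assms by (auto simp: radial_def field_simps)

lemma radial_antimono:
  assumes "0 \<le> \<rho>1" "\<rho>1 \<le> \<rho>2"
  shows "radial \<rho>2 \<le> radial \<rho>1"
  using assms by (auto simp: radial_def field_simps)

text \<open>
  After the substitution \<open>r = radial \<rho>\<close>, the integrand \<open>base_weight \<cdot> gap_bound\<close> becomes half of
  \<open>2kr(1 - r)\<^sup>2 gap_sign / gap_denom\<^sup>2\<close>. One integration by parts of the term with \<open>gap_denom\<^sup>2\<close> leaves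
  the integrand \<open>2/3 \<cdot> r(1 - r)(1 - 2r)(2 + kr(1 - r)/gap_denom)\<close>, which is antisymmetric about \<open>1/2\<close>
  except for the decreasing factor \<open>1/gap_denom\<close>. Replacing \<open>gap_denom\<close> by its value \<open>1 - 3k/4\<close> at
  \<open>r = 1/2\<close> therefore decreases the integrand and makes it the derivative of a polynomial. Together with
  the boundary term \<open>- 2/3 \<cdot> r\<^sup>2(1 - r)\<^sup>2/gap_denom\<close> of the integration by parts, that polynomial is the
  primitive below, which vanishes at \<open>0\<close> and \<open>1\<close>.
\<close>

definition gap_primitive :: "real \<Rightarrow> real \<Rightarrow> real" where
  "gap_primitive k r = 2/3 * (r\<^sup>2 * (1 - r)\<^sup>2) * (1 - 1 / gap_denom k r)
     + 2 * k / 9 * (r ^ 3 * (1 - r) ^ 3) / (1 - 3 * k / 4)"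

text \<open>
  The gap along a ray from \<open>0\<close> to a point of modulus \<open>x\<close> is integrated over \<open>0 \<le> \<rho> \<le> x\<close>, and the
  value of the primitive at \<open>r = (1 - x)/(1 + x)\<close> enters this integral with a minus sign.
\<close>

lemma gap_primitive_nonpos:
  assumes k: "0 \<le> k" "k \<le> 1" and r: "0 < r" "r \<le> 1"
  shows "gap_primitive k r \<le> 0"
proof -
  define M where "M = gap_denom k r"
  have M: "M = 1 - k + k * r\<^sup>2" and M0: "M > 0"
    using gap_denom_pos[OF k r(1)] by (auto simp: M_def gap_denom_def)
  have "M \<le> 1"
    using k r mult_left_le[of "r\<^sup>2" k] by (simp add: M power_le_one)
  then have "1 + r \<le> (1 + r) / M"
    using M0 r mult_right_mono[of M 1 "1 + r"] by (simp add: field_simps)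
  moreover have "r / (3 * (1 - 3 * k / 4)) \<le> 4/3 * r"
    using k r by (auto simp: divide_simps algebra_simps mult_left_le)
  moreover have "4/3 * r \<le> 1 + r"
    using r by simp
  ultimately have "r / (3 * (1 - 3 * k / 4)) - (1 + r) / M \<le> 0"
    by linarith
  then have "2/3 * (r\<^sup>2 * (1 - r)\<^sup>2) * (k * (1 - r)) * (r / (3 * (1 - 3 * k / 4)) - (1 + r) / M) \<le> 0"
    using k r by (intro mult_nonneg_nonpos mult_nonneg_nonneg) auto
  moreover have "gap_primitive k r = 2/3 * (r\<^sup>2 * (1 - r)\<^sup>2) * (k * (1 - r)) * (r / (3 * (1 - 3 * k / 4)) - (1 + r) / M)"
  proof -
    define i j where "i = 1 / (1 - 3 * k / 4)" and "j = 1 / M"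
    have j: "1 - j = - (k * (1 - r)) * ((1 + r) * j)"
      using M0 by (simp add: j_def M field_simps power2_eq_square)
    have "gap_primitive k r = 2/3 * (r\<^sup>2 * (1 - r)\<^sup>2) * (1 - j) + 2 * k / 9 * (r ^ 3 * (1 - r) ^ 3) * i"
      by (simp add: gap_primitive_def i_def j_def M_def)
    also have "\<dots> = 2/3 * (r\<^sup>2 * (1 - r)\<^sup>2) * (k * (1 - r)) * (r * i / 3 - (1 + r) * j)"
      unfolding j by (simp add: eval_nat_numeral field_simps)
    finally show ?thesis
      by (simp add: i_def j_def)
  qed
  ultimately show ?thesis
    by (simp only:)
qed

lemma gap_primitive_deriv_le:
  assumes k: "0 \<le> k" "k \<le> 1" and r: "0 < r" "r \<le> 1"
  obtains D where "(gap_primitive k has_real_derivative D) (at r)"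
    and "D \<le> 4 * r * (1 - r)\<^sup>2 / (1 - r\<^sup>2) * gap_bound k r"
proof -
  define M where "M = gap_denom k r"
  define m where "m = 1 - 3 * k / 4"
  have M: "M = 1 - k + k * r\<^sup>2" and M0: "M > 0"
    using gap_denom_pos[OF k r(1)] by (auto simp: M_def gap_denom_def)
  have m0: "m > 0"
    using k by (simp add: m_def)
  define D where "D = 4/3 * (r * (1 - r) * (1 - 2 * r)) * (1 - 1 / M)
     + 2/3 * (r\<^sup>2 * (1 - r)\<^sup>2) * (2 * k * r / M\<^sup>2)
     + 2 * k / 3 * (r\<^sup>2 * (1 - r)\<^sup>2 * (1 - 2 * r)) / m"
  have "(gap_primitive k has_real_derivative D) (at r)"
  proof -
    have dM: "((\<lambda>r. 1 - 1 / gap_denom k r) has_real_derivative 2 * k * r / M\<^sup>2) (at r)"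
      using M0 unfolding gap_denom_def M
      by (auto intro!: derivative_eq_intros simp: power2_eq_square)
    have d2: "((\<lambda>r. r\<^sup>2 * (1 - r)\<^sup>2) has_real_derivative 2 * (r * (1 - r) * (1 - 2 * r))) (at r)"
      by (auto intro!: derivative_eq_intros simp: power2_eq_square algebra_simps)
    have d3: "((\<lambda>r. r ^ 3 * (1 - r) ^ 3) has_real_derivative 3 * (r\<^sup>2 * (1 - r)\<^sup>2 * (1 - 2 * r))) (at r)"
      by (auto intro!: derivative_eq_intros simp: eval_nat_numeral algebra_simps)
    show ?thesis
      unfolding gap_primitive_def[abs_def] m_def[symmetric]
      by (rule DERIV_cong[OF DERIV_add[OF DERIV_mult[OF DERIV_cmult[OF d2] dM] DERIV_cdivide[OF DERIV_cmult[OF d3]]]])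
         (simp add: D_def M_def[symmetric] mult_ac)
  qed
  moreover have "D \<le> 2 * k * r * (1 - r)\<^sup>2 * gap_sign k r / M\<^sup>2"
  proof -
    \<comment> \<open>The error made by freezing \<open>gap_denom\<close> at \<open>r = 1/2\<close>. Its two factors \<open>1 - 2r\<close> and
      \<open>1/M - 1/m\<close> have the same sign.\<close>
    have "2 * k * r * (1 - r)\<^sup>2 * gap_sign k r / M\<^sup>2 - D
        = 2/3 * k * r\<^sup>2 * (1 - r)\<^sup>2 * (1 - 2 * r) * (1 / M - 1 / m)"
    proof -
      have "3 * (1 - r) * gap_sign k r * 2 + 4 * (1 - 2 * r) * (1 - r\<^sup>2) * M - 4 * r\<^sup>2 * (1 - r) 
         = 2 * r * (1 - r) * (1 - 2 * r) * M"
        unfolding gap_sign_def M_def[symmetric] unfolding M by (simp add: field_simps eval_nat_numeral)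
      moreover define i j where "i = 1 / m" and "j = 1 / M"
      ultimately have key: "k * r * (1 - r) / 3 * j\<^sup>2 * (3 * (1 - r) * gap_sign k r * 2 + 4 * (1 - 2 * r) * (1 - r\<^sup>2) * M - 4 * r\<^sup>2 * (1 - r))
         = k * r * (1 - r) / 3 * j\<^sup>2 * (2 * r * (1 - r) * (1 - 2 * r) * M)"
        by simp
      have j2: "j = M * j\<^sup>2"
        using M0 by (simp add: j_def power2_eq_square)
      have "1 - j = (M - 1) * j"
        using M0 by (simp add: j_def field_simps)
      then have j1: "1 - j = - (k * (1 - r\<^sup>2) * (M * j\<^sup>2))"
        unfolding j2[symmetric] by (simp add: M algebra_simps)
      have "D = 4/3 * (r * (1 - r) * (1 - 2 * r)) * (1 - j) + 4/3 * (r\<^sup>2 * (1 - r)\<^sup>2) * (k * r * j\<^sup>2)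
          + 2 * k / 3 * (r\<^sup>2 * (1 - r)\<^sup>2 * (1 - 2 * r)) * i"
        by (simp add: D_def i_def j_def power_divide)
      then have "D = - 4/3 * (r * (1 - r) * (1 - 2 * r)) * (k * (1 - r\<^sup>2) * (M * j\<^sup>2)) + 4/3 * (r\<^sup>2 * (1 - r)\<^sup>2) * (k * r * j\<^sup>2)
          + 2 * k / 3 * (r\<^sup>2 * (1 - r)\<^sup>2 * (1 - 2 * r)) * i"
        unfolding j1 by simp
      then have "2 * k * r * (1 - r)\<^sup>2 * gap_sign k r * j\<^sup>2 - D
          = 2/3 * k * r\<^sup>2 * (1 - r)\<^sup>2 * (1 - 2 * r) * (M * j\<^sup>2 - i)"
        using key by (simp add: eval_nat_numeral field_simps)
      also have "M * j\<^sup>2 - i = 1 / M - 1 / m"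
        unfolding j2[symmetric] by (simp add: i_def j_def)
      finally show ?thesis
        by (simp add: j_def power_divide)
    qed
    also have "1 / M - 1 / m = k * (1 - 2 * r) * (1/2 + r) / (2 * M * m)"
    proof -
      have "1 / M - 1 / m = (m - M) / (M * m)"
        using M0 m0 by (simp add: field_simps)
      also have "m - M = k * (1 - 2 * r) * (1/2 + r) / 2"
        by (simp add: m_def M field_simps power2_eq_square)
      finally show ?thesis
        by simp
    qed
    also have "2/3 * k * r\<^sup>2 * (1 - r)\<^sup>2 * (1 - 2 * r) * (k * (1 - 2 * r) * (1/2 + r) / (2 * M * m))
      = (2/3 * k\<^sup>2 * r\<^sup>2 * (1 - r)\<^sup>2 * (1 - 2 * r)\<^sup>2) * (1/2 + r) / (2 * M * m)"
      by (simp add: power2_eq_square)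
    also have "\<dots> \<ge> 0"
      using M0 m0 r by (intro divide_nonneg_pos mult_nonneg_nonneg) auto
    finally show ?thesis
      by simp
  qed
  moreover have "2 * k * r * (1 - r)\<^sup>2 * gap_sign k r / M\<^sup>2 \<le> 4 * r * (1 - r)\<^sup>2 / (1 - r\<^sup>2) * gap_bound k r"
  proof (cases "r = 1")
    case False
    then have "1 - r\<^sup>2 > 0"
      using r power_strict_mono[of r 1 2] by auto
    then show ?thesis
      using M0 unfolding gap_bound_def M_def[symmetric] by (simp add: field_simps)
  qed simp
  ultimately show ?thesis
    using that by force
qed

lemma set_integrable_scaleR_bounded:
  fixes g :: "'a \<Rightarrow> 'b::{banach, second_countable_topology}" and v :: "'a \<Rightarrow> real"
  assumes v: "set_integrable M A v" and g: "set_borel_measurable M A g"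
    and B: "\<And>t. t \<in> A \<Longrightarrow> norm (g t) \<le> B"
  shows "set_integrable M A (\<lambda>t. v t *\<^sub>R g t)"
proof -
  have m: "(\<lambda>x. indicat_real A x *\<^sub>R v x) \<in> borel_measurable M" "(\<lambda>x. indicat_real A x *\<^sub>R g x) \<in> borel_measurable M"
    using v g by (auto simp: set_integrable_def set_borel_measurable_def)
  have "(\<lambda>x. (indicat_real A x *\<^sub>R v x) *\<^sub>R (indicat_real A x *\<^sub>R g x)) \<in> borel_measurable M"
    using m by measurable
  also have "(\<lambda>x. (indicat_real A x *\<^sub>R v x) *\<^sub>R (indicat_real A x *\<^sub>R g x)) = (\<lambda>x. indicat_real A x *\<^sub>R (v x *\<^sub>R g x))"
    by (auto simp: indicator_def fun_eq_iff)
  finally have m': "(\<lambda>x. indicat_real A x *\<^sub>R (v x *\<^sub>R g x)) \<in> borel_measurable M" .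
  have "integrable M (\<lambda>x. B * (indicat_real A x *\<^sub>R v x))"
    using v unfolding set_integrable_def by simp
  then show ?thesis
    unfolding set_integrable_def
  proof (rule Bochner_Integration.integrable_bound[OF _ m'])
    show "AE x in M. norm (indicat_real A x *\<^sub>R v x *\<^sub>R g x) \<le> norm (B * (indicat_real A x *\<^sub>R v x))"
    proof (rule AE_I2)
      fix x
      show "norm (indicat_real A x *\<^sub>R v x *\<^sub>R g x) \<le> norm (B * (indicat_real A x *\<^sub>R v x))"
      proof (cases "x \<in> A")
        case True
        then have "norm (g x) \<le> \<bar>B\<bar>"
          using B[of x] by linarith
        then have "\<bar>v x\<bar> * norm (g x) \<le> \<bar>v x\<bar> * \<bar>B\<bar>"
          by (intro mult_left_mono) auto
        then show ?thesis
          using True by (simp add: abs_mult mult.commute)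
      qed simp
    qed
  qed
qed

lemma set_integrable_scaleR_continuous:
  fixes g :: "real \<Rightarrow> 'b::{banach, second_countable_topology}" and v :: "real \<Rightarrow> real"
  assumes v: "set_integrable lborel {a..b} v" and g: "continuous_on {a..b} g"
  shows "set_integrable lborel {a..b} (\<lambda>t. v t *\<^sub>R g t)"
proof -
  have "bounded (g ` {a..b})"
    by (intro compact_imp_bounded compact_continuous_image g) auto
  then obtain B where "\<forall>t\<in>{a..b}. norm (g t) \<le> B"
    unfolding bounded_iff by auto
  moreover have "set_borel_measurable lborel {a..b} g"
    using borel_measurable_continuous_on_indicator[OF _ g]
    by (simp add: set_borel_measurable_def)
  ultimately show ?thesis
    by (intro set_integrable_scaleR_bounded[OF v]) auto
qed

lemma gap_bound_continuous:
  assumes k: "0 \<le> k" "k \<le> 1" and x: "0 \<le> x" "x < 1"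
  shows "continuous_on {0..1} (\<lambda>\<tau>. gap_bound k (radial (\<tau> * x)))"
proof -
  have x1: "0 \<le> \<tau> * x" "\<tau> * x < 1" if "\<tau> \<in> {0..1}" for \<tau>
    using that x mult_le_one[of \<tau> x] by (auto intro: le_less_trans[OF mult_left_le_one_le])
  have "gap_denom k (radial (\<tau> * x)) \<noteq> 0" if "\<tau> \<in> {0..1}" for \<tau>
    using gap_denom_pos[OF k radial_bounds(1)[OF x1[OF that]]] by simp
  moreover have "continuous_on {0..1} (\<lambda>\<tau>. radial (\<tau> * x))"
  proof -
    have "1 + \<tau> * x \<noteq> 0" if "\<tau> \<in> {0..1}" for \<tau>
      using x1(1)[OF that] by linarith
    then show ?thesis
      unfolding radial_def by (intro continuous_intros) auto
  qed
  ultimately show ?thesis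
    unfolding gap_bound_def gap_sign_def gap_denom_def
    by (intro continuous_intros) auto
qed

lemma base_weight_continuous:
  assumes x: "0 \<le> x" "x < 1"
  shows "continuous_on {0..1} (\<lambda>\<tau>. base_weight (\<tau> * x))"
proof -
  have "1 + \<tau> * x \<noteq> 0" if "\<tau> \<in> {0..1}" for \<tau>
  proof -
    have "0 \<le> \<tau> * x"
      using that x by simp
    then show ?thesis
      by linarith
  qed
  then show ?thesis
    unfolding base_weight_def radial_def by (intro continuous_intros) auto
qed

lemma base_weight_gap_integral_nonneg:
  assumes k: "0 \<le> k" "k \<le> 1" and x: "0 < x" "x < 1"
  shows "0 \<le> (LINT \<tau>:{0..1}|lborel. base_weight (\<tau> * x) * gap_bound k (radial (\<tau> * x)))"
proof -
  define r where "r \<tau> = radial (\<tau> * x)" for \<tau>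
  \<comment> \<open>The sign and the factor \<open>1/2\<close> come from \<open>d\<rho> = - (1 + \<rho>)\<^sup>2/2 dr\<close>.\<close>
  define \<theta> where "\<theta> \<tau> = - gap_primitive k (r \<tau>) / 2" for \<tau>
  have x1: "0 \<le> \<tau> * x" "\<tau> * x < 1" if "\<tau> \<in> {0..1}" for \<tau>
    using that x by (auto intro: le_less_trans[OF mult_left_le_one_le])
  have r: "0 < r \<tau>" "r \<tau> \<le> 1" if "\<tau> \<in> {0..1}" for \<tau>
    using radial_bounds[OF x1[OF that]] by (simp_all add: r_def)
  define f where "f \<tau> = base_weight (\<tau> * x) * gap_bound k (r \<tau>)" for \<tau>
  have "\<exists>d. (\<theta> has_real_derivative d) (at \<tau> within {0..1}) \<and> d \<le> x * f \<tau>" if \<tau>: "\<tau> \<in> {0..1}" for \<tau>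
  proof -
    obtain D where D: "(gap_primitive k has_real_derivative D) (at (r \<tau>))"
      and le: "D \<le> 4 * r \<tau> * (1 - r \<tau>)\<^sup>2 / (1 - (r \<tau>)\<^sup>2) * gap_bound k (r \<tau>)"
      using gap_primitive_deriv_le[OF k r[OF \<tau>]] by blast
    have "(r has_real_derivative (- 2 * x / (1 + \<tau> * x)\<^sup>2)) (at \<tau>)"
      unfolding r_def[abs_def] radial_def using x1[OF \<tau>]
      by (auto intro!: derivative_eq_intros simp: power2_eq_square divide_simps) (auto simp: algebra_simps)
    from DERIV_chain2[OF D this]
    have "((\<lambda>\<tau>. gap_primitive k (r \<tau>)) has_real_derivative D * (- 2 * x / (1 + \<tau> * x)\<^sup>2)) (at \<tau>)" .
    from DERIV_cdivide[OF DERIV_minus[OF this], of 2]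
    have "(\<theta> has_real_derivative D * x / (1 + \<tau> * x)\<^sup>2) (at \<tau>)"
      unfolding \<theta>_def[abs_def] by simp
    moreover have "D * x / (1 + \<tau> * x)\<^sup>2 \<le> x * f \<tau>"
    proof -
      have "D * (x / (1 + \<tau> * x)\<^sup>2) \<le> 4 * r \<tau> * (1 - r \<tau>)\<^sup>2 / (1 - (r \<tau>)\<^sup>2) * gap_bound k (r \<tau>) * (x / (1 + \<tau> * x)\<^sup>2)"
        using x by (intro mult_right_mono[OF le]) auto
      also have "4 * r \<tau> * (1 - r \<tau>)\<^sup>2 / (1 - (r \<tau>)\<^sup>2) = base_weight (\<tau> * x) * (1 + \<tau> * x)\<^sup>2"
      proof (cases "r \<tau> = 1")
        case True
        then show ?thesis
          by (simp add: base_weight_def r_def)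
      next
        case False
        have "1 + \<tau> * x = 2 / (1 + r \<tau>)"
          using x1[OF \<tau>] by (simp add: r_def radial_def field_simps)
        then have e: "base_weight (\<tau> * x) * (1 + \<tau> * x)\<^sup>2 = r \<tau> * (1 - (r \<tau>)\<^sup>2) * (2 / (1 + r \<tau>))\<^sup>2"
          by (simp add: base_weight_def r_def)
        have f: "1 - (r \<tau>)\<^sup>2 = (1 - r \<tau>) * (1 + r \<tau>)"
          by (simp add: power2_eq_square algebra_simps)
        show ?thesis
          using False r[OF \<tau>] unfolding e f
          by (simp add: divide_simps) (simp add: power2_eq_square algebra_simps)
      qed
      also have "\<dots> * gap_bound k (r \<tau>) * (x / (1 + \<tau> * x)\<^sup>2) = x * f \<tau>"
        using x1[OF \<tau>] by (simp add: f_def)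
      finally show ?thesis
        by simp
    qed
    ultimately show ?thesis
      using has_field_derivative_at_within by blast
  qed
  then obtain d where d: "\<And>\<tau>. \<tau> \<in> {0..1} \<Longrightarrow> (\<theta> has_real_derivative d \<tau>) (at \<tau> within {0..1})"
    "\<And>\<tau>. \<tau> \<in> {0..1} \<Longrightarrow> d \<tau> \<le> x * f \<tau>"
    by metis
  have "(d has_integral (\<theta> 1 - \<theta> 0)) {0..1}"
    using d(1) by (intro fundamental_theorem_of_calculus) (auto simp: has_real_derivative_iff_has_vector_derivative)
  moreover have cont: "continuous_on {0..1} f"
    unfolding f_def r_def using x
    by (intro continuous_intros gap_bound_continuous base_weight_continuous k) auto
  moreover have "((\<lambda>\<tau>. x * f \<tau>) has_integral (x * integral {0..1} f)) {0..1}"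
    by (intro has_integral_mult_right integrable_integral integrable_continuous_real cont)
  ultimately have "\<theta> 1 - \<theta> 0 \<le> x * integral {0..1} f"
    using has_integral_le d(2) by blast
  moreover have "\<theta> 0 = 0"
    by (simp add: \<theta>_def r_def radial_def gap_primitive_def)
  moreover have "\<theta> 1 \<ge> 0"
    using gap_primitive_nonpos[OF k r, of 1] by (simp add: \<theta>_def)
  ultimately have "0 \<le> integral {0..1} f"
    using x by (metis diff_zero order_trans zero_le_mult_iff not_less)
  moreover have "(LINT \<tau>:{0..1}|lborel. f \<tau>) = integral {0..1} f"
    by (intro set_borel_integral_eq_integral borel_integrable_atLeastAtMost' cont)
  ultimately show ?thesis
    by (simp add: f_def r_def)
qed

text \<open>
  If the gap changes sign at \<open>\<tau>0\<close>, let \<open>m\<close> be the quotient of the two weights there. The quotient is at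
  least \<open>m\<close> where the gap is positive and at most \<open>m\<close> where it is negative, so replacing \<open>v\<close> by \<open>m\<close>
  times the comparison weight only decreases the integral.
\<close>

lemma weighted_gap_integral_nonneg:
  assumes k: "0 \<le> k" "k \<le> 1" and x: "0 < x" "x < 1"
    and v: "set_integrable lborel {0..1} v" "\<And>\<tau>. 0 < \<tau> \<Longrightarrow> \<tau> \<le> 1 \<Longrightarrow> 0 \<le> v \<tau>"
    and ratio: "\<And>\<tau>1 \<tau>2. 0 < \<tau>1 \<Longrightarrow> \<tau>1 \<le> \<tau>2 \<Longrightarrow> \<tau>2 \<le> 1 \<Longrightarrow>
       v \<tau>2 * base_weight (\<tau>1 * x) \<le> v \<tau>1 * base_weight (\<tau>2 * x)"
  shows "0 \<le> (LINT \<tau>:{0..1}|lborel. v \<tau> * gap_bound k (radial (\<tau> * x)))"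
proof -
  define r where "r \<tau> = radial (\<tau> * x)" for \<tau>
  define G where "G \<tau> = gap_bound k (r \<tau>)" for \<tau>
  define b where "b \<tau> = base_weight (\<tau> * x)" for \<tau>
  have x1: "0 \<le> \<tau> * x" "\<tau> * x < 1" if "\<tau> \<in> {0..1}" for \<tau>
    using that x by (auto intro: le_less_trans[OF mult_left_le_one_le])
  have r: "0 < r \<tau>" "r \<tau> \<le> 1" if "\<tau> \<in> {0..1}" for \<tau>
    using radial_bounds[OF x1[OF that]] by (simp_all add: r_def)
  have G_int: "set_integrable lborel {0..1} (\<lambda>\<tau>. v \<tau> * G \<tau>)"
    using set_integrable_scaleR_continuous[OF v(1) gap_bound_continuous[OF k, of x]] x
    by (simp add: G_def r_def)
  have b_int: "set_integrable lborel {0..1} (\<lambda>\<tau>. m * (b \<tau> * G \<tau>))" for m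
    unfolding G_def b_def r_def using x
    by (intro borel_integrable_atLeastAtMost' continuous_intros gap_bound_continuous base_weight_continuous k) auto
  have G0: "G 0 = 0"
    by (simp add: G_def r_def radial_def gap_bound_def)
  have fac: "0 \<le> k * (1 - (r \<tau>)\<^sup>2) / (2 * (gap_denom k (r \<tau>))\<^sup>2)" if "\<tau> \<in> {0..1}" for \<tau>
    using r[OF that] k by (intro divide_nonneg_nonneg mult_nonneg_nonneg) (auto simp: power_le_one less_imp_le)
  have Gs: "G \<tau> = k * (1 - (r \<tau>)\<^sup>2) / (2 * (gap_denom k (r \<tau>))\<^sup>2) * gap_sign k (r \<tau>)" for \<tau>
    by (simp add: G_def gap_bound_def)
  obtain m where m: "m \<ge> 0" "\<And>\<tau>. \<tau> \<in> {0..1} \<Longrightarrow> m * (b \<tau> * G \<tau>) \<le> v \<tau> * G \<tau>"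
  proof (cases "\<forall>\<tau>\<in>{0..1}. 0 \<le> G \<tau>")
    case True
    have "0 \<le> v \<tau> * G \<tau>" if "\<tau> \<in> {0..1}" for \<tau>
      using True that v(2)[of \<tau>] G0 by (cases "\<tau> = 0") auto
    then show ?thesis
      using that[of 0] by auto
  next
    case False
    then obtain \<tau>1 where \<tau>1: "\<tau>1 \<in> {0..1}" "G \<tau>1 < 0"
      by (auto simp: not_le)
    then have neg: "gap_sign k (r \<tau>1) < 0"
      using fac[OF \<tau>1(1)] mult_nonneg_nonneg[OF fac[OF \<tau>1(1)], of "gap_sign k (r \<tau>1)"]
      unfolding Gs by linarith
    have "continuous_on {0..\<tau>1} (\<lambda>\<tau>. gap_sign k (r \<tau>))"
    proof -
      have "1 + \<tau> * x \<noteq> 0" if "\<tau> \<in> {0..\<tau>1}" for \<tau>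
        using x1[of \<tau>] that \<tau>1 by auto
      then show ?thesis
        unfolding r_def radial_def gap_sign_def gap_denom_def by (intro continuous_intros) auto
    qed
    moreover have pos: "gap_sign k (r 0) > 0"
      by (simp add: r_def radial_def gap_sign_def gap_denom_def)
    ultimately obtain \<tau>0 where \<tau>0: "0 \<le> \<tau>0" "\<tau>0 \<le> \<tau>1" "gap_sign k (r \<tau>0) = 0"
      using IVT2'[of "\<lambda>\<tau>. gap_sign k (r \<tau>)" \<tau>1 0 0] neg \<tau>1(1) by auto
    then have \<tau>0': "0 < \<tau>0" "\<tau>0 \<le> 1"
      using pos \<tau>1(1) by (auto simp: order_less_le)
    have bpos: "b \<tau> > 0" if "0 < \<tau>" "\<tau> \<le> 1" for \<tau>
    proof -
      have "r \<tau> < 1"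
        using that x by (auto simp: r_def radial_def divide_less_eq add_pos_pos)
      then show ?thesis
        using r[of \<tau>] that by (auto simp: b_def base_weight_def r_def[symmetric] power_less_one_iff intro!: mult_pos_pos)
    qed
    define m where "m = v \<tau>0 / b \<tau>0"
    have "m \<ge> 0"
      using v(2)[of \<tau>0] bpos \<tau>0' by (simp add: m_def less_imp_le)
    moreover have "m * (b \<tau> * G \<tau>) \<le> v \<tau> * G \<tau>" if \<tau>: "\<tau> \<in> {0..1}" for \<tau>
    proof (cases "\<tau> = 0")
      case False
      then have \<tau>': "0 < \<tau>" "\<tau> \<le> 1"
        using \<tau> by auto
      show ?thesis
      proof (cases "\<tau> \<le> \<tau>0")
        case True
        then have "r \<tau>0 \<le> r \<tau>"
          unfolding r_def using \<tau>' x by (intro radial_antimono) auto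
        then have "gap_sign k (r \<tau>) \<ge> 0"
          using gap_sign_mono[OF k, of "r \<tau>0" "r \<tau>"] \<tau>0(3) r[OF \<tau>] r[of \<tau>0] \<tau>0' by auto
        then have "G \<tau> \<ge> 0"
          unfolding Gs by (rule mult_nonneg_nonneg[OF fac[OF \<tau>]])
        moreover have "m * b \<tau> \<le> v \<tau>"
          using ratio[OF \<tau>'(1) True \<tau>0'(2)] bpos[OF \<tau>0'] by (simp add: m_def b_def field_simps)
        ultimately show ?thesis
          using mult_right_mono[of "m * b \<tau>" "v \<tau>" "G \<tau>"] by (simp add: mult.assoc)
      next
        case False
        then have le: "\<tau>0 \<le> \<tau>"
          by simp
        then have "r \<tau> \<le> r \<tau>0"
          unfolding r_def using \<tau>0' x by (intro radial_antimono) auto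
        then have "gap_sign k (r \<tau>) \<le> 0"
          using gap_sign_mono[OF k, of "r \<tau>" "r \<tau>0"] \<tau>0(3) r[OF \<tau>] r[of \<tau>0] \<tau>0' by auto
        then have "G \<tau> \<le> 0"
          unfolding Gs by (rule mult_nonneg_nonpos[OF fac[OF \<tau>]])
        moreover have "v \<tau> \<le> m * b \<tau>"
          using ratio[OF \<tau>0'(1) le \<tau>'(2)] bpos[OF \<tau>0'] by (simp add: m_def b_def field_simps)
        ultimately show ?thesis
          using mult_right_mono_neg[of "v \<tau>" "m * b \<tau>" "G \<tau>"] by (simp add: mult.assoc)
      qed
    qed (simp add: G0)
    ultimately show ?thesis
      using that by blast
  qed
  have "0 \<le> (LINT \<tau>:{0..1}|lborel. m * (b \<tau> * G \<tau>))"
    using base_weight_gap_integral_nonneg[OF k x] m(1) by (simp add: G_def b_def r_def)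
  also have "\<dots> \<le> (LINT \<tau>:{0..1}|lborel. v \<tau> * G \<tau>)"
    by (rule set_integral_mono[OF b_int G_int m(2)])
  finally show ?thesis
    by (simp add: G_def r_def)
qed

section \<open>The density with moments ab/((n + a)(n + b))\<close>

text \<open>
  The multiplicative convolution of the densities \<open>a t\<^bsup>a-1\<^esup>\<close> and \<open>b t\<^bsup>b-1\<^esup>\<close> on \<open>[0, 1]\<close>; the case \<open>a = b\<close>
  is the limit \<open>b \<rightarrow> a\<close>.
\<close>

definition mellin_weight :: "real \<Rightarrow> real \<Rightarrow> real \<Rightarrow> real" where
  "mellin_weight a b t =
     a * b * t powr (a - 1) * (if a = b then - ln t else (t powr (b - a) - 1) / (a - b))"

lemma set_integral_01_FTC_nonneg:
  fixes f F :: "real \<Rightarrow> real"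
  assumes F: "\<And>t. 0 < t \<Longrightarrow> t < 1 \<Longrightarrow> DERIV F t :> f t"
    and f: "\<And>t. 0 < t \<Longrightarrow> t < 1 \<Longrightarrow> isCont f t" "\<And>t. 0 < t \<Longrightarrow> t < 1 \<Longrightarrow> 0 \<le> f t"
    and A: "(F \<longlongrightarrow> A) (at_right 0)" and B: "(F \<longlongrightarrow> B) (at_left 1)"
  shows "set_integrable lborel {0..1} f" "(LINT t:{0..1}|lborel. f t) = B - A"
proof -
  have A': "((F \<circ> real_of_ereal) \<longlongrightarrow> A) (at_right 0)"
    using A by (simp add: zero_ereal_def ereal_tendsto_simps)
  have B': "((F \<circ> real_of_ereal) \<longlongrightarrow> B) (at_left 1)"
    using B by (simp add: one_ereal_def ereal_tendsto_simps)
  have int: "set_integrable lborel (einterval 0 1) f" "(LBINT x=0..1. f x) = B - A"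
    using interval_integral_FTC_nonneg[of 0 1 F f, OF _ _ _ _ A' B'] F f by auto
  have "einterval 0 1 = {0<..<1::real}"
    by (auto simp: einterval_def)
  then have "set_integrable lborel {0<..<1} f"
    using int by simp
  moreover have "set_integrable lborel {0<..<1} f \<longleftrightarrow> set_integrable lborel {0..1} f"
    by (rule set_integrable_discrete_difference[where X = "{0, 1}"]) auto
  ultimately show "set_integrable lborel {0..1} f"
    by simp
  show "(LINT t:{0..1}|lborel. f t) = B - A"
    using int(2) interval_integral_Icc[of 0 1 f] by (simp add: zero_ereal_def one_ereal_def)
qed

lemma powr_integral_01:
  assumes p: "0 < (p :: real)"
  shows "set_integrable lborel {0..1} (\<lambda>t. t powr (p - 1))"
    and "(LINT t:{0..1}|lborel. t powr (p - 1)) = 1 / p"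
proof -
  define F where "F t = t powr p / p" for t :: real
  have F: "DERIV F t :> t powr (p - 1)" if "0 < t" for t
    unfolding F_def[abs_def] using that p by (auto intro!: derivative_eq_intros)
  have "((\<lambda>t. t powr p) \<longlongrightarrow> 0 powr p) (at_right 0)"
    using p by (intro tendsto_powr' tendsto_intros) (auto simp: eventually_at_filter)
  then have A: "(F \<longlongrightarrow> 0) (at_right 0)"
    unfolding F_def[abs_def] using tendsto_divide[OF _ tendsto_const, of "\<lambda>t. t powr p" 0 "at_right 0" p] p by simp
  have "isCont F 1"
    using F[of 1] DERIV_isCont by auto
  then have B: "(F \<longlongrightarrow> 1 / p) (at_left 1)"
    by (auto simp: isCont_def F_def intro: tendsto_mono[OF at_le])
  have c: "isCont (\<lambda>t. t powr (p - 1)) t" if "0 < t" for t :: real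
    using that by (intro continuous_intros) auto
  show "set_integrable lborel {0..1} (\<lambda>t. t powr (p - 1))"
    "(LINT t:{0..1}|lborel. t powr (p - 1)) = 1 / p"
    using set_integral_01_FTC_nonneg[of F "\<lambda>t. t powr (p - 1)", OF F _ _ A B] c by auto
qed

lemma powr_ln_integral_01:
  assumes p: "0 < (p :: real)"
  shows "set_integrable lborel {0..1} (\<lambda>t. t powr (p - 1) * - ln t)"
    and "(LINT t:{0..1}|lborel. t powr (p - 1) * - ln t) = 1 / p\<^sup>2"
proof -
  define F where "F t = t powr p / p\<^sup>2 - t powr p * ln t / p" for t :: real
  have F: "DERIV F t :> t powr (p - 1) * - ln t" if "0 < t" for t
    unfolding F_def[abs_def] using that p
    by (auto intro!: derivative_eq_intros simp: field_simps powr_diff power2_eq_square)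
  have A: "(F \<longlongrightarrow> 0) (at_right 0)"
    unfolding F_def[abs_def] using p by real_asymp
  have "isCont F 1"
    using F[of 1] DERIV_isCont by auto
  then have B: "(F \<longlongrightarrow> 1 / p\<^sup>2) (at_left 1)"
    by (auto simp: isCont_def F_def intro: tendsto_mono[OF at_le])
  have c: "isCont (\<lambda>t. t powr (p - 1) * - ln t) t" if "0 < t" for t :: real
    using that by (intro continuous_intros) auto
  have n: "0 \<le> t powr (p - 1) * - ln t" if "0 < t" "t < 1" for t :: real
    using that by (intro mult_nonneg_nonneg) (auto simp: ln_le_zero_iff)
  show "set_integrable lborel {0..1} (\<lambda>t. t powr (p - 1) * - ln t)"
    "(LINT t:{0..1}|lborel. t powr (p - 1) * - ln t) = 1 / p\<^sup>2"
    using set_integral_01_FTC_nonneg[of F "\<lambda>t. t powr (p - 1) * - ln t", OF F _ _ A B] c n by auto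
qed

lemma powr_mult_power:
  "0 \<le> t \<Longrightarrow> t powr (p - 1) * t ^ n = (t :: real) powr (real n + p - 1)"
  by (cases "t = 0") (auto simp: powr_realpow[symmetric] powr_add[symmetric] algebra_simps)

lemma powr_moment:
  assumes p: "0 < (p :: real)"
  shows "(LINT t:{0..1}|lborel. t powr (p - 1) * t ^ n) = 1 / (real n + p)"
proof -
  have "(LINT t:{0..1}|lborel. t powr (p - 1) * t ^ n) = (LINT t:{0..1}|lborel. t powr (real n + p - 1))"
    by (intro set_lebesgue_integral_cong) (auto simp: powr_mult_power)
  then show ?thesis
    using powr_integral_01(2)[of "real n + p"] p by simp
qed

lemma mellin_weight_moment:
  assumes ab: "0 < a" "0 < b"
  shows "set_integrable lborel {0..1} (mellin_weight a b)" (is ?I)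
    and "(LINT t:{0..1}|lborel. mellin_weight a b t * t ^ n) = a * b / ((real n + a) * (real n + b))" (is ?M)
proof -
  have "?I \<and> ?M"
  proof (cases "a = b")
    case True
    have "mellin_weight a b t * t ^ n = a * b * (t powr (real n + a - 1) * - ln t)" if "t \<in> {0..1}" for t n
      using that powr_mult_power[of t a n] True by (simp add: mellin_weight_def mult_ac)
    then have e: "(LINT t:{0..1}|lborel. mellin_weight a b t * t ^ n)
        = (LINT t:{0..1}|lborel. a * b * (t powr (real n + a - 1) * - ln t))"
      by (intro set_lebesgue_integral_cong) auto
    have "mellin_weight a b = (\<lambda>t. a * b * (t powr (a - 1) * - ln t))"
      using True by (auto simp: mellin_weight_def)
    moreover have "set_integrable lborel {0..1} \<dots>"
      using powr_ln_integral_01(1)[OF ab(1)] by (rule set_integrable_mult_right)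
    ultimately show ?thesis
      using e powr_ln_integral_01(2)[of "real n + a"] ab True by (simp only: set_integral_mult_right) (simp add: power2_eq_square)
  next
    case False
    have m: "mellin_weight a b t * t ^ n
        = a * b / (a - b) * (t powr (real n + b - 1) - t powr (real n + a - 1))" if "0 \<le> t" for t n
    proof -
      have "t powr (a - 1) * t powr (b - a) = t powr (b - 1)"
        by (simp add: powr_add[symmetric])
      then have "mellin_weight a b t = a * b / (a - b) * (t powr (b - 1) - t powr (a - 1))"
        using False by (simp add: mellin_weight_def algebra_simps diff_divide_distrib)
      then have "mellin_weight a b t * t ^ n = a * b / (a - b) * (t powr (b - 1) * t ^ n - t powr (a - 1) * t ^ n)"
        by (simp only: mult.assoc left_diff_distrib)
      then show ?thesis
        using that by (simp only: powr_mult_power)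
    qed
    have i: "set_integrable lborel {0..1} (\<lambda>t. t powr (real n + b - 1))" "set_integrable lborel {0..1} (\<lambda>t. t powr (real n + a - 1))" for n
      using powr_integral_01(1)[of "real n + b"] powr_integral_01(1)[of "real n + a"] ab by auto
    have "(LINT t:{0..1}|lborel. mellin_weight a b t * t ^ n)
        = (LINT t:{0..1}|lborel. a * b / (a - b) * (t powr (real n + b - 1) - t powr (real n + a - 1)))"
      using m by (intro set_lebesgue_integral_cong) auto
    also have "\<dots> = a * b / (a - b) * (1 / (real n + b) - 1 / (real n + a))"
      using i powr_integral_01(2)[of "real n + b"] powr_integral_01(2)[of "real n + a"] ab
      by (simp only: set_integral_mult_right set_integral_diff)
    also have "\<dots> = a * b / ((real n + a) * (real n + b))"
    proof -
      have "1 / (real n + b) - 1 / (real n + a) = (a - b) / ((real n + a) * (real n + b))"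
        using ab by (simp add: field_simps)
      then show ?thesis
        using False by simp
    qed
    finally have ?M .
    moreover have ?I
    proof -
      have "set_integrable lborel {0..1} (\<lambda>t. a * b / (a - b) * (t powr (real 0 + b - 1) - t powr (real 0 + a - 1)))"
        using i[of 0] by (intro set_integrable_mult_right set_integral_diff(1))
      also have "?this \<longleftrightarrow> ?I"
        using m[of _ 0] by (intro set_integrable_cong) auto
      finally show ?thesis .
    qed
    ultimately show ?thesis
      by simp
  qed
  then show ?I ?M
    by auto
qed

lemma mellin_weight_nonneg:
  assumes ab: "0 < b" "b \<le> a" and t: "0 < t" "t \<le> 1"
  shows "0 \<le> mellin_weight a b t"
proof (cases "a = b")
  case True
  then show ?thesis
    using ab t by (simp add: mellin_weight_def mult_nonneg_nonpos ln_le_zero_iff)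
next
  case False
  then have "1 \<le> t powr (b - a)"
    using ab t powr_mono2'[of "b - a" t 1] by simp
  then show ?thesis
    using ab False by (simp add: mellin_weight_def)
qed

text \<open>
  The quotient \<open>mellin_weight \<tau> / base_weight (\<tau>x)\<close> is a constant times a product \<open>h\<close> of five nonnegative
  decreasing functions. Four of them are elementary. The fifth, \<open>L\<close>, decreases because
  \<open>2E(t) \<le> t\<^bsup>b-a-1\<^esup>(1 - t\<^sup>2)\<close>, which follows from \<open>E(t) \<le> t\<^bsup>b-a\<^esup> ln(1/t)\<close> and \<open>2 ln(1/t) \<le> 1/t - t\<close>.
\<close>

lemma mellin_weight_ratio:
  assumes ab: "0 < b" "b \<le> a" "a \<le> 1" and x: "0 < x" "x < 1"
    and \<tau>: "0 < \<tau>1" "\<tau>1 \<le> \<tau>2" "\<tau>2 \<le> 1"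
  shows "mellin_weight a b \<tau>2 * base_weight (\<tau>1 * x) \<le> mellin_weight a b \<tau>1 * base_weight (\<tau>2 * x)"
proof (cases "\<tau>2 = 1")
  case True
  have "0 \<le> mellin_weight a b \<tau>1 * base_weight x"
    using \<tau> x radial_bounds[of x] mellin_weight_nonneg[OF ab(1,2), of \<tau>1]
    by (intro mult_nonneg_nonneg) (auto simp: base_weight_def power_le_one)
  moreover have "mellin_weight a b 1 = 0"
    by (simp add: mellin_weight_def)
  ultimately show ?thesis
    using True by simp
next
  case False
  define E where "E t = (if a = b then - ln t else (t powr (b - a) - 1) / (a - b))" for t
  define L where "L t = E t * ((1 + t) / (1 - t))" for t
  define h where "h t = t powr (a - 1) * ((1 + t)\<^sup>2 / t) * L t * ((1 - t) / (1 - t * x)) * ((1 + t * x) / (1 + t)) ^ 3" for t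
  have \<tau>': "\<tau>2 < 1" "0 < \<tau>2" "\<tau>1 < 1"
    using False \<tau> by auto
  have w: "mellin_weight a b t = a * b / (4 * x) * h t * base_weight (t * x)" if t: "0 < t" "t < 1" for t
  proof -
    have tx: "t * x < 1" "0 < t * x"
      using t x by (auto intro: le_less_trans[OF mult_left_le_one_le])
    have "base_weight (t * x) = 4 * (t * x) * (1 - t * x) / (1 + t * x) ^ 3"
    proof -
      have "1 - (radial (t * x))\<^sup>2 = 4 * (t * x) / (1 + t * x)\<^sup>2"
        using tx unfolding radial_def power_divide
        by (simp add: field_simps) (simp add: power2_eq_square algebra_simps)
      then show ?thesis
        using tx by (simp add: base_weight_def radial_def power2_eq_square power3_eq_cube mult_ac)
    qed
    moreover have "mellin_weight a b t = a * b * t powr (a - 1) * E t"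
      by (simp add: mellin_weight_def E_def)
    moreover have "h t = t powr (a - 1) * E t * ((1 + t * x) ^ 3 / (t * (1 - t * x)))"
      using t tx unfolding h_def L_def
      by (simp add: divide_simps) (simp add: power2_eq_square power3_eq_cube)
    ultimately show ?thesis
      using t tx x add_pos_pos[OF zero_less_one tx(2)] by simp
  qed
  have E0: "0 \<le> E t" if t: "0 < t" "t < 1" for t
    using mellin_weight_nonneg[OF ab(1,2), of t] ab t
    by (auto simp: mellin_weight_def E_def ln_le_zero_iff zero_le_mult_iff mult_le_0_iff)
  have E_le: "2 * E t \<le> t powr (b - a - 1) * (1 - t\<^sup>2)" if t: "0 < t" "t < 1" for t
  proof -
    have "E t \<le> t powr (b - a) * - ln t"
    proof (cases "a = b")
      case False
      have "ln (t powr (a - b)) \<le> t powr (a - b) - 1"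
        using t by (intro ln_le_minus_one) auto
      then have "1 - t powr (a - b) \<le> (a - b) * - ln t"
        using t by (simp add: ln_powr)
      then have "t powr (b - a) * (1 - t powr (a - b)) \<le> t powr (b - a) * ((a - b) * - ln t)"
        by (intro mult_left_mono) auto
      moreover have "t powr (b - a) * t powr (a - b) = 1"
        using t by (simp add: powr_add[symmetric])
      ultimately show ?thesis
        using False ab by (simp add: E_def field_simps)
    qed (use t in \<open>simp add: E_def\<close>)
    also have "\<dots> \<le> t powr (b - a) * ((1 / t - t) / 2)"
    proof (rule mult_left_mono)
      define K where "K t = 1 / t - t + 2 * ln t" for t :: real
      have "K 1 \<le> K t"
      proof (rule DERIV_nonpos_imp_nonincreasing[of t 1 K])
        fix y assume y: "t \<le> y" "y \<le> 1"
        have "(K has_real_derivative (- (1 / y\<^sup>2) - 1 + 2 / y)) (at y)"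
          unfolding K_def[abs_def] using y t
          by (auto intro!: derivative_eq_intros simp: power2_eq_square divide_inverse)
        moreover have "- (1 / y\<^sup>2) - 1 + 2 / y = - ((1 / y - 1)\<^sup>2)"
          using y t by (simp add: power2_eq_square field_simps)
        ultimately show "\<exists>z. DERIV K y :> z \<and> z \<le> 0"
          by auto
      qed (use t in simp)
      then show "- ln t \<le> (1 / t - t) / 2"
        by (simp add: K_def)
    qed simp
    also have "\<dots> = t powr (b - a - 1) * (1 - t\<^sup>2) / 2"
      using t powr_diff[of t "b - a" 1] by (simp add: power2_eq_square field_simps)
    finally show ?thesis
      by simp
  qed
  have L: "L \<tau>2 \<le> L \<tau>1"
  proof (rule DERIV_nonpos_imp_nonincreasing[OF \<tau>(2)])
    fix y assume "\<tau>1 \<le> y" "y \<le> \<tau>2"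
    then have y: "0 < y" "y < 1"
      using \<tau> \<tau>' by auto
    have dE: "(E has_real_derivative - (y powr (b - a - 1))) (at y)"
    proof (cases "a = b")
      case True
      then show ?thesis
        unfolding E_def[abs_def] using y
        by (auto intro!: derivative_eq_intros simp: powr_minus divide_inverse)
    next
      case False
      have "((\<lambda>t. (t powr (b - a) - 1) / (a - b)) has_real_derivative (b - a) * y powr (b - a - 1) / (a - b)) (at y)"
        using y False by (auto intro!: derivative_eq_intros)
      moreover have "(b - a) * y powr (b - a - 1) / (a - b) = - (y powr (b - a - 1))"
        using False by (simp add: field_simps)
      ultimately show ?thesis
        unfolding E_def[abs_def] using False by simp
    qed
    have "((\<lambda>t. (1 + t) / (1 - t)) has_real_derivative 2 / (1 - y)\<^sup>2) (at y)"
      using y by (auto intro!: derivative_eq_intros simp: power2_eq_square divide_simps)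
    from DERIV_mult[OF dE this]
    have "(L has_real_derivative (- (y powr (b - a - 1)) * ((1 + y) / (1 - y)) + 2 / (1 - y)\<^sup>2 * E y)) (at y)"
      unfolding L_def[abs_def] .
    moreover have "- (y powr (b - a - 1)) * ((1 + y) / (1 - y)) + 2 / (1 - y)\<^sup>2 * E y
        = (2 * E y - y powr (b - a - 1) * (1 - y\<^sup>2)) / (1 - y)\<^sup>2"
    proof -
      have "(1 + y) / (1 - y) = (1 - y\<^sup>2) / (1 - y)\<^sup>2"
      proof -
        have "1 - y\<^sup>2 = (1 + y) * (1 - y)"
          by (simp add: power2_eq_square algebra_simps)
        then show ?thesis
          using y by (simp only: power2_eq_square[of "1 - y"]) simp
      qed
      then show ?thesis
        by (simp add: diff_divide_distrib[of "2 * E y" "y powr (b - a - 1) * (1 - y\<^sup>2)"])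
    qed
    ultimately show "\<exists>z. DERIV L y :> z \<and> z \<le> 0"
      using E_le[OF y] by (auto intro!: exI divide_nonpos_nonneg)
  qed
  have L0: "0 \<le> L t" if "0 < t" "t < 1" for t
    using E0[OF that] that by (simp add: L_def)
  have tx: "t * x < 1" "0 < t * x" if "0 < t" "t < 1" for t
    using that x by (auto intro: le_less_trans[OF mult_left_le_one_le])
  note tx1 = tx[OF \<tau>(1) \<tau>'(3)] and tx2 = tx[OF \<tau>'(2) \<tau>'(1)]
  have h: "h \<tau>2 \<le> h \<tau>1"
  proof -
    have "\<tau>2 powr (a - 1) \<le> \<tau>1 powr (a - 1)"
      using ab \<tau> by (intro powr_mono2') auto
    moreover have "(1 + \<tau>2)\<^sup>2 / \<tau>2 \<le> (1 + \<tau>1)\<^sup>2 / \<tau>1"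
    proof -
      have "0 \<le> (\<tau>2 - \<tau>1) * (1 - \<tau>1 * \<tau>2)"
        using \<tau> \<tau>' by (intro mult_nonneg_nonneg) (auto simp: mult_le_one)
      then show ?thesis
        using \<tau> \<tau>' by (simp add: field_simps power2_eq_square)
    qed
    moreover have "(1 - \<tau>2) / (1 - \<tau>2 * x) \<le> (1 - \<tau>1) / (1 - \<tau>1 * x)"
    proof -
      have "0 \<le> (\<tau>2 - \<tau>1) * (1 - x)"
        using \<tau> x by (intro mult_nonneg_nonneg) auto
      then show ?thesis
        using tx1 tx2 by (simp add: field_simps)
    qed
    moreover have "((1 + \<tau>2 * x) / (1 + \<tau>2)) ^ 3 \<le> ((1 + \<tau>1 * x) / (1 + \<tau>1)) ^ 3"
    proof (rule power_mono)
      have "0 \<le> (\<tau>2 - \<tau>1) * (1 - x)"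
        using \<tau> x by (intro mult_nonneg_nonneg) auto
      then show "(1 + \<tau>2 * x) / (1 + \<tau>2) \<le> (1 + \<tau>1 * x) / (1 + \<tau>1)"
        using \<tau> \<tau>' by (simp add: field_simps)
    qed (use \<tau>' tx2 in auto)
    moreover have "0 \<le> t powr (a - 1)" "0 \<le> (1 + t)\<^sup>2 / t" "0 \<le> (1 - t) / (1 - t * x)" "0 \<le> ((1 + t * x) / (1 + t)) ^ 3"
      if "0 < t" "t < 1" for t
      using that tx[OF that] by simp_all
    note nonneg1 = this[OF \<tau>(1) \<tau>'(3)] L0[OF \<tau>(1) \<tau>'(3)] and nonneg2 = this[OF \<tau>'(2,1)] L0[OF \<tau>'(2,1)]
    ultimately show ?thesis
      unfolding h_def by (intro mult_mono mult_nonneg_nonneg L nonneg1 nonneg2)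
  qed
  have bw: "0 \<le> base_weight (t * x)" if "0 < t" "t < 1" for t
    using radial_bounds[of "t * x"] tx[OF that] by (simp add: base_weight_def power_le_one)
  have "a * b / (4 * x) * (base_weight (\<tau>1 * x) * base_weight (\<tau>2 * x)) * h \<tau>2
     \<le> a * b / (4 * x) * (base_weight (\<tau>1 * x) * base_weight (\<tau>2 * x)) * h \<tau>1"
    using ab x \<tau> \<tau>' bw by (intro mult_left_mono h mult_nonneg_nonneg divide_nonneg_nonneg) auto
  then show ?thesis
    unfolding w[OF \<tau>(1) \<tau>'(3)] w[OF \<tau>'(2) \<tau>'(1)] by (simp only: mult_ac)
qed

section \<open>The kernel inequality for power series\<close>

text \<open>
  The series of the norms of the coefficients dominates the power series on all of \<open>[0, 1]\<close>, so that sum and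
  integral may be interchanged for any integrable weight.
\<close>

lemma power_series_moments:
  fixes c :: "nat \<Rightarrow> 'a::{banach, second_countable_topology}" and v :: "real \<Rightarrow> real"
  assumes v: "set_integrable lborel {0..1} v" and c: "summable (\<lambda>n. norm (c n))"
  shows "set_integrable lborel {0..1} (\<lambda>t. v t *\<^sub>R (\<Sum>n. t ^ n *\<^sub>R c n))"
    and "(\<lambda>n. (LINT t:{0..1}|lborel. v t * t ^ n) *\<^sub>R c n) sums (LINT t:{0..1}|lborel. v t *\<^sub>R (\<Sum>n. t ^ n *\<^sub>R c n))"
proof -
  define V where "V t = indicat_real {0..1} t * v t" for t
  define f where "f n t = V t *\<^sub>R (t ^ n *\<^sub>R c n)" for n t
  have V: "integrable lborel V"
    using v by (simp add: V_def[abs_def] set_integrable_def)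
  have vn: "set_integrable lborel {0..1} (\<lambda>t. v t * t ^ n)" for n
    using set_integrable_scaleR_continuous[OF v, of "\<lambda>t. t ^ n"] by (simp add: continuous_intros)
  have fI: "integrable lborel (f n)" for n
    using integrable_scaleR_left[OF vn[of n, unfolded set_integrable_def], of "c n"]
    by (simp add: f_def[abs_def] V_def mult.assoc)
  have le: "norm (f n t) \<le> \<bar>V t\<bar> * norm (c n)" for n t
  proof (cases "t \<in> {0..1}")
    case True
    then have "\<bar>V t\<bar> * (t ^ n * norm (c n)) \<le> \<bar>V t\<bar> * (1 * norm (c n))"
      by (intro mult_left_mono mult_right_mono) (auto simp: power_le_one)
    then show ?thesis
      using True by (simp add: f_def abs_mult)
  qed (simp add: f_def V_def)
  have s1: "summable (\<lambda>n. norm (f n t))" for t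
    using c le by (intro summable_comparison_test[OF _ summable_mult[OF c, of "\<bar>V t\<bar>"]]) auto
  have "(\<integral>t. norm (f n t) \<partial>lborel) \<le> (\<integral>t. \<bar>V t\<bar> * norm (c n) \<partial>lborel)" for n
    using le V fI by (intro integral_mono) auto
  then have s2: "summable (\<lambda>n. \<integral>t. norm (f n t) \<partial>lborel)"
    by (intro summable_comparison_test[OF _ summable_mult[OF c, of "\<integral>t. \<bar>V t\<bar> \<partial>lborel"]]) auto
  have sum_f: "(\<Sum>n. f n t) = indicat_real {0..1} t *\<^sub>R (v t *\<^sub>R (\<Sum>n. t ^ n *\<^sub>R c n))" for t
  proof (cases "t \<in> {0..1}")
    case True
    have "summable (\<lambda>n. t ^ n *\<^sub>R c n)"
      using True by (intro summable_comparison_test[OF _ c]) (auto simp: mult_left_le_one_le power_le_one)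
    then show ?thesis
      using True by (simp add: f_def V_def suminf_scaleR_right)
  qed (simp add: f_def V_def)
  have "integrable lborel (\<lambda>t. \<Sum>n. f n t)"
    by (rule integrable_suminf[OF fI AE_I2[OF s1] s2])
  then show "set_integrable lborel {0..1} (\<lambda>t. v t *\<^sub>R (\<Sum>n. t ^ n *\<^sub>R c n))"
    by (simp add: set_integrable_def sum_f)
  have "(\<lambda>n. integral\<^sup>L lborel (f n)) sums (\<integral>t. (\<Sum>n. f n t) \<partial>lborel)"
    by (rule sums_integral[OF fI AE_I2[OF s1] s2])
  moreover have "integral\<^sup>L lborel (f n) = (LINT t:{0..1}|lborel. v t * t ^ n) *\<^sub>R c n" for n
    using integral_scaleR_left[of "c n" lborel "\<lambda>t. indicat_real {0..1} t *\<^sub>R (v t * t ^ n)"] vn[of n]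
    by (simp add: f_def[abs_def] V_def set_lebesgue_integral_def set_integrable_def mult.assoc)
  ultimately show "(\<lambda>n. (LINT t:{0..1}|lborel. v t * t ^ n) *\<^sub>R c n) sums (LINT t:{0..1}|lborel. v t *\<^sub>R (\<Sum>n. t ^ n *\<^sub>R c n))"
    by (simp add: set_lebesgue_integral_def sum_f)
qed

lemma starlike_kernel_sums:
  fixes \<kappa> y :: "'a::{real_normed_field, banach}"
  assumes y: "norm y < 1"
  shows "(\<lambda>n. (1 + \<kappa> * of_nat n) * y ^ n) sums starlike_kernel \<kappa> y"
    and "summable (\<lambda>n. norm ((1 + \<kappa> * of_nat n) * y ^ n))"
proof -
  have nz: "1 - y \<noteq> 0"
    using y by auto
  have "(\<lambda>n. y ^ n + \<kappa> * (of_nat (Suc n) * y ^ n - y ^ n)) sums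
      (1 / (1 - y) + \<kappa> * (1 / (1 - y)\<^sup>2 - 1 / (1 - y)))"
    by (intro sums_add sums_mult sums_diff geometric_sums geometric_deriv_sums y)
  moreover have "1 / (1 - y)\<^sup>2 - 1 / (1 - y) = y / (1 - y)\<^sup>2"
  proof -
    have "1 / (1 - y) = (1 - y) / (1 - y)\<^sup>2"
      using nz by (simp add: power2_eq_square)
    then show ?thesis
      by (simp only: diff_divide_distrib[symmetric]) simp
  qed
  ultimately show "(\<lambda>n. (1 + \<kappa> * of_nat n) * y ^ n) sums starlike_kernel \<kappa> y"
    by (simp add: starlike_kernel_def algebra_simps)
  have "summable (\<lambda>n. norm y ^ n + norm \<kappa> * (of_nat (Suc n) * norm y ^ n))"
    using y by (intro summable_add summable_mult sums_summable[OF geometric_sums] sums_summable[OF geometric_deriv_sums]) auto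
  then show "summable (\<lambda>n. norm ((1 + \<kappa> * of_nat n) * y ^ n))"
  proof (rule summable_comparison_test[rotated], intro exI allI impI)
    fix n
    have "norm (1 + \<kappa> * of_nat n) \<le> 1 + norm \<kappa> * real (Suc n)"
    proof -
      have "norm (1 + \<kappa> * of_nat n) \<le> 1 + norm \<kappa> * real n"
        by (rule order_trans[OF norm_triangle_ineq]) (simp add: norm_mult)
      moreover have "norm \<kappa> * real n \<le> norm \<kappa> * real (Suc n)"
        by (intro mult_left_mono) auto
      ultimately show ?thesis
        by linarith
    qed
    then have "norm (1 + \<kappa> * of_nat n) * norm y ^ n \<le> (1 + norm \<kappa> * real (Suc n)) * norm y ^ n"
      by (intro mult_right_mono) auto
    then show "norm (norm ((1 + \<kappa> * of_nat n) * y ^ n)) \<le> norm y ^ n + norm \<kappa> * (of_nat (Suc n) * norm y ^ n)"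
      unfolding real_norm_def abs_norm_cancel norm_mult[of _ "y ^ n"] norm_power
      by (simp add: algebra_simps)
  qed
qed

text \<open>
  In the variable \<open>u = 1/(1 + y)\<close>, which lies in \<open>[1/2, 1]\<close>, the kernel is \<open>(1 - s)u + su\<^sup>2\<close>, whose derivative
  is at least \<open>1\<close> there.
\<close>

lemma starlike_kernel_real_antimono:
  fixes s :: real
  assumes "0 \<le> s" "0 \<le> y1" "y1 \<le> y2" "y2 \<le> 1"
  shows "starlike_kernel s (- y2) \<le> starlike_kernel s (- y1)"
proof -
  define u1 u2 where "u1 = 1 / (1 + y1)" and "u2 = 1 / (1 + y2)"
  have e: "starlike_kernel s (- y) = (1 - s) * (1 / (1 + y)) + s * (1 / (1 + y))\<^sup>2" if "0 \<le> y" for y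
  proof -
    define q where "q = 1 + y"
    have q: "q > 0" "y = q - 1"
      using that by (auto simp: q_def)
    have "starlike_kernel s (- y) = 1 / q - s * (q - 1) / q\<^sup>2"
      unfolding starlike_kernel_def q(2) by (simp add: algebra_simps diff_divide_distrib)
    also have "\<dots> = (1 - s) * (1 / q) + s * (1 / q)\<^sup>2"
      using q(1) by (simp add: field_simps power2_eq_square)
    finally show ?thesis
      by (simp add: q_def)
  qed
  have u: "u2 \<le> u1" "1/2 \<le> u2"
    using assms by (auto simp: u1_def u2_def field_simps)
  then have "s * (u1 + u2 - 1) \<ge> 0"
    using assms by simp
  then have "0 \<le> (u1 - u2) * (1 + s * (u1 + u2 - 1))"
    using u by simp
  also have "\<dots> = starlike_kernel s (- y1) - starlike_kernel s (- y2)"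
    using assms by (simp add: e u1_def[symmetric] u2_def[symmetric]) (simp add: power2_eq_square algebra_simps)
  finally show ?thesis
    by simp
qed

text \<open>
  The core of the proof. The factors \<open>ab/((n + a)(n + b))\<close> are the moments of \<open>mellin_weight\<close>, so the sum
  is the integral of \<open>\<Delta>(\<tau>) = Re E\<^sub>\<kappa>(\<tau>\<zeta>) - E\<^sub>s(-\<tau>t)\<close> against this density. Passing from \<open>t\<close> to \<open>|\<zeta>|\<close>
  decreases \<open>\<Delta>\<close>, and what is left is bounded below by the gap.
\<close>

lemma Re_mellin_series_ge:
  fixes a b s t :: real and \<kappa> \<zeta> :: complex
  assumes ab: "0 < b" "b \<le> a" "a \<le> 1" and s: "0 \<le> s" "s \<le> 4/3"
    and \<kappa>: "norm (\<kappa> - s / 2) \<le> s / 2" and t: "norm \<zeta> \<le> t" "t < 1"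
  shows "0 \<le> (\<Sum>n. a * b / ((real n + a) * (real n + b)) * (Re ((1 + \<kappa> * of_nat n) * \<zeta> ^ n) - (1 + s * real n) * (- t) ^ n))"
proof -
  define c where "c n = Re ((1 + \<kappa> * of_nat n) * \<zeta> ^ n) - (1 + s * real n) * (- t) ^ n" for n
  define \<Delta> where "\<Delta> \<tau> = Re (starlike_kernel \<kappa> (of_real \<tau> * \<zeta>)) - starlike_kernel s (- (\<tau> * t))" for \<tau> :: real
  define w where "w = mellin_weight a b"
  define x where "x = norm \<zeta>"
  have a: "0 < a"
    using ab by simp
  note w_int = mellin_weight_moment(1)[OF a ab(1), folded w_def]
  have t0: "0 \<le> t" "norm \<zeta> < 1"
    using t by (auto intro: order_trans[OF norm_ge_zero])
  have sum_c: "summable (\<lambda>n. norm (c n))"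
  proof (rule summable_comparison_test)
    show "summable (\<lambda>n. norm ((1 + \<kappa> * of_nat n) * \<zeta> ^ n) + norm ((1 + s * of_nat n) * (- t) ^ n))"
      using t t0 by (intro summable_add starlike_kernel_sums(2)) auto
    show "\<exists>N. \<forall>n\<ge>N. norm (norm (c n)) \<le> norm ((1 + \<kappa> * of_nat n) * \<zeta> ^ n) + norm ((1 + s * of_nat n) * (- t) ^ n)"
    proof (intro exI allI impI)
      fix n
      show "norm (norm (c n)) \<le> norm ((1 + \<kappa> * of_nat n) * \<zeta> ^ n) + norm ((1 + s * of_nat n) * (- t) ^ n)"
        unfolding c_def real_norm_def abs_abs using abs_Re_le_cmod[of "(1 + \<kappa> * of_nat n) * \<zeta> ^ n"]
        by (intro order_trans[OF abs_triangle_ineq4] add_mono) auto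
    qed
  qed
  have \<Delta>: "(\<Sum>n. \<tau> ^ n *\<^sub>R c n) = \<Delta> \<tau>" if \<tau>: "\<tau> \<in> {0..1}" for \<tau>
  proof -
    have n1: "norm (of_real \<tau> * \<zeta>) < 1" "norm (- (\<tau> * t)) < 1"
      using \<tau> t t0 by (auto simp: norm_mult abs_mult intro: le_less_trans[OF mult_left_le_one_le])
    have "(\<lambda>n. Re ((1 + \<kappa> * of_nat n) * (of_real \<tau> * \<zeta>) ^ n) - (1 + s * real n) * (- (\<tau> * t)) ^ n) sums \<Delta> \<tau>"
      unfolding \<Delta>_def by (intro sums_diff sums_Re starlike_kernel_sums(1) n1)
    moreover have "Re ((1 + \<kappa> * of_nat n) * (of_real \<tau> * \<zeta>) ^ n) - (1 + s * real n) * (- (\<tau> * t)) ^ n = \<tau> ^ n *\<^sub>R c n" for n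
    proof -
      have "(1 + \<kappa> * of_nat n) * (of_real \<tau> * \<zeta>) ^ n = \<tau> ^ n *\<^sub>R ((1 + \<kappa> * of_nat n) * \<zeta> ^ n)"
        by (simp add: power_mult_distrib scaleR_conv_of_real mult_ac)
      moreover have "(- (\<tau> * t)) ^ n = \<tau> ^ n * (- t) ^ n"
        by (simp flip: power_mult_distrib)
      ultimately show ?thesis
        unfolding c_def by (simp only: scaleR_complex.sel real_scaleR_def) (simp add: algebra_simps)
    qed
    ultimately show ?thesis
      by (simp add: sums_iff)
  qed
  note moments = power_series_moments[OF w_int sum_c]
  have int: "set_integrable lborel {0..1} (\<lambda>\<tau>. w \<tau> * \<Delta> \<tau>)"
    using moments(1) \<Delta> by (subst set_integrable_cong[OF refl refl, of _ _ "\<lambda>\<tau>. w \<tau> *\<^sub>R (\<Sum>n. \<tau> ^ n *\<^sub>R c n)"]) auto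
  have "(LINT \<tau>:{0..1}|lborel. w \<tau> *\<^sub>R (\<Sum>n. \<tau> ^ n *\<^sub>R c n)) = (LINT \<tau>:{0..1}|lborel. w \<tau> * \<Delta> \<tau>)"
    using \<Delta> by (intro set_lebesgue_integral_cong) auto
  then have sums: "(\<lambda>n. a * b / ((real n + a) * (real n + b)) * c n) sums (LINT \<tau>:{0..1}|lborel. w \<tau> * \<Delta> \<tau>)"
    using moments(2) mellin_weight_moment(2)[OF a ab(1)] by (simp add: w_def)
  have w0: "0 \<le> w \<tau>" if "0 < \<tau>" "\<tau> \<le> 1" for \<tau>
    unfolding w_def by (rule mellin_weight_nonneg[OF ab(1,2) that])
  have w00: "w 0 = 0"
    by (simp add: w_def mellin_weight_def)
  have "0 \<le> (LINT \<tau>:{0..1}|lborel. w \<tau> * \<Delta> \<tau>)"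
  proof (cases "\<zeta> = 0")
    case True
    have "0 \<le> w \<tau> * \<Delta> \<tau>" if "\<tau> \<in> {0..1}" for \<tau>
    proof (cases "\<tau> = 0")
      case False
      have "starlike_kernel s (- (\<tau> * t)) \<le> starlike_kernel s (- 0)"
        using that t t0 by (intro starlike_kernel_real_antimono s) (auto simp: mult_le_one)
      then show ?thesis
        using False that w0[of \<tau>] True by (intro mult_nonneg_nonneg) (auto simp: \<Delta>_def starlike_kernel_def)
    qed (simp add: w00)
    then show ?thesis
      unfolding set_lebesgue_integral_def by (intro integral_nonneg_AE AE_I2) (auto simp: indicator_def)
  next
    case False
    then have x: "0 < x" "x < 1"
      using t0 by (auto simp: x_def)
    define k where "k = (1 + Re \<zeta> / x) / 2"
    have "\<bar>Re \<zeta> / x\<bar> \<le> 1"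
      using abs_Re_le_cmod[of \<zeta>] x by (simp add: x_def)
    then have "- 1 \<le> Re \<zeta> / x" "Re \<zeta> / x \<le> 1"
      by linarith+
    then have k: "0 \<le> k" "k \<le> 1"
      by (simp_all add: k_def)
    have Re: "Re \<zeta> = x * (2 * k - 1)"
      using x by (simp add: k_def field_simps)
    have ge: "w \<tau> * (3 * s / 4 * gap_bound k (radial (\<tau> * x))) \<le> w \<tau> * \<Delta> \<tau>" if \<tau>: "\<tau> \<in> {0..1}" for \<tau>
    proof (cases "\<tau> = 0")
      case False
      have \<tau>x: "\<tau> * x < 1"
        using \<tau> x by (auto intro: le_less_trans[OF mult_left_le_one_le])
      have "3 * s / 4 * gap_bound k (radial (\<tau> * x)) \<le> Re (starlike_kernel \<kappa> (of_real \<tau> * \<zeta>)) - starlike_kernel s (- (\<tau> * x))"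
        by (rule starlike_kernel_gap[OF s \<kappa> _ _ _ k])
           (use \<tau> \<tau>x Re in \<open>auto simp: x_def norm_mult radial_def\<close>)
      moreover have "starlike_kernel s (- (\<tau> * t)) \<le> starlike_kernel s (- (\<tau> * x))"
        using \<tau> t t0 x by (intro starlike_kernel_real_antimono s) (auto simp: mult_le_one x_def mult_left_mono)
      ultimately have "3 * s / 4 * gap_bound k (radial (\<tau> * x)) \<le> \<Delta> \<tau>"
        unfolding \<Delta>_def by linarith
      then show ?thesis
        using False \<tau> w0[of \<tau>] by (intro mult_left_mono) auto
    qed (simp add: w00)
    have "0 \<le> 3 * s / 4 * (LINT \<tau>:{0..1}|lborel. w \<tau> * gap_bound k (radial (\<tau> * x)))"
      unfolding w_def using s
      by (intro mult_nonneg_nonneg weighted_gap_integral_nonneg[OF k x w_int[unfolded w_def]]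
          mellin_weight_ratio[OF ab x] mellin_weight_nonneg[OF ab(1,2)]) auto
    also have "\<dots> = (LINT \<tau>:{0..1}|lborel. w \<tau> * (3 * s / 4 * gap_bound k (radial (\<tau> * x))))"
      by (subst set_integral_mult_right[symmetric]) (simp add: mult_ac)
    also have "\<dots> \<le> (LINT \<tau>:{0..1}|lborel. w \<tau> * \<Delta> \<tau>)"
    proof (rule set_integral_mono[OF _ int ge])
      have "set_integrable lborel {0..1} (\<lambda>\<tau>. w \<tau> *\<^sub>R (3 * s / 4 * gap_bound k (radial (\<tau> * x))))"
        using x by (intro set_integrable_scaleR_continuous w_int continuous_intros gap_bound_continuous k) auto
      then show "set_integrable lborel {0..1} (\<lambda>\<tau>. w \<tau> * (3 * s / 4 * gap_bound k (radial (\<tau> * x))))"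
        by simp
    qed
    finally show ?thesis .
  qed
  then show ?thesis
    using sums unfolding c_def[symmetric] by (simp add: sums_iff)
qed

section \<open>Double integrals and decreasing weights\<close>

text \<open>
  Evaluates the double integrals in the definitions of \<open>g\<close> and \<open>q\<close>: expanding \<open>\<phi>\<close> in its power series
  lets the two integrations act separately on \<open>s\<^sup>n\<close> and \<open>w\<^sup>n\<close>.
\<close>

lemma mellin_double_integral:
  fixes \<phi> :: "real \<Rightarrow> real" and c :: "nat \<Rightarrow> real"
  assumes ab: "0 < a" "0 < b" and t: "0 \<le> t" "t < 1"
    and \<phi>: "\<And>y. 0 \<le> y \<Longrightarrow> y < 1 \<Longrightarrow> (\<lambda>n. c n * (- y) ^ n) sums \<phi> y"
    and c: "\<And>y. 0 \<le> y \<Longrightarrow> y < 1 \<Longrightarrow> summable (\<lambda>n. \<bar>c n\<bar> * y ^ n)"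
  shows "(\<lambda>n. c n * (- t) ^ n / ((real n + a) * (real n + b))) sums
    (LINT s:{0..1}|lborel. LINT w:{0..1}|lborel. \<phi> (s * w * t) * s powr (a - 1) * w powr (b - 1))"
proof -
  have sc: "summable (\<lambda>n. norm (c n * (- y) ^ n))" if "0 \<le> y" "y < 1" for y
    using c[OF that] that by (simp add: abs_mult power_abs)
  have inner: "(\<lambda>n. s ^ n *\<^sub>R (c n * (- t) ^ n / (real n + b))) sums
      (LINT w:{0..1}|lborel. \<phi> (s * w * t) * w powr (b - 1))" if s: "s \<in> {0..1}" for s
  proof -
    have st: "0 \<le> s * t" "s * t < 1"
      using s t by (auto intro: le_less_trans[OF mult_left_le_one_le])
    have "(\<lambda>n. (LINT w:{0..1}|lborel. w powr (b - 1) * w ^ n) *\<^sub>R (c n * (- (s * t)) ^ n)) sums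
        (LINT w:{0..1}|lborel. w powr (b - 1) *\<^sub>R (\<Sum>n. w ^ n *\<^sub>R (c n * (- (s * t)) ^ n)))"
      by (rule power_series_moments(2)[OF powr_integral_01(1)[OF ab(2)] sc[OF st]])
    also have "(LINT w:{0..1}|lborel. w powr (b - 1) *\<^sub>R (\<Sum>n. w ^ n *\<^sub>R (c n * (- (s * t)) ^ n)))
        = (LINT w:{0..1}|lborel. \<phi> (s * w * t) * w powr (b - 1))"
    proof (intro set_lebesgue_integral_cong allI impI)
      fix w :: real assume w: "w \<in> {0..1}"
      have "0 \<le> s * w * t" "s * w * t < 1"
        using s w t st mult_left_le_one_le[of "s * t" w] by (auto simp: mult_ac)
      from \<phi>[OF this] have "(\<Sum>n. w ^ n *\<^sub>R (c n * (- (s * t)) ^ n)) = \<phi> (s * w * t)"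
        by (simp add: sums_iff mult_ac flip: power_mult_distrib)
      then show "w powr (b - 1) *\<^sub>R (\<Sum>n. w ^ n *\<^sub>R (c n * (- (s * t)) ^ n)) = \<phi> (s * w * t) * w powr (b - 1)"
        by simp
    qed auto
    finally have "(\<lambda>n. (1 / (real n + b)) *\<^sub>R (c n * (- (s * t)) ^ n)) sums
        (LINT w:{0..1}|lborel. \<phi> (s * w * t) * w powr (b - 1))"
      by (simp only: powr_moment[OF ab(2)])
    moreover have "(- (s * t)) ^ n = s ^ n * (- t) ^ n" for n
      by (simp flip: power_mult_distrib)
    ultimately show ?thesis
      by (simp add: mult_ac)
  qed
  have "summable (\<lambda>n. norm (c n * (- t) ^ n / (real n + b)))"
  proof (rule summable_comparison_test[OF _ summable_mult[OF sc[OF t], of "1 / b"]], intro exI allI impI)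
    fix n
    have "\<bar>c n * (- t) ^ n\<bar> / (real n + b) \<le> \<bar>c n * (- t) ^ n\<bar> / b"
      using ab by (intro divide_left_mono) auto
    then show "norm (norm (c n * (- t) ^ n / (real n + b))) \<le> 1 / b * norm (c n * (- t) ^ n)"
      using ab by simp
  qed
  then have "(\<lambda>n. (LINT s:{0..1}|lborel. s powr (a - 1) * s ^ n) *\<^sub>R (c n * (- t) ^ n / (real n + b))) sums
      (LINT s:{0..1}|lborel. s powr (a - 1) *\<^sub>R (\<Sum>n. s ^ n *\<^sub>R (c n * (- t) ^ n / (real n + b))))"
    by (rule power_series_moments(2)[OF powr_integral_01(1)[OF ab(1)]])
  also have "(LINT s:{0..1}|lborel. s powr (a - 1) *\<^sub>R (\<Sum>n. s ^ n *\<^sub>R (c n * (- t) ^ n / (real n + b))))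
     = (LINT s:{0..1}|lborel. LINT w:{0..1}|lborel. \<phi> (s * w * t) * s powr (a - 1) * w powr (b - 1))"
  proof (intro set_lebesgue_integral_cong allI impI)
    fix s :: real assume s: "s \<in> {0..1}"
    have "(LINT w:{0..1}|lborel. \<phi> (s * w * t) * s powr (a - 1) * w powr (b - 1))
        = (LINT w:{0..1}|lborel. s powr (a - 1) * (\<phi> (s * w * t) * w powr (b - 1)))"
      by (simp add: mult_ac)
    then show "s powr (a - 1) *\<^sub>R (\<Sum>n. s ^ n *\<^sub>R (c n * (- t) ^ n / (real n + b)))
        = (LINT w:{0..1}|lborel. \<phi> (s * w * t) * s powr (a - 1) * w powr (b - 1))"
      using inner[OF s] by (simp only: set_integral_mult_right) (simp add: sums_iff)
  qed auto
  finally show ?thesis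
    unfolding powr_moment[OF ab(1)] by simp
qed

text \<open>
  Used for the boundedness of \<open>g\<close> and \<open>q\<close> on \<open>[0, 1)\<close>, where the coefficients of the series need not be
  absolutely summable: the sum is a mean of values of \<open>\<phi>\<close>.
\<close>

lemma mellin_series_bound:
  fixes \<phi> :: "real \<Rightarrow> real" and c :: "nat \<Rightarrow> real"
  assumes ab: "0 < b" "b \<le> a" and t: "0 \<le> t" "t < 1"
    and \<phi>: "\<And>y. 0 \<le> y \<Longrightarrow> y < 1 \<Longrightarrow> (\<lambda>n. c n * (- y) ^ n) sums \<phi> y"
    and c: "\<And>y. 0 \<le> y \<Longrightarrow> y < 1 \<Longrightarrow> summable (\<lambda>n. \<bar>c n\<bar> * y ^ n)"
    and B: "\<And>y. 0 \<le> y \<Longrightarrow> y < 1 \<Longrightarrow> \<bar>\<phi> y\<bar> \<le> B"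
  shows "\<bar>\<Sum>n. a * b / ((real n + a) * (real n + b)) * (c n * (- t) ^ n)\<bar> \<le> B"
proof -
  define w where "w = mellin_weight a b"
  have a: "0 < a"
    using ab by simp
  note w_int = mellin_weight_moment(1)[OF a ab(1), folded w_def]
  have "summable (\<lambda>n. norm (c n * (- t) ^ n))"
    using c[OF t] t by (simp add: abs_mult power_abs)
  note moments = power_series_moments[OF w_int this]
  have \<phi>t: "(\<Sum>n. \<tau> ^ n *\<^sub>R (c n * (- t) ^ n)) = \<phi> (\<tau> * t)" "\<bar>\<phi> (\<tau> * t)\<bar> \<le> B" if \<tau>: "\<tau> \<in> {0..1}" for \<tau>
  proof -
    have "0 \<le> \<tau> * t" "\<tau> * t < 1"
      using \<tau> t by (auto intro: le_less_trans[OF mult_left_le_one_le])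
    from \<phi>[OF this] B[OF this] show "(\<Sum>n. \<tau> ^ n *\<^sub>R (c n * (- t) ^ n)) = \<phi> (\<tau> * t)" "\<bar>\<phi> (\<tau> * t)\<bar> \<le> B"
      by (simp_all add: sums_iff mult_ac flip: power_mult_distrib)
  qed
  have w0: "0 \<le> w \<tau>" if "\<tau> \<in> {0..1}" for \<tau>
    using mellin_weight_nonneg[OF ab, of \<tau>] that by (cases "\<tau> = 0") (auto simp: w_def mellin_weight_def)
  define f where "f \<tau> = w \<tau> *\<^sub>R (\<Sum>n. \<tau> ^ n *\<^sub>R (c n * (- t) ^ n))" for \<tau>
  have f: "\<bar>f \<tau>\<bar> \<le> B * w \<tau>" if "\<tau> \<in> {0..1}" for \<tau>
    using \<phi>t[OF that] w0[OF that] mult_right_mono[of "\<bar>\<phi> (\<tau> * t)\<bar>" B "w \<tau>"]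
    by (simp add: f_def abs_mult mult_ac)
  have f_int: "set_integrable lborel {0..1} f"
    using moments(1) by (simp add: f_def[abs_def])
  have w1: "(LINT \<tau>:{0..1}|lborel. w \<tau>) = 1"
    using mellin_weight_moment(2)[OF a ab(1), of 0] ab by (simp add: w_def)
  have Bw: "set_integrable lborel {0..1} (\<lambda>\<tau>. B * w \<tau>)" "set_integrable lborel {0..1} (\<lambda>\<tau>. - B * w \<tau>)"
    using set_integrable_mult_right[OF w_int, of B] set_integrable_mult_right[OF w_int, of "- B"] by auto
  have "(LINT \<tau>:{0..1}|lborel. f \<tau>) \<le> (LINT \<tau>:{0..1}|lborel. B * w \<tau>)"
    "(LINT \<tau>:{0..1}|lborel. - B * w \<tau>) \<le> (LINT \<tau>:{0..1}|lborel. f \<tau>)"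
    using f by (intro set_integral_mono Bw f_int; force simp: abs_le_iff)+
  then have "\<bar>LINT \<tau>:{0..1}|lborel. f \<tau>\<bar> \<le> B"
    by (simp only: set_integral_mult_right w1)
  moreover have "(LINT \<tau>:{0..1}|lborel. f \<tau>) = (\<Sum>n. a * b / ((real n + a) * (real n + b)) * (c n * (- t) ^ n))"
    using moments(2) mellin_weight_moment(2)[OF a ab(1)] by (simp add: f_def w_def sums_iff)
  ultimately show ?thesis
    by simp
qed

text \<open>
  Integration by parts in the form \<open>(lam P)' \<le> lam P'\<close> on \<open>[\<epsilon>, T]\<close>. The boundary term at \<open>T\<close> has the
  right sign. The one at \<open>\<epsilon>\<close> is at most \<open>B \<epsilon> lam(\<epsilon>)\<close>, which is bounded by \<open>B\<close> times the integral of
  \<open>lam\<close> over \<open>(0, \<epsilon>]\<close> because \<open>lam\<close> decreases, and hence tends to \<open>0\<close>.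
\<close>

lemma decreasing_weight_integral_nonneg:
  fixes lam lam' P P' :: "real \<Rightarrow> real"
  assumes lam: "set_integrable lborel {0..1} lam" "\<And>t. t \<in> {0<..<1} \<Longrightarrow> 0 \<le> lam t"
    and lam': "\<And>t. t \<in> {0<..<1} \<Longrightarrow> (lam has_real_derivative lam' t) (at t)"
      "\<And>t. t \<in> {0<..<1} \<Longrightarrow> lam' t \<le> 0"
    and P: "\<And>t. t \<in> {0<..<1} \<Longrightarrow> (P has_real_derivative P' t) (at t)"
      "\<And>t. t \<in> {0<..<1} \<Longrightarrow> 0 \<le> P t" "\<And>t. t \<in> {0<..<1/2} \<Longrightarrow> P t \<le> B * t"
    and int: "set_integrable lborel {0..1} (\<lambda>t. lam t * P' t)" and cont: "continuous_on {0<..<1} P'"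
  shows "0 \<le> (LINT t:{0..1}|lborel. lam t * P' t)"
proof -
  define I where "I A f = (LINT t:A|lborel. f t)" for A :: "real set" and f :: "real \<Rightarrow> real"
  have sub: "set_integrable lborel A lam" "set_integrable lborel A (\<lambda>t. lam t * P' t)" if "A \<subseteq> {0..1}" "A \<in> sets lborel" for A
    using that lam(1) int by (auto intro: set_integrable_subset)
  have B0: "0 \<le> B"
    using P(2)[of "1/4"] P(3)[of "1/4"] by simp
  have anti: "lam v \<le> lam u" if "0 < u" "u \<le> v" "v < 1" for u v
  proof (rule DERIV_nonpos_imp_nonincreasing[OF that(2)])
    fix x assume "u \<le> x" "x \<le> v"
    then have "x \<in> {0<..<1}"
      using that by simp
    then show "\<exists>y. (lam has_real_derivative y) (at x) \<and> y \<le> 0"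
      using lam' by blast
  qed
  have small: "\<epsilon> * lam \<epsilon> \<le> I {0<..\<epsilon>} lam" if e: "0 < \<epsilon>" "\<epsilon> < 1" for \<epsilon>
  proof -
    have "(LINT t:{0<..\<epsilon>}|lborel. lam \<epsilon>) \<le> I {0<..\<epsilon>} lam"
      unfolding I_def using e anti
      by (intro set_integral_mono sub(1)) (auto simp: set_integrable_def)
    moreover have "(LINT t:{0<..\<epsilon>}|lborel. lam \<epsilon>) = \<epsilon> * lam \<epsilon>"
      using e by (simp add: set_lebesgue_integral_def)
    ultimately show ?thesis
      by simp
  qed
  have key: "- B * I {0<..\<epsilon>} lam \<le> I {\<epsilon>..T} (\<lambda>t. lam t * P' t)" if e: "0 < \<epsilon>" "\<epsilon> < 1/2" "\<epsilon> \<le> T" "T < 1" for \<epsilon> T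
  proof -
    have "((\<lambda>t. lam t * P t) has_vector_derivative lam' t * P t + P' t * lam t) (at t within {\<epsilon>..T})"
      if "t \<in> {\<epsilon>..T}" for t
    proof -
      have "t \<in> {0<..<1}"
        using that e by auto
      from DERIV_mult[OF lam'(1)[OF this] P(1)[OF this]] show ?thesis
        unfolding has_real_derivative_iff_has_vector_derivative[symmetric]
        by (rule has_field_derivative_at_within)
    qed
    then have "((\<lambda>t. lam' t * P t + P' t * lam t) has_integral (lam T * P T - lam \<epsilon> * P \<epsilon>)) {\<epsilon>..T}"
      by (rule fundamental_theorem_of_calculus[OF e(3)])
    moreover have c: "continuous_on {\<epsilon>..T} (\<lambda>t. lam t * P' t)"
    proof (rule continuous_on_mult)
      have sub: "{\<epsilon>..T} \<subseteq> {0<..<1}"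
        using e by auto
      then show "continuous_on {\<epsilon>..T} P'"
        by (rule continuous_on_subset[OF cont])
      show "continuous_on {\<epsilon>..T} lam"
        using sub by (intro DERIV_continuous_on[of _ _ lam'] has_field_derivative_at_within[OF lam'(1)]) auto
    qed
    then have "((\<lambda>t. lam t * P' t) has_integral I {\<epsilon>..T} (\<lambda>t. lam t * P' t)) {\<epsilon>..T}"
      unfolding I_def set_borel_integral_eq_integral(2)[OF borel_integrable_atLeastAtMost'[OF c]]
      by (intro integrable_integral integrable_continuous_real)
    ultimately have "lam T * P T - lam \<epsilon> * P \<epsilon> \<le> I {\<epsilon>..T} (\<lambda>t. lam t * P' t)"
    proof (rule has_integral_le)
      fix t assume "t \<in> {\<epsilon>..T}"
      then have "lam' t * P t \<le> 0"
        using e lam'(2)[of t] P(2)[of t] by (intro mult_nonpos_nonneg) auto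
      then show "lam' t * P t + P' t * lam t \<le> lam t * P' t"
        by (simp add: mult.commute)
    qed
    moreover have "0 \<le> lam T * P T"
      using e lam(2)[of T] P(2)[of T] by auto
    moreover have "lam \<epsilon> * P \<epsilon> \<le> lam \<epsilon> * (B * \<epsilon>)"
      using e lam(2)[of \<epsilon>] P(3)[of \<epsilon>] by (intro mult_left_mono) auto
    moreover have "B * (\<epsilon> * lam \<epsilon>) \<le> B * I {0<..\<epsilon>} lam"
      using e by (intro mult_left_mono small B0) auto
    ultimately show ?thesis
      by (simp add: mult_ac)
  qed
  define e where "e n = 1 / (real n + 3)" for n
  have e: "0 < e n" "e n < 1/2" "e n \<le> 1 - e n" "1 - e n < 1" for n
    by (auto simp: e_def field_simps)
  have e0: "e \<longlonglongrightarrow> 0"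
    unfolding e_def by real_asymp
  have decE: "e m \<le> e n" if "n \<le> m" for n m
    using that by (auto simp: e_def field_simps)
  have "(\<lambda>n. I {e n..1 - e n} (\<lambda>t. lam t * P' t)) \<longlonglongrightarrow> I (\<Union>n. {e n..1 - e n}) (\<lambda>t. lam t * P' t)"
    unfolding I_def
  proof (rule set_integral_cont_up)
    show "incseq (\<lambda>n. {e n..1 - e n})"
      using decE by (fastforce simp: incseq_def intro: order_trans)
    have "{e n..1 - e n} \<subseteq> {0..1}" for n
      using e(1)[of n] by auto
    then have "(\<Union>n. {e n..1 - e n}) \<subseteq> {0..1}"
      by blast
    then show "set_integrable lborel (\<Union>n. {e n..1 - e n}) (\<lambda>t. lam t * P' t)"
      by (intro sub) auto
  qed auto
  moreover have U: "(\<Union>n. {e n..1 - e n}) = {0<..<1}"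
  proof (intro equalityI subsetI)
    fix t :: real assume t: "t \<in> {0<..<1}"
    then have "eventually (\<lambda>n. e n < min t (1 - t)) sequentially"
      using order_tendstoD(2)[OF e0, of "min t (1 - t)"] by auto
    then obtain n where "e n < min t (1 - t)"
      by (auto simp: eventually_sequentially)
    then show "t \<in> (\<Union>n. {e n..1 - e n})"
      by (auto intro!: exI[of _ n])
  qed (use e in \<open>force intro: less_le_trans le_less_trans\<close>)
  moreover have "I {0<..<1} (\<lambda>t. lam t * P' t) = I {0..1} (\<lambda>t. lam t * P' t)"
    unfolding I_def by (rule set_integral_discrete_difference[where X = "{0, 1}"]) auto
  moreover have "(\<lambda>n. I {0<..e n} lam) \<longlonglongrightarrow> I (\<Inter>n. {0<..e n}) lam"
    unfolding I_def
  proof (rule set_integral_cont_down)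
    show "decseq (\<lambda>n. {0<..e n})"
      using decE by (fastforce simp: decseq_def intro: order_trans)
    show "set_integrable lborel {0<..e 0} lam"
      using e[of 0] by (intro sub) auto
  qed auto
  moreover have "(\<Inter>n. {0<..e n}) = {}"
  proof -
    have "\<exists>n. e n < t" if "0 < t" for t
      using order_tendstoD(2)[OF e0 that] by (auto simp: eventually_sequentially)
    then have "x \<notin> (\<Inter>n. {0<..e n})" for x
      by (cases "0 < x") (auto simp: not_le)
    then show ?thesis
      by blast
  qed
  moreover have "I {} lam = 0"
    by (simp add: I_def set_lebesgue_integral_def)
  ultimately have "(\<lambda>n. I {e n..1 - e n} (\<lambda>t. lam t * P' t)) \<longlonglongrightarrow> I {0..1} (\<lambda>t. lam t * P' t)"
    and "(\<lambda>n. I {0<..e n} lam) \<longlonglongrightarrow> 0"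
    by simp_all
  then have "- B * 0 \<le> I {0..1} (\<lambda>t. lam t * P' t)"
    using key e by (intro LIMSEQ_le[OF tendsto_mult[OF tendsto_const]]) auto
  then show ?thesis
    by (simp add: I_def)
qed

section \<open>Hadamard products as circle averages\<close>

lemma exp_i_integral:
  "(LINT \<theta>:{0..2 * pi}|lborel. exp (\<i> * of_int k * of_real \<theta>)) = (if k = 0 then of_real (2 * pi) else 0)"
proof (cases "k = 0")
  case True
  then show ?thesis
    by (simp add: set_lebesgue_integral_def scaleR_conv_of_real)
next
  case False
  define F where "F \<theta> = exp (\<i> * of_int k * of_real \<theta>) / (\<i> * of_int k)" for \<theta> :: real
  have "(F has_vector_derivative exp (\<i> * of_int k * of_real \<theta>)) (at \<theta> within {0..2 * pi})" for \<theta>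
    unfolding F_def[abs_def] using False
    by (auto intro!: derivative_eq_intros has_vector_derivative_real_field simp: field_simps)
  then have "((\<lambda>\<theta>. exp (\<i> * of_int k * of_real \<theta>)) has_integral (F (2 * pi) - F 0)) {0..2 * pi}"
    by (intro fundamental_theorem_of_calculus) auto
  moreover have "exp (\<i> * of_int k * of_real (2 * pi)) = 1"
    using exp_integer_2pi[of "of_int k"] by (simp add: mult_ac)
  then have "F (2 * pi) = F 0"
    by (simp add: F_def)
  ultimately have "integral {0..2 * pi} (\<lambda>\<theta>. exp (\<i> * of_int k * of_real \<theta>)) = 0"
    by (simp add: integral_unique)
  moreover have "set_integrable lborel {0..2 * pi} (\<lambda>\<theta>. exp (\<i> * of_int k * of_real \<theta>))"
    by (intro borel_integrable_atLeastAtMost' continuous_intros)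
  ultimately show ?thesis
    using False by (simp add: set_borel_integral_eq_integral)
qed

text \<open>
  The integer \<open>e\<close> is \<open>1\<close> for series in \<open>e\<^bsup>i\<theta>\<^esup>\<close> and \<open>-1\<close> for series in \<open>e\<^bsup>-i\<theta>\<^esup>\<close>.
\<close>

lemma circle_series_sums:
  fixes c :: "nat \<Rightarrow> complex" and g :: "real \<Rightarrow> complex" and e :: int
  assumes c: "summable (\<lambda>n. norm (c n))" and g: "continuous_on {0..2 * pi} g"
  shows "(\<lambda>n. c n * (LINT \<theta>:{0..2 * pi}|lborel. exp (\<i> * of_int (e * int n) * of_real \<theta>) * g \<theta>)) sums
     (LINT \<theta>:{0..2 * pi}|lborel. (\<Sum>n. c n * exp (\<i> * of_int (e * int n) * of_real \<theta>)) * g \<theta>)"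
proof -
  define E where "E n \<theta> = exp (\<i> * of_int (e * int n) * of_real \<theta>)" for n and \<theta> :: real
  have E1: "norm (E n \<theta>) = 1" for n \<theta>
    by (simp add: E_def)
  define f where "f n \<theta> = indicat_real {0..2 * pi} \<theta> *\<^sub>R (c n * (E n \<theta> * g \<theta>))" for n \<theta>
  have "set_integrable lborel {0..2 * pi} (\<lambda>\<theta>. c n * (E n \<theta> * g \<theta>))" for n
    unfolding E_def by (intro borel_integrable_atLeastAtMost' continuous_intros g)
  then have fI: "integrable lborel (f n)" for n
    by (simp add: f_def[abs_def] set_integrable_def)
  have gI: "set_integrable lborel {0..2 * pi} g"
    by (rule borel_integrable_atLeastAtMost'[OF g])
  have nf: "norm (f n \<theta>) = norm (c n) * norm (indicat_real {0..2 * pi} \<theta> *\<^sub>R g \<theta>)" for n \<theta>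
    by (simp add: f_def norm_mult E1)
  have s1: "summable (\<lambda>n. norm (f n \<theta>))" for \<theta>
    unfolding nf by (intro summable_mult2 c)
  have s2: "summable (\<lambda>n. \<integral>\<theta>. norm (f n \<theta>) \<partial>lborel)"
    unfolding nf by (simp add: summable_mult2 c)
  have "(\<lambda>n. integral\<^sup>L lborel (f n)) sums (\<integral>\<theta>. (\<Sum>n. f n \<theta>) \<partial>lborel)"
    by (rule sums_integral[OF fI AE_I2[OF s1] s2])
  moreover have "integral\<^sup>L lborel (f n) = c n * (LINT \<theta>:{0..2 * pi}|lborel. E n \<theta> * g \<theta>)" for n
    unfolding f_def[abs_def] set_lebesgue_integral_def[symmetric] by simp
  moreover have "(\<Sum>n. f n \<theta>) = indicat_real {0..2 * pi} \<theta> *\<^sub>R ((\<Sum>n. c n * E n \<theta>) * g \<theta>)" for \<theta>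
  proof -
    have "summable (\<lambda>n. c n * E n \<theta>)"
      by (rule summable_norm_cancel) (simp add: norm_mult E1 c)
    then have "(\<lambda>n. indicat_real {0..2 * pi} \<theta> *\<^sub>R (c n * E n \<theta> * g \<theta>)) sums
        (indicat_real {0..2 * pi} \<theta> *\<^sub>R ((\<Sum>n. c n * E n \<theta>) * g \<theta>))"
      by (intro sums_scaleR_right sums_mult2 summable_sums)
    then show ?thesis
      by (simp add: f_def sums_iff mult.assoc)
  qed
  ultimately show ?thesis
    by (simp add: E_def set_lebesgue_integral_def)
qed

lemma continuous_on_circle_series:
  fixes c :: "nat \<Rightarrow> complex" and e :: int
  assumes c: "summable (\<lambda>n. norm (c n))"
  shows "continuous_on A (\<lambda>\<theta>::real. \<Sum>n. c n * exp (\<i> * of_int (e * int n) * of_real \<theta>))"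
proof (rule uniform_limit_theorem[OF _ Weierstrass_m_test[OF _ c]])
  show "\<forall>\<^sub>F n in sequentially. continuous_on A (\<lambda>\<theta>::real. \<Sum>i<n. c i * exp (\<i> * of_int (e * int i) * of_real \<theta>))"
    by (intro always_eventually allI continuous_intros)
qed (auto simp: norm_mult)

text \<open>
  Orthogonality of the exponentials pairs \<open>h\<^sub>n\<close> with \<open>d\<^sub>n\<close>. The conjugate of \<open>D\<close>, brought in by the real
  part, has only nonnegative frequencies and therefore sees nothing of \<open>H\<close> but its constant term.
\<close>

lemma hadamard_product_average:
  fixes h d :: "nat \<Rightarrow> complex"
  assumes h: "summable (\<lambda>n. norm (h n))" and d: "summable (\<lambda>n. norm (d n))"
  defines "H \<equiv> \<lambda>\<theta>::real. \<Sum>n. h n * exp (\<i> * of_int (1 * int n) * of_real \<theta>)"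
    and "D \<equiv> \<lambda>\<theta>::real. \<Sum>n. d n * exp (\<i> * of_int ((-1) * int n) * of_real \<theta>)"
  shows "(LINT \<theta>:{0..2 * pi}|lborel. H \<theta> * of_real (2 * Re (D \<theta>)))
      = of_real (2 * pi) * ((\<Sum>n. h n * d n) + h 0 * cnj (d 0))"
    and "(LINT \<theta>:{0..2 * pi}|lborel. H \<theta>) = of_real (2 * pi) * h 0"
    and "(LINT \<theta>:{0..2 * pi}|lborel. D \<theta>) = of_real (2 * pi) * d 0"
    and "continuous_on A H" and "continuous_on A D"
proof -
  show cH: "continuous_on A H" for A
    unfolding H_def by (rule continuous_on_circle_series[OF h])
  show cD: "continuous_on A D" for A
    unfolding D_def by (rule continuous_on_circle_series[OF d])
  define e where "e k \<theta> = exp (\<i> * of_int k * of_real \<theta>)" for k :: int and \<theta> :: real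
  have ee: "e j \<theta> * e k \<theta> = e (j + k) \<theta>" for j k \<theta>
    by (simp add: e_def exp_add[symmetric] algebra_simps)
  have ie: "(LINT \<theta>:{0..2 * pi}|lborel. e k \<theta>) = (if k = 0 then of_real (2 * pi) else 0)" for k
    unfolding e_def by (rule exp_i_integral)
  have ce: "continuous_on A (e k)" for A k
    unfolding e_def[abs_def] by (intro continuous_intros)
  have H: "H \<theta> = (\<Sum>n. h n * e (1 * int n) \<theta>)" and D: "D \<theta> = (\<Sum>n. d n * e ((-1) * int n) \<theta>)" for \<theta>
    by (simp_all add: H_def D_def e_def)
  note S = circle_series_sums[folded e_def]
  have eD: "(LINT \<theta>:{0..2 * pi}|lborel. D \<theta> * e k \<theta>) = (if k \<ge> 0 then of_real (2 * pi) * d (nat k) else 0)" for k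
  proof -
    have "(\<lambda>n. d n * (LINT \<theta>:{0..2 * pi}|lborel. e ((-1) * int n) \<theta> * e k \<theta>)) sums
        (LINT \<theta>:{0..2 * pi}|lborel. D \<theta> * e k \<theta>)"
      unfolding D by (rule S[OF d ce])
    moreover have "d n * (LINT \<theta>:{0..2 * pi}|lborel. e ((-1) * int n) \<theta> * e k \<theta>)
        = (if n = nat k then (if k \<ge> 0 then of_real (2 * pi) * d n else 0) else 0)" for n
      by (auto simp: ee ie)
    ultimately show ?thesis
      using sums_single[of "nat k" "\<lambda>n. if k \<ge> 0 then of_real (2 * pi) * d n else 0"] sums_unique2 by auto
  qed
  have cnj_e: "cnj (e k \<theta>) = e (- k) \<theta>" for k \<theta>
    by (simp add: e_def exp_cnj)
  have ecD: "(LINT \<theta>:{0..2 * pi}|lborel. e k \<theta> * cnj (D \<theta>)) = (if k \<le> 0 then of_real (2 * pi) * cnj (d (nat (- k))) else 0)" for k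
  proof -
    have "(LINT \<theta>:{0..2 * pi}|lborel. e k \<theta> * cnj (D \<theta>)) = (LINT \<theta>:{0..2 * pi}|lborel. cnj (D \<theta> * e (- k) \<theta>))"
      by (simp add: cnj_e mult.commute)
    also have "\<dots> = cnj (LINT \<theta>:{0..2 * pi}|lborel. D \<theta> * e (- k) \<theta>)"
      unfolding set_lebesgue_integral_def by (simp only: complex_cnj_scaleR[symmetric] Bochner_Integration.integral_cnj)
    finally show ?thesis
      by (simp add: eD)
  qed
  have reD: "(LINT \<theta>:{0..2 * pi}|lborel. e (1 * int n) \<theta> * of_real (2 * Re (D \<theta>)))
      = of_real (2 * pi) * (d n + (if n = 0 then cnj (d 0) else 0))" for n
  proof -
    have "(LINT \<theta>:{0..2 * pi}|lborel. e (int n) \<theta> * of_real (2 * Re (D \<theta>)))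
        = (LINT \<theta>:{0..2 * pi}|lborel. D \<theta> * e (int n) \<theta> + e (int n) \<theta> * cnj (D \<theta>))"
    proof -
      have "e (int n) \<theta> * of_real (2 * Re (D \<theta>)) = D \<theta> * e (int n) \<theta> + e (int n) \<theta> * cnj (D \<theta>)" for \<theta>
        unfolding complex_add_cnj[symmetric] by (simp add: algebra_simps)
      then show ?thesis
        by (simp only:)
    qed
    also have "\<dots> = (LINT \<theta>:{0..2 * pi}|lborel. D \<theta> * e (int n) \<theta>) + (LINT \<theta>:{0..2 * pi}|lborel. e (int n) \<theta> * cnj (D \<theta>))"
      by (intro set_integral_add borel_integrable_atLeastAtMost' continuous_intros ce cD)
    finally show ?thesis
      by (simp add: eD ecD distrib_left)
  qed
  have "(\<lambda>n. h n * (LINT \<theta>:{0..2 * pi}|lborel. e (1 * int n) \<theta> * of_real (2 * Re (D \<theta>)))) sums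
      (LINT \<theta>:{0..2 * pi}|lborel. H \<theta> * of_real (2 * Re (D \<theta>)))"
    unfolding H by (rule S[OF h]) (intro continuous_intros cD)
  moreover have "h n * (LINT \<theta>:{0..2 * pi}|lborel. e (1 * int n) \<theta> * of_real (2 * Re (D \<theta>)))
      = of_real (2 * pi) * (h n * d n + (if n = 0 then h n * cnj (d 0) else 0))" for n
    unfolding reD by (simp add: algebra_simps)
  ultimately have *: "(\<lambda>n. of_real (2 * pi) * (h n * d n + (if n = 0 then h n * cnj (d 0) else 0))) sums
      (LINT \<theta>:{0..2 * pi}|lborel. H \<theta> * of_real (2 * Re (D \<theta>)))"
    by simp
  have "Bseq d"
    using summable_LIMSEQ_zero[OF summable_norm_cancel[OF d]] convergentI convergent_imp_Bseq by blast
  then obtain K where K: "\<And>n. norm (d n) \<le> K"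
    by (auto simp: Bseq_def)
  have "summable (\<lambda>n. norm (h n * d n))"
  proof (rule summable_comparison_test)
    show "\<exists>N. \<forall>n\<ge>N. norm (norm (h n * d n)) \<le> norm (h n) * K"
      using K by (auto simp: norm_mult mult_left_mono)
    show "summable (\<lambda>n. norm (h n) * K)"
      by (rule summable_mult2[OF h])
  qed
  then have "(\<lambda>n. of_real (2 * pi) * (h n * d n + (if n = 0 then h n * cnj (d 0) else 0))) sums
      (of_real (2 * pi) * ((\<Sum>n. h n * d n) + h 0 * cnj (d 0)))"
    by (intro sums_mult sums_add summable_sums sums_single) (rule summable_norm_cancel)
  then show "(LINT \<theta>:{0..2 * pi}|lborel. H \<theta> * of_real (2 * Re (D \<theta>)))
      = of_real (2 * pi) * ((\<Sum>n. h n * d n) + h 0 * cnj (d 0))"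
    using * sums_unique2 by blast
  show "(LINT \<theta>:{0..2 * pi}|lborel. D \<theta>) = of_real (2 * pi) * d 0"
    using eD[of 0] by (simp add: e_def)
  have "(\<lambda>n. h n * (LINT \<theta>:{0..2 * pi}|lborel. e (1 * int n) \<theta> * 1)) sums (LINT \<theta>:{0..2 * pi}|lborel. H \<theta> * 1)"
    unfolding H by (rule S[OF h]) (intro continuous_intros)
  moreover have "h n * (LINT \<theta>:{0..2 * pi}|lborel. e (1 * int n) \<theta> * 1) = (if n = 0 then of_real (2 * pi) * h n else 0)" for n
    unfolding mult_1_right ie by simp
  ultimately have "(\<lambda>n. if n = 0 then of_real (2 * pi) * h n else 0) sums (LINT \<theta>:{0..2 * pi}|lborel. H \<theta>)"
    by simp
  then show "(LINT \<theta>:{0..2 * pi}|lborel. H \<theta>) = of_real (2 * pi) * h 0"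
    using sums_single[of 0 "\<lambda>n. of_real (2 * pi) * h n"] sums_unique2 by blast
qed

text \<open>
  Split \<open>z = Ry\<close> with \<open>|y|, R < 1\<close> and average \<open>H(Re\<^bsup>i\<theta>\<^esup>) - \<beta>\<close> with the density
  \<open>q = 2 Re C(ye\<^bsup>-i\<theta>\<^esup>) - 1 + \<beta>/(1 - \<beta>)\<close>. The constants in \<open>q\<close> are such that the average is exactly
  the convolution, while its rotated real part is positive because \<open>q\<close> is nonnegative with positive
  mean.
\<close>

lemma half_plane_convolution_nonzero:
  fixes h c :: "nat \<Rightarrow> complex" and \<beta> \<phi> :: real
  assumes h: "\<And>r. 0 \<le> r \<Longrightarrow> r < 1 \<Longrightarrow> summable (\<lambda>n. norm (h n) * r ^ n)" and h0: "h 0 = 1"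
    and c: "\<And>r. 0 \<le> r \<Longrightarrow> r < 1 \<Longrightarrow> summable (\<lambda>n. norm (c n) * r ^ n)" and c0: "c 0 = 1"
    and \<beta>: "\<beta> < 1"
    and H: "\<And>z. norm z < 1 \<Longrightarrow> 0 < Re (exp (\<i> * of_real \<phi>) * ((\<Sum>n. h n * z ^ n) - of_real \<beta>))"
    and C: "\<And>z. norm z < 1 \<Longrightarrow> (1 - \<beta> / (1 - \<beta>)) / 2 \<le> Re (\<Sum>n. c n * z ^ n)"
    and z: "norm z < 1"
  shows "(\<Sum>n. h n * c n * z ^ n) \<noteq> 0"
proof
  assume zero: "(\<Sum>n. h n * c n * z ^ n) = 0"
  define R where "R = (1 + norm z) / 2"
  have R: "0 < R" "R < 1" "norm z < R"
    using z norm_ge_zero[of z] by (auto simp: R_def simp del: norm_ge_zero)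
  define y where "y = z / of_real R"
  have y: "norm y < 1" "of_real R * y = z"
    using R by (auto simp: y_def norm_divide)
  define h' c' where "h' n = h n * of_real R ^ n" and "c' n = c n * y ^ n" for n
  have sh: "summable (\<lambda>n. norm (h' n))" and sc: "summable (\<lambda>n. norm (c' n))"
    using h[of R] c[of "norm y"] R y by (simp_all add: h'_def c'_def norm_mult norm_power)
  define G where "G \<theta> = (\<Sum>n. h' n * exp (\<i> * of_int (1 * int n) * of_real \<theta>))" for \<theta> :: real
  define D where "D \<theta> = (\<Sum>n. c' n * exp (\<i> * of_int ((-1) * int n) * of_real \<theta>))" for \<theta> :: real
  note avg = hadamard_product_average[OF sh sc, folded G_def D_def]
  note cG = avg(4) and cD = avg(5)
  define \<kappa> where "\<kappa> = \<beta> / (1 - \<beta>)"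
  define q where "q \<theta> = 2 * Re (D \<theta>) - 1 + \<kappa>" for \<theta>
  define u where "u \<theta> = Re (exp (\<i> * of_real \<phi>) * (G \<theta> - of_real \<beta>))" for \<theta>
  have cq: "continuous_on A q" and cu: "continuous_on A u" for A
    unfolding q_def u_def by (intro continuous_intros cD cG)+
  have q0: "0 \<le> q \<theta>" for \<theta>
  proof -
    have "D \<theta> = (\<Sum>n. c n * (y * exp (- (\<i> * of_real \<theta>))) ^ n)"
      unfolding D_def c'_def by (simp add: power_mult_distrib exp_of_nat_mult[symmetric] mult_ac)
    moreover have "norm (y * exp (- (\<i> * of_real \<theta>))) < 1"
      using y by (simp add: norm_mult)
    ultimately show ?thesis
      using C[of "y * exp (- (\<i> * of_real \<theta>))"] by (simp add: q_def \<kappa>_def)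
  qed
  have u0: "0 < u \<theta>" for \<theta>
  proof -
    have "G \<theta> = (\<Sum>n. h n * (of_real R * exp (\<i> * of_real \<theta>)) ^ n)"
      unfolding G_def h'_def by (simp add: power_mult_distrib exp_of_nat_mult[symmetric] mult_ac)
    moreover have "norm (of_real R * exp (\<i> * of_real \<theta>)) < 1"
      using R by (simp add: norm_mult)
    ultimately show ?thesis
      using H[of "of_real R * exp (\<i> * of_real \<theta>)"] by (simp add: u_def)
  qed
  obtain \<theta>0 where \<theta>0: "\<And>\<theta>. \<theta> \<in> {0..2 * pi} \<Longrightarrow> u \<theta>0 \<le> u \<theta>"
  proof -
    have "\<exists>x\<in>{0..2 * pi}. \<forall>y\<in>{0..2 * pi}. u x \<le> u y"
      by (rule continuous_attains_inf) (auto intro: cu)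
    then show ?thesis
      using that by blast
  qed
  have int: "set_integrable lborel {0..2 * pi} f" if "continuous_on {0..2 * pi} f" for f :: "real \<Rightarrow> 'a :: {banach, second_countable_topology}"
    by (rule borel_integrable_atLeastAtMost'[OF that])
  have Re_int: "Re (LINT \<theta>:{0..2 * pi}|lborel. f \<theta>) = (LINT \<theta>:{0..2 * pi}|lborel. Re (f \<theta>))"
    if "continuous_on {0..2 * pi} f" for f
    using integral_Re[OF int[OF that, unfolded set_integrable_def]]
    by (simp add: set_lebesgue_integral_def)
  have h'0: "h' 0 = 1" and c'0: "c' 0 = 1"
    by (simp_all add: h'_def c'_def h0 c0)
  have "(\<Sum>n. h' n * c' n) = (\<Sum>n. h n * c n * z ^ n)"
    unfolding h'_def c'_def y(2)[symmetric] by (simp add: power_mult_distrib mult_ac)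
  then have GD: "(LINT \<theta>:{0..2 * pi}|lborel. G \<theta> * of_real (2 * Re (D \<theta>))) = of_real (2 * pi)"
    using avg(1) zero by (simp add: h'0 c'0)
  have "(LINT \<theta>:{0..2 * pi}|lborel. 2 * Re (D \<theta>)) = 2 * (2 * pi)"
    using Re_int[OF cD] avg(3) by (simp add: c'0)
  moreover have "(LINT \<theta>:{0..2 * pi}|lborel. q \<theta>)
      = (LINT \<theta>:{0..2 * pi}|lborel. 2 * Re (D \<theta>)) + (LINT \<theta>:{0..2 * pi}|lborel. - 1 + \<kappa>)"
    unfolding q_def diff_conv_add_uminus add.assoc
    by (intro set_integral_add(2) int continuous_intros cD)
  moreover have "(LINT \<theta>:{0..2 * pi}|lborel. - 1 + \<kappa>) = 2 * pi * (\<kappa> - 1)"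
    by (simp add: set_lebesgue_integral_def)
  ultimately have q_int: "(LINT \<theta>:{0..2 * pi}|lborel. q \<theta>) = 2 * pi * (1 + \<kappa>)"
    by (simp add: algebra_simps)
  have \<kappa>1: "1 + \<kappa> = 1 / (1 - \<beta>)" "\<beta> * (1 + \<kappa>) = \<kappa>"
    using \<beta> by (simp_all add: \<kappa>_def field_simps)
  have "(LINT \<theta>:{0..2 * pi}|lborel. (G \<theta> - of_real \<beta>) * of_real (q \<theta>))
    = (LINT \<theta>:{0..2 * pi}|lborel. (G \<theta> * of_real (2 * Re (D \<theta>)) + of_real (\<kappa> - 1) * G \<theta>) - of_real \<beta> * of_real (q \<theta>))"
    by (simp add: q_def algebra_simps)
  also have "\<dots> = (LINT \<theta>:{0..2 * pi}|lborel. G \<theta> * of_real (2 * Re (D \<theta>)))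
      + of_real (\<kappa> - 1) * (LINT \<theta>:{0..2 * pi}|lborel. G \<theta>) - of_real \<beta> * (LINT \<theta>:{0..2 * pi}|lborel. of_real (q \<theta>))"
  proof -
    note i = int continuous_on_mult continuous_on_of_real continuous_on_const continuous_on_Re continuous_on_add cG cD cq
    show ?thesis
      by (subst set_integral_diff(2), (intro i)+, subst set_integral_add(2), (intro i)+) simp
  qed
  also have "\<dots> = of_real (2 * pi) + of_real (\<kappa> - 1) * (of_real (2 * pi) * 1) - of_real \<beta> * of_real (2 * pi * (1 + \<kappa>))"
    unfolding GD avg(2) h'0 set_integral_complex_of_real q_int ..
  also have "\<dots> = of_real (2 * pi * (\<kappa> - \<beta> * (1 + \<kappa>)))"
    by (simp add: algebra_simps)
  finally have "(LINT \<theta>:{0..2 * pi}|lborel. (G \<theta> - of_real \<beta>) * of_real (q \<theta>)) = 0"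
    unfolding \<kappa>1(2) by simp
  then have "0 = Re (LINT \<theta>:{0..2 * pi}|lborel. exp (\<i> * of_real \<phi>) * ((G \<theta> - of_real \<beta>) * of_real (q \<theta>)))"
    by (simp only: set_integral_mult_right) simp
  also have "\<dots> = (LINT \<theta>:{0..2 * pi}|lborel. Re (exp (\<i> * of_real \<phi>) * ((G \<theta> - of_real \<beta>) * of_real (q \<theta>))))"
    by (intro Re_int continuous_intros cG cq)
  also have "\<dots> = (LINT \<theta>:{0..2 * pi}|lborel. u \<theta> * q \<theta>)"
    unfolding u_def mult.assoc[symmetric] by simp
  also have "\<dots> \<ge> (LINT \<theta>:{0..2 * pi}|lborel. u \<theta>0 * q \<theta>)"
    using \<theta>0 q0 by (intro set_integral_mono int continuous_intros cu cq mult_right_mono) auto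
  also have "(LINT \<theta>:{0..2 * pi}|lborel. u \<theta>0 * q \<theta>) = u \<theta>0 * (2 * pi * (1 / (1 - \<beta>)))"
    using q_int \<kappa>1(1) by simp
  finally show False
    using u0[of \<theta>0] \<beta> pi_gt_zero by (simp add: mult_le_0_iff divide_le_0_iff not_le)
qed

section \<open>Power series of g and q\<close>

text \<open>
  The derivative of \<open>y \<cdot> starlike_kernel s y\<close>.
\<close>

definition convexity_kernel :: "real \<Rightarrow> real \<Rightarrow> real" where
  "convexity_kernel s y = 1 / (1 - y)\<^sup>2 + 2 * s * y / (1 - y) ^ 3"

lemma convexity_kernel_sums:
  fixes s y :: real
  assumes y: "\<bar>y\<bar> < 1"
  shows "(\<lambda>n. (real n + 1) * (1 + s * real n) * y ^ n) sums convexity_kernel s y"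
proof -
  define c where "c n = (if n = 0 then 0 else 1 + s * (real n - 1))" for n
  have "(\<lambda>n. c n * x ^ n) sums (x * starlike_kernel s x)" if "norm x < 1" for x :: real
  proof -
    have "(\<lambda>n. x * ((1 + s * of_nat n) * x ^ n)) sums (x * starlike_kernel s x)"
      by (intro sums_mult starlike_kernel_sums that)
    then have "(\<lambda>n. c (Suc n) * x ^ Suc n) sums (x * starlike_kernel s x)"
      by (simp add: c_def mult_ac)
    then show ?thesis
      by (subst (asm) sums_Suc_iff) (simp add: c_def)
  qed
  moreover have "((\<lambda>x. x * starlike_kernel s x) has_real_derivative convexity_kernel s y) (at y)"
  proof -
    have nz: "1 - y \<noteq> 0"
      using y by auto
    have 1: "((\<lambda>x. x / (1 - x)) has_real_derivative 1 / (1 - y)\<^sup>2) (at y)"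
      using nz by (auto intro!: derivative_eq_intros simp: power2_eq_square)
    have "((\<lambda>x. s * (x / (1 - x))\<^sup>2 + x / (1 - x)) has_real_derivative
        s * (2 * (y / (1 - y)) * (1 / (1 - y)\<^sup>2)) + 1 / (1 - y)\<^sup>2) (at y)"
      by (rule DERIV_add[OF DERIV_cmult[OF _] 1]) (rule derivative_eq_intros 1 refl | simp)+
    moreover have "(\<lambda>x. s * (x / (1 - x))\<^sup>2 + x / (1 - x)) = (\<lambda>x. x * starlike_kernel s x)"
      by (auto simp: starlike_kernel_def fun_eq_iff power2_eq_square algebra_simps)
    moreover have "s * (2 * (y / (1 - y)) * (1 / (1 - y)\<^sup>2)) + 1 / (1 - y)\<^sup>2 = convexity_kernel s y"
      by (simp add: convexity_kernel_def power2_eq_square power3_eq_cube mult_ac)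
    ultimately show ?thesis
      by simp
  qed
  ultimately have "(\<lambda>n. diffs c n * y ^ n) sums convexity_kernel s y"
    using y by (intro termdiffs_sums_strong[where K = 1]) auto
  then show ?thesis
    by (simp add: diffs_def c_def add.commute)
qed

lemma convexity_kernel_summable:
  fixes s y :: real
  assumes "0 \<le> s" "0 \<le> y" "y < 1"
  shows "summable (\<lambda>n. \<bar>(real n + 1) * (1 + s * real n)\<bar> * y ^ n)"
  using sums_summable[OF convexity_kernel_sums[of y s]] assms by (simp add: abs_mult)

lemma starlike_kernel_summable:
  fixes s y :: real
  assumes "0 \<le> s" "0 \<le> y" "y < 1"
  shows "summable (\<lambda>n. \<bar>1 + s * real n\<bar> * y ^ n)"
  using starlike_kernel_sums(2)[of y s] assms by (simp add: abs_mult)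

lemma kernels_of_order:
  fixes \<sigma> s y :: real
  assumes \<sigma>: "\<sigma> < 1" and s: "s = 1 / (1 - \<sigma>)" and y: "0 \<le> y"
  shows "starlike_kernel s (- y) = (1 - \<sigma> * (1 + y)) / ((1 - \<sigma>) * (1 + y)\<^sup>2)"
    and "convexity_kernel s (- y) = (1 - \<sigma> - (1 + \<sigma>) * y) / ((1 - \<sigma>) * (1 + y) ^ 3)"
proof -
  define p u where "p = 1 - \<sigma>" and "u = 1 + y"
  have p: "p > 0" "\<sigma> = 1 - p" and u: "u > 0" "y = u - 1" and s': "s = 1 / p"
    using \<sigma> y s by (auto simp: p_def u_def)
  have "starlike_kernel s (- y) = 1 / u - s * (u - 1) / u\<^sup>2"
    by (simp add: starlike_kernel_def u_def)
  also have "\<dots> = (1 - \<sigma> * u) / (p * u\<^sup>2)"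
    unfolding s' p(2) using p(1) u(1) by (simp add: divide_simps) (simp add: power2_eq_square algebra_simps)
  finally show "starlike_kernel s (- y) = (1 - \<sigma> * (1 + y)) / ((1 - \<sigma>) * (1 + y)\<^sup>2)"
    by (simp add: p_def u_def)
  have "convexity_kernel s (- y) = 1 / u\<^sup>2 - 2 * s * (u - 1) / u ^ 3"
    by (simp add: convexity_kernel_def u_def)
  also have "\<dots> = (1 - \<sigma> - (1 + \<sigma>) * (u - 1)) / (p * u ^ 3)"
    unfolding s' p(2) using p(1) u(1) by (simp add: divide_simps) (simp add: eval_nat_numeral algebra_simps)
  finally show "convexity_kernel s (- y) = (1 - \<sigma> - (1 + \<sigma>) * y) / ((1 - \<sigma>) * (1 + y) ^ 3)"
    by (simp add: p_def u_def)
qed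

lemma g_fun_sums:
  assumes \<mu>: "0 < \<mu>" "0 < \<nu>" and \<sigma>: "\<sigma> < 1" and t: "0 \<le> t" "t < 1" and s: "s = 1 / (1 - \<sigma>)"
  shows "(\<lambda>n. 1 / \<mu> * (1 / \<nu>) / ((real n + 1 / \<mu>) * (real n + 1 / \<nu>)) * ((1 + s * real n) * (- t) ^ n))
    sums ((g_fun \<mu> \<nu> \<sigma> t + 1) / 2)"
proof -
  have s0: "0 \<le> s"
    using \<sigma> by (simp add: s)
  have "(\<lambda>n. (1 + s * real n) * (- t) ^ n / ((real n + 1 / \<mu>) * (real n + 1 / \<nu>))) sums
      (LINT s':{0..1}|lborel. LINT w:{0..1}|lborel. starlike_kernel s (- (s' * w * t)) * s' powr (1 / \<mu> - 1) * w powr (1 / \<nu> - 1))"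
    using \<mu> t starlike_kernel_summable[OF s0]
    by (intro mellin_double_integral[where \<phi> = "\<lambda>y. starlike_kernel s (- y)"] starlike_kernel_sums) auto
  also have "(LINT s':{0..1}|lborel. LINT w:{0..1}|lborel. starlike_kernel s (- (s' * w * t)) * s' powr (1 / \<mu> - 1) * w powr (1 / \<nu> - 1))
      = (LINT s:{0..1}|lborel. LINT w:{0..1}|lborel.
        (1 - \<sigma> * (1 + s * w * t)) / ((1 - \<sigma>) * (1 + s * w * t)\<^sup>2) * s powr (1 / \<mu> - 1) * w powr (1 / \<nu> - 1))"
  proof (intro set_lebesgue_integral_cong allI impI)
    fix s' w :: real assume "s' \<in> {0..1}" "w \<in> {0..1}"
    then have "0 \<le> s' * w * t"
      using t by simp
    then have "starlike_kernel s (- (s' * w * t)) = (1 - \<sigma> * (1 + s' * w * t)) / ((1 - \<sigma>) * (1 + s' * w * t)\<^sup>2)"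
      by (rule kernels_of_order(1)[OF \<sigma> s])
    then show "starlike_kernel s (- (s' * w * t)) * s' powr (1 / \<mu> - 1) * w powr (1 / \<nu> - 1)
      = (1 - \<sigma> * (1 + s' * w * t)) / ((1 - \<sigma>) * (1 + s' * w * t)\<^sup>2) * s' powr (1 / \<mu> - 1) * w powr (1 / \<nu> - 1)"
      by simp
  qed auto
  also have "\<dots> = \<mu> * \<nu> * ((g_fun \<mu> \<nu> \<sigma> t + 1) / 2)"
    using \<mu> by (simp add: g_fun_def)
  finally have "(\<lambda>n. 1 / (\<mu> * \<nu>) * ((1 + s * real n) * (- t) ^ n / ((real n + 1 / \<mu>) * (real n + 1 / \<nu>)))) sums
      (1 / (\<mu> * \<nu>) * (\<mu> * \<nu> * ((g_fun \<mu> \<nu> \<sigma> t + 1) / 2)))"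
    by (rule sums_mult)
  then show ?thesis
    using \<mu> by (simp add: mult_ac)
qed

lemma q_fun_sums:
  assumes \<mu>: "0 < \<mu>" "0 < \<nu>" and \<sigma>: "\<sigma> < 1" and t: "0 \<le> t" "t < 1" and s: "s = 1 / (1 - \<sigma>)"
  shows "(\<lambda>n. 1 / \<mu> * (1 / \<nu>) / ((real n + 1 / \<mu>) * (real n + 1 / \<nu>)) * ((real n + 1) * (1 + s * real n) * (- t) ^ n))
    sums q_fun \<mu> \<nu> \<sigma> t"
proof -
  have s0: "0 \<le> s"
    using \<sigma> by (simp add: s)
  have "(\<lambda>n. ((real n + 1) * (1 + s * real n)) * (- t) ^ n / ((real n + 1 / \<mu>) * (real n + 1 / \<nu>))) sums
      (LINT s':{0..1}|lborel. LINT w:{0..1}|lborel. convexity_kernel s (- (s' * w * t)) * s' powr (1 / \<mu> - 1) * w powr (1 / \<nu> - 1))"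
    using \<mu> t convexity_kernel_summable[OF s0]
    by (intro mellin_double_integral[where \<phi> = "\<lambda>y. convexity_kernel s (- y)"] convexity_kernel_sums) auto
  also have "(LINT s':{0..1}|lborel. LINT w:{0..1}|lborel. convexity_kernel s (- (s' * w * t)) * s' powr (1 / \<mu> - 1) * w powr (1 / \<nu> - 1))
      = (LINT s:{0..1}|lborel. LINT w:{0..1}|lborel.
        (1 - \<sigma> - (1 + \<sigma>) * s * w * t) / ((1 - \<sigma>) * (1 + s * w * t) ^ 3) * s powr (1 / \<mu> - 1) * w powr (1 / \<nu> - 1))"
  proof (intro set_lebesgue_integral_cong allI impI)
    fix s' w :: real assume "s' \<in> {0..1}" "w \<in> {0..1}"
    then have "0 \<le> s' * w * t"
      using t by simp
    then have "convexity_kernel s (- (s' * w * t)) = (1 - \<sigma> - (1 + \<sigma>) * (s' * w * t)) / ((1 - \<sigma>) * (1 + s' * w * t) ^ 3)"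
      by (rule kernels_of_order(2)[OF \<sigma> s])
    then show "convexity_kernel s (- (s' * w * t)) * s' powr (1 / \<mu> - 1) * w powr (1 / \<nu> - 1)
      = (1 - \<sigma> - (1 + \<sigma>) * s' * w * t) / ((1 - \<sigma>) * (1 + s' * w * t) ^ 3) * s' powr (1 / \<mu> - 1) * w powr (1 / \<nu> - 1)"
      by (simp add: mult.assoc)
  qed auto
  also have "\<dots> = \<mu> * \<nu> * q_fun \<mu> \<nu> \<sigma> t"
    using \<mu> by (simp add: q_fun_def)
  finally have "(\<lambda>n. 1 / (\<mu> * \<nu>) * (((real n + 1) * (1 + s * real n)) * (- t) ^ n / ((real n + 1 / \<mu>) * (real n + 1 / \<nu>)))) sums
      (1 / (\<mu> * \<nu>) * (\<mu> * \<nu> * q_fun \<mu> \<nu> \<sigma> t))"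
    by (rule sums_mult)
  then show ?thesis
    using \<mu> by (simp add: mult_ac)
qed

section \<open>Comparison with the integral that defines \<open>\<beta>\<close>\<close>

lemma power_series_weight_integrable:
  fixes c :: "nat \<Rightarrow> real" and v :: "real \<Rightarrow> real"
  assumes v: "set_integrable lborel {0..1} v"
    and B: "\<And>t. 0 \<le> t \<Longrightarrow> t < 1 \<Longrightarrow> \<bar>\<Sum>n. c n * t ^ n\<bar> \<le> B"
  shows "set_integrable lborel {0..1} (\<lambda>t. v t * (\<Sum>n. c n * t ^ n))"
proof -
  define f where "f t = (\<Sum>n. c n * t ^ n)" for t
  have "f \<in> borel_measurable borel"
    unfolding f_def[abs_def] by measurable
  then have "set_borel_measurable lborel {0..1} f"
    by (simp add: set_borel_measurable_def)
  moreover have "norm (f t) \<le> max B \<bar>f 1\<bar>" if "t \<in> {0..1}" for t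
    using B[of t] that by (cases "t = 1") (auto simp: f_def)
  ultimately show ?thesis
    using set_integrable_scaleR_bounded[OF v, of f "max B \<bar>f 1\<bar>"] by (simp add: f_def)
qed

text \<open>
  The coefficients \<open>(n + 1)y\<^sub>n\<close> are those of the derivative of \<open>t \<Sum> y\<^sub>n t\<^sup>n\<close>, a nonnegative function that
  is \<open>O(t)\<close> at \<open>0\<close>.
\<close>

lemma weighted_power_series_primitive_nonneg:
  fixes lam lam' :: "real \<Rightarrow> real" and y :: "nat \<Rightarrow> real"
  assumes lam: "set_integrable lborel {0..1} lam" "\<And>t. t \<in> {0<..<1} \<Longrightarrow> 0 \<le> lam t"
    and lam': "\<And>t. t \<in> {0<..<1} \<Longrightarrow> (lam has_real_derivative lam' t) (at t)"
      "\<And>t. t \<in> {0<..<1} \<Longrightarrow> lam' t \<le> 0"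
    and y: "\<And>t. \<bar>t\<bar> < 1 \<Longrightarrow> summable (\<lambda>n. y n * t ^ n)"
    and pos: "\<And>t. 0 \<le> t \<Longrightarrow> t < 1 \<Longrightarrow> 0 \<le> (\<Sum>n. y n * t ^ n)"
    and B: "\<And>t. 0 \<le> t \<Longrightarrow> t < 1 \<Longrightarrow> (\<Sum>n. y n * t ^ n) \<le> B"
    and int: "set_integrable lborel {0..1} (\<lambda>t. lam t * (\<Sum>n. (real n + 1) * y n * t ^ n))"
  shows "0 \<le> (LINT t:{0..1}|lborel. lam t * (\<Sum>n. (real n + 1) * y n * t ^ n))"
proof -
  define c where "c n = (if n = 0 then 0 else y (n - 1))" for n
  define P where "P t = (\<Sum>n. c n * t ^ n)" for t :: real
  have cs: "(\<lambda>n. c n * t ^ n) sums (t * (\<Sum>n. y n * t ^ n))" if "\<bar>t\<bar> < 1" for t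
  proof -
    have "(\<lambda>n. t * (y n * t ^ n)) sums (t * (\<Sum>n. y n * t ^ n))"
      by (intro sums_mult summable_sums y that)
    then have "(\<lambda>n. c (Suc n) * t ^ Suc n) sums (t * (\<Sum>n. y n * t ^ n))"
      by (simp add: c_def mult_ac)
    then show ?thesis
      by (subst (asm) sums_Suc_iff) (simp add: c_def)
  qed
  have P: "P t = t * (\<Sum>n. y n * t ^ n)" if "\<bar>t\<bar> < 1" for t
    using cs[OF that] by (simp add: P_def sums_iff)
  have c_sum: "summable (\<lambda>n. c n * t ^ n)" if "norm t < 1" for t :: real
    using cs[of t] that by (simp add: sums_iff)
  have diffs_c: "diffs c = (\<lambda>n. (real n + 1) * y n)"
    by (simp add: diffs_def c_def fun_eq_iff add.commute)
  have dP: "(P has_real_derivative (\<Sum>n. (real n + 1) * y n * t ^ n)) (at t)" if "\<bar>t\<bar> < 1" for t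
    using termdiffs_strong'[of 1 c t] c_sum that unfolding P_def[abs_def] diffs_c by simp
  have d_sum: "summable (\<lambda>n. (real n + 1) * y n * t ^ n)" if "norm t < 1" for t :: real
    using termdiff_converges[of t 1 c] c_sum that unfolding diffs_c by simp
  have "isCont (\<lambda>t. \<Sum>n. (real n + 1) * y n * t ^ n) t" if "\<bar>t\<bar> < 1" for t
    using DERIV_isCont[OF termdiffs_strong'[of 1 "\<lambda>n. (real n + 1) * y n" t]] d_sum that by simp
  then have cont: "continuous_on {0<..<1} (\<lambda>t. \<Sum>n. (real n + 1) * y n * t ^ n)"
    by (auto intro: continuous_at_imp_continuous_on)
  show ?thesis
  proof (rule decreasing_weight_integral_nonneg[OF lam lam' _ _ _ int cont, where P = P and B = B])
    fix t :: real
    show "(P has_real_derivative (\<Sum>n. (real n + 1) * y n * t ^ n)) (at t)" "0 \<le> P t" if "t \<in> {0<..<1}"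
      using that dP[of t] P[of t] pos[of t] by auto
    show "P t \<le> B * t" if "t \<in> {0<..<1/2}"
      using that P[of t] B[of t] mult_left_mono[of "\<Sum>n. y n * t ^ n" B t] by (simp add: mult.commute)
  qed
qed

text \<open>
  Put \<open>r\<^sub>n = Re ((1 + \<kappa>n)z\<^sup>n)\<close> and \<open>Y(t) = \<Sum> m\<^sub>n (r\<^sub>n - (1 + sn)(-1)\<^sup>n) t\<^sup>n\<close>. The right side minus the left
  side is the integral of \<open>lam ((1 - \<xi>)Y + \<xi>P')\<close> with \<open>P(t) = tY(t)\<close>, because
  \<open>1 + \<xi>n = (1 - \<xi>) + \<xi>(n + 1)\<close> and passing from \<open>Y\<close> to \<open>P'\<close> multiplies the \<open>n\<close>-th coefficient by \<open>n + 1\<close>.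
  Both parts are nonnegative as \<open>Y \<ge> 0\<close> and \<open>lam\<close> decreases.
\<close>

lemma weighted_g_q_integral_le:
  fixes \<xi> \<mu> \<nu> \<sigma> s :: real and lam lam' :: "real \<Rightarrow> real" and \<kappa> z :: complex
  assumes \<xi>: "0 \<le> \<xi>" "\<xi> \<le> 1" and \<mu>\<nu>: "1 \<le> \<mu>" "\<mu> \<le> \<nu>"
    and \<sigma>: "0 \<le> \<sigma>" "\<sigma> \<le> 1/4" and s: "s = 1 / (1 - \<sigma>)"
    and lam: "set_integrable lborel {0..1} lam" "\<And>t. t \<in> {0<..<1} \<Longrightarrow> 0 \<le> lam t"
      "(LINT t:{0..1}|lborel. lam t) = 1" "lam 1 = 0"
    and lam': "\<And>t. t \<in> {0<..<1} \<Longrightarrow> (lam has_real_derivative lam' t) (at t)"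
      "\<And>t. t \<in> {0<..<1} \<Longrightarrow> lam' t \<le> 0"
    and \<kappa>: "norm (\<kappa> - s / 2) \<le> s / 2" and z: "norm z < 1"
  defines "m \<equiv> \<lambda>n. 1 / \<mu> * (1 / \<nu>) / ((real n + 1 / \<mu>) * (real n + 1 / \<nu>))"
  shows "(1 + (LINT t:{0..1}|lborel. lam t * ((1 - \<xi>) * g_fun \<mu> \<nu> \<sigma> t + \<xi> * (2 * q_fun \<mu> \<nu> \<sigma> t - 1)))) / 2
    \<le> (\<Sum>n. (LINT t:{0..1}|lborel. lam t * t ^ n) * (m n * (1 + \<xi> * real n) * Re ((1 + \<kappa> * of_nat n) * z ^ n)))"
    (is "_ \<le> ?R")
proof -
  define a b where "a = 1 / \<mu>" and "b = 1 / \<nu>"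
  have ab: "0 < b" "b \<le> a" "a \<le> 1" "0 < a"
    using \<mu>\<nu> by (auto simp: a_def b_def field_simps)
  have m: "m n = a * b / ((real n + a) * (real n + b))" for n
    by (simp add: m_def a_def b_def)
  have m1: "0 \<le> m n" "m n \<le> 1" for n
  proof -
    show "0 \<le> m n"
      unfolding m using ab by simp
    have "a * b \<le> (real n + a) * (real n + b)"
      using ab by (intro mult_mono) auto
    then show "m n \<le> 1"
      unfolding m using ab by (simp add: divide_le_eq_1 add_nonneg_pos)
  qed
  have s1: "0 \<le> s" "s \<le> 4/3" and \<sigma>1: "\<sigma> < 1"
    using \<sigma> by (auto simp: s field_simps)
  have \<mu>0: "0 < \<mu>" "0 < \<nu>"
    using \<mu>\<nu> by auto
  define r where "r n = Re ((1 + \<kappa> * of_nat n) * z ^ n)" for n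
  define bd where "bd n = (real n + 1) * (1 + norm \<kappa> * real n) * norm z ^ n" for n
  have bd_sum: "summable bd"
    unfolding bd_def using convexity_kernel_sums[of "norm z" "norm \<kappa>"] z by (simp add: sums_iff)
  have r_le: "\<bar>r n\<bar> \<le> (1 + norm \<kappa> * real n) * norm z ^ n" for n
  proof -
    have "\<bar>r n\<bar> \<le> norm (1 + \<kappa> * of_nat n) * norm z ^ n"
      unfolding r_def using abs_Re_le_cmod[of "(1 + \<kappa> * of_nat n) * z ^ n"] by (simp add: norm_mult norm_power)
    also have "norm (1 + \<kappa> * of_nat n) \<le> 1 + norm \<kappa> * real n"
      by (rule order_trans[OF norm_triangle_ineq]) (simp add: norm_mult)
    finally show ?thesis
      by (simp add: mult_right_mono)
  qed
  have bound: "\<bar>k * m n * r n\<bar> \<le> bd n" if "0 \<le> k" "k \<le> real n + 1" for k n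
  proof -
    have "\<bar>k * m n * r n\<bar> = (k * m n) * \<bar>r n\<bar>"
      using that m1 by (simp add: abs_mult)
    also have "\<dots> \<le> ((real n + 1) * 1) * ((1 + norm \<kappa> * real n) * norm z ^ n)"
      using that m1 r_le by (intro mult_mono) auto
    finally show ?thesis
      by (simp add: bd_def)
  qed
  have bound_t: "\<bar>k * m n * r n * t ^ n\<bar> \<le> bd n" if "0 \<le> k" "k \<le> real n + 1" "\<bar>t\<bar> \<le> 1" for k n t
  proof -
    have "\<bar>k * m n * r n\<bar> * \<bar>t\<bar> ^ n \<le> bd n * 1"
      using bound[OF that(1,2)] that(3) by (intro mult_mono) (auto simp: power_le_one bd_def)
    then show ?thesis
      by (simp add: abs_mult power_abs)
  qed
  define u where "u n = (1 + \<xi> * real n) * m n * r n" for n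
  have \<xi>n: "0 \<le> 1 + \<xi> * real n" "1 + \<xi> * real n \<le> real n + 1" for n
    using \<xi> mult_right_mono[of \<xi> 1 "real n"] by auto
  have u_sum: "summable (\<lambda>n. norm (u n))"
    unfolding u_def using bound[OF \<xi>n] by (intro summable_comparison_test[OF _ bd_sum]) auto
  define A0 A1 where "A0 t = (\<Sum>n. 1 * m n * r n * t ^ n)" and "A1 t = (\<Sum>n. (real n + 1) * m n * r n * t ^ n)" for t
  have A_sum: "summable (\<lambda>n. 1 * m n * r n * t ^ n)" "summable (\<lambda>n. (real n + 1) * m n * r n * t ^ n)" if "\<bar>t\<bar> \<le> 1" for t
    using bound_t[of 1 _ t] bound_t[of "real _ + 1" _ t] that
    by (intro summable_comparison_test[OF _ bd_sum]; force)+
  have A_le: "\<bar>A0 t\<bar> \<le> suminf bd" "\<bar>A1 t\<bar> \<le> suminf bd" if "\<bar>t\<bar> \<le> 1" for t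
  proof -
    have le: "norm (suminf f) \<le> suminf bd" if "\<And>n. \<bar>f n\<bar> \<le> bd n" for f :: "nat \<Rightarrow> real"
      using that by (intro norm_suminf_le bd_sum) auto
    show "\<bar>A0 t\<bar> \<le> suminf bd"
      unfolding A0_def real_norm_def[symmetric] by (rule le, rule bound_t) (use that in simp_all)
    show "\<bar>A1 t\<bar> \<le> suminf bd"
      unfolding A1_def real_norm_def[symmetric] by (rule le, rule bound_t) (use that in simp_all)
  qed
  define G Q where "G t = (g_fun \<mu> \<nu> \<sigma> t + 1) / 2" and "Q t = q_fun \<mu> \<nu> \<sigma> t" for t
  have G: "(\<lambda>n. m n * ((1 + s * real n) * (- t) ^ n)) sums G t"
    and Q: "(\<lambda>n. m n * ((real n + 1) * (1 + s * real n) * (- t) ^ n)) sums Q t" if "0 \<le> t" "t < 1" for t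
    unfolding m_def G_def Q_def
    by (rule g_fun_sums[OF \<mu>0 \<sigma>1 that s], rule q_fun_sums[OF \<mu>0 \<sigma>1 that s])
  have G_le: "\<bar>G t\<bar> \<le> 1 + s" if t: "0 \<le> t" "t < 1" for t
  proof -
    have "\<bar>\<Sum>n. m n * ((1 + s * real n) * (- t) ^ n)\<bar> \<le> 1 + s"
      unfolding m
    proof (rule mellin_series_bound[OF ab(1,2) t, where \<phi> = "\<lambda>y. starlike_kernel s (- y)"])
      fix y :: real assume y: "0 \<le> y" "y < 1"
      show "(\<lambda>n. (1 + s * real n) * (- y) ^ n) sums starlike_kernel s (- y)"
        using starlike_kernel_sums(1)[of "- y" s] y by simp
      show "summable (\<lambda>n. \<bar>1 + s * real n\<bar> * y ^ n)"
        by (rule starlike_kernel_summable[OF s1(1) y])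
      have e: "0 \<le> 1 / (1 + y)" "1 / (1 + y) \<le> 1" "0 \<le> y / (1 + y)\<^sup>2" "y / (1 + y)\<^sup>2 \<le> 1"
        using y by (auto simp: divide_le_eq power2_eq_square algebra_simps)
      moreover have "starlike_kernel s (- y) = 1 / (1 + y) - s * (y / (1 + y)\<^sup>2)"
        by (simp add: starlike_kernel_def)
      moreover have "s * (y / (1 + y)\<^sup>2) \<le> s * 1" "0 \<le> s * (y / (1 + y)\<^sup>2)"
        using s1 by (intro mult_left_mono mult_nonneg_nonneg e; simp)+
      ultimately show "\<bar>starlike_kernel s (- y)\<bar> \<le> 1 + s"
        by linarith
    qed
    then show ?thesis
      using G[OF t] by (simp add: sums_iff)
  qed
  have Q_le: "\<bar>Q t\<bar> \<le> 1 + 2 * s" if t: "0 \<le> t" "t < 1" for t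
  proof -
    have "\<bar>\<Sum>n. m n * ((real n + 1) * (1 + s * real n) * (- t) ^ n)\<bar> \<le> 1 + 2 * s"
      unfolding m
    proof (rule mellin_series_bound[OF ab(1,2) t, where \<phi> = "\<lambda>y. convexity_kernel s (- y)"])
      fix y :: real assume y: "0 \<le> y" "y < 1"
      show "(\<lambda>n. (real n + 1) * (1 + s * real n) * (- y) ^ n) sums convexity_kernel s (- y)"
        using convexity_kernel_sums[of "- y" s] y by simp
      show "summable (\<lambda>n. \<bar>(real n + 1) * (1 + s * real n)\<bar> * y ^ n)"
        by (rule convexity_kernel_summable[OF s1(1) y])
      have p: "1 \<le> (1 + y)\<^sup>2" "1 \<le> (1 + y) ^ 3"
        using y by (auto intro: one_le_power)
      then have "y \<le> (1 + y) ^ 3"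
        using y by linarith
      with p have e: "0 \<le> 1 / (1 + y)\<^sup>2" "1 / (1 + y)\<^sup>2 \<le> 1" "0 \<le> y / (1 + y) ^ 3" "y / (1 + y) ^ 3 \<le> 1"
        using y by (auto simp: divide_le_eq)
      moreover have "convexity_kernel s (- y) = 1 / (1 + y)\<^sup>2 - (2 * s) * (y / (1 + y) ^ 3)"
        by (simp add: convexity_kernel_def)
      moreover have "(2 * s) * (y / (1 + y) ^ 3) \<le> (2 * s) * 1" "0 \<le> (2 * s) * (y / (1 + y) ^ 3)"
        using s1 by (intro mult_left_mono mult_nonneg_nonneg e; simp)+
      ultimately show "\<bar>convexity_kernel s (- y)\<bar> \<le> 1 + 2 * s"
        by linarith
    qed
    then show ?thesis
      using Q[OF t] by (simp add: sums_iff)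
  qed
  define y where "y n = m n * (r n - (1 + s * real n) * (- 1) ^ n)" for n
  define Y P' where "Y t = (\<Sum>n. y n * t ^ n)" and "P' t = (\<Sum>n. (real n + 1) * y n * t ^ n)" for t
  have neg: "(- t) ^ n = (- 1) ^ n * t ^ n" for t :: real and n
    by (simp flip: power_mult_distrib)
  have Y_sums: "(\<lambda>n. y n * t ^ n) sums (A0 t - G t)" and P'_sums: "(\<lambda>n. (real n + 1) * y n * t ^ n) sums (A1 t - Q t)"
    if t: "0 \<le> t" "t < 1" for t
    using sums_diff[OF summable_sums[OF A_sum(1)[of t]] G[OF t]] sums_diff[OF summable_sums[OF A_sum(2)[of t]] Q[OF t]] t
    unfolding A0_def[symmetric] A1_def[symmetric] y_def neg[of t]
    by (simp_all add: algebra_simps)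
  have Y: "Y t = A0 t - G t" and P': "P' t = A1 t - Q t" if t: "0 \<le> t" "t < 1" for t
    using Y_sums[OF t] P'_sums[OF t] by (simp_all add: Y_def P'_def sums_iff)
  have YB: "\<bar>Y t\<bar> \<le> suminf bd + (1 + s)" "\<bar>P' t\<bar> \<le> suminf bd + (1 + 2 * s)" if "0 \<le> t" "t < 1" for t
    using Y[OF that] P'[OF that] A_le[of t] G_le[OF that] Q_le[OF that] that by auto
  have Y_int: "set_integrable lborel {0..1} (\<lambda>t. lam t * Y t)"
    and P'_int: "set_integrable lborel {0..1} (\<lambda>t. lam t * P' t)"
    using YB unfolding Y_def P'_def by (auto intro!: power_series_weight_integrable[OF lam(1)])
  have Y_nonneg: "0 \<le> Y t" if t: "0 \<le> t" "t < 1" for t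
  proof -
    have "norm (of_real t * z) \<le> t"
      using t z by (simp add: norm_mult mult_left_le)
    from Re_mellin_series_ge[OF ab(1-3) s1 \<kappa> this t(2)]
    have "0 \<le> (\<Sum>n. m n * (Re ((1 + \<kappa> * of_nat n) * (of_real t * z) ^ n) - (1 + s * real n) * (- t) ^ n))"
      by (simp only: m)
    moreover have "Re ((1 + \<kappa> * of_nat n) * (of_real t * z) ^ n) = t ^ n * r n" for n
    proof -
      have "(1 + \<kappa> * of_nat n) * (of_real t * z) ^ n = of_real (t ^ n) * ((1 + \<kappa> * of_nat n) * z ^ n)"
        by (simp add: power_mult_distrib mult_ac)
      then show ?thesis
        unfolding r_def
        by (simp only: times_complex.sel(1)[of "of_real (t ^ n)"] Re_complex_of_real Im_complex_of_real mult_zero_left diff_zero)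
    qed
    moreover have "m n * (t ^ n * r n - (1 + s * real n) * (- t) ^ n) = y n * t ^ n" for n
      unfolding y_def neg[of t] by (simp add: algebra_simps)
    ultimately show ?thesis
      by (simp only: Y_def)
  qed
  have "0 \<le> (LINT t:{0..1}|lborel. lam t * P' t)"
    unfolding P'_def
  proof (rule weighted_power_series_primitive_nonneg[OF lam(1,2) lam'])
    show "summable (\<lambda>n. y n * t ^ n)" if t1: "\<bar>t\<bar> < 1" for t
    proof -
      obtain t' where t': "\<bar>t\<bar> < t'" "t' < 1"
        using dense[OF t1] by blast
      then have "summable (\<lambda>n. y n * t' ^ n)"
        using Y_sums[of t'] by (auto simp: sums_iff)
      then show ?thesis
        using t' by (intro powser_inside[of y t' t]) auto
    qed
    show "0 \<le> (\<Sum>n. y n * t ^ n)" "(\<Sum>n. y n * t ^ n) \<le> suminf bd + (1 + s)" if "0 \<le> t" "t < 1" for t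
      using Y_nonneg[OF that] YB(1)[OF that] by (auto simp: Y_def)
  qed (use P'_int in \<open>simp_all add: P'_def\<close>)
  moreover have "0 \<le> (LINT t:{0..1}|lborel. lam t * Y t)"
  proof -
    have "0 \<le> indicat_real {0..1} t * (lam t * Y t)" if "t \<noteq> 0" for t
      using that lam(2)[of t] lam(4) Y_nonneg[of t] by (cases "t = 1") (auto simp: indicator_def)
    then have "AE t in lborel. 0 \<le> indicat_real {0..1} t * (lam t * Y t)"
      using AE_lborel_singleton[of 0] by (auto elim!: eventually_mono)
    then show ?thesis
      unfolding set_lebesgue_integral_def by (auto intro: integral_nonneg_AE)
  qed
  ultimately have nonneg: "0 \<le> (1 - \<xi>) * (LINT t:{0..1}|lborel. lam t * Y t) + \<xi> * (LINT t:{0..1}|lborel. lam t * P' t)"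
    using \<xi> by simp
  define U where "U t = (\<Sum>n. t ^ n * u n)" for t
  have U: "U t = (1 - \<xi>) * A0 t + \<xi> * A1 t" if "\<bar>t\<bar> \<le> 1" for t
  proof -
    have "(\<lambda>n. (1 - \<xi>) * (1 * m n * r n * t ^ n) + \<xi> * ((real n + 1) * m n * r n * t ^ n)) sums ((1 - \<xi>) * A0 t + \<xi> * A1 t)"
      unfolding A0_def A1_def by (intro sums_add sums_mult summable_sums A_sum that)
    also have "(\<lambda>n. (1 - \<xi>) * (1 * m n * r n * t ^ n) + \<xi> * ((real n + 1) * m n * r n * t ^ n)) = (\<lambda>n. t ^ n * u n)"
      by (simp add: u_def algebra_simps)
    finally show ?thesis
      by (simp add: U_def sums_iff)
  qed
  have U_int: "set_integrable lborel {0..1} (\<lambda>t. lam t * U t)"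
    and U_eq: "(\<lambda>n. (LINT t:{0..1}|lborel. lam t * t ^ n) * u n) sums (LINT t:{0..1}|lborel. lam t * U t)"
    using power_series_moments[OF lam(1) u_sum] by (simp_all add: U_def)
  have "?R = (LINT t:{0..1}|lborel. lam t * U t)"
    using U_eq by (simp add: sums_iff u_def r_def mult_ac)
  have "lam t * ((1 - \<xi>) * g_fun \<mu> \<nu> \<sigma> t + \<xi> * (2 * q_fun \<mu> \<nu> \<sigma> t - 1))
      = 2 * (lam t * U t) - 2 * ((1 - \<xi>) * (lam t * Y t) + \<xi> * (lam t * P' t)) - lam t" if t: "t \<in> {0..1}" for t
  proof (cases "t = 1")
    case False
    then have "0 \<le> t" "t < 1"
      using t by auto
    then have "U t = (1 - \<xi>) * A0 t + \<xi> * A1 t" "A0 t = Y t + G t" "A1 t = P' t + Q t"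
      using U[of t] Y[of t] P'[of t] by auto
    then have "U t - ((1 - \<xi>) * Y t + \<xi> * P' t) = (1 - \<xi>) * G t + \<xi> * Q t"
      by (simp only:) (simp add: algebra_simps)
    moreover have g: "g_fun \<mu> \<nu> \<sigma> t = 2 * G t - 1"
      by (simp add: G_def field_simps)
    have "(1 - \<xi>) * g_fun \<mu> \<nu> \<sigma> t + \<xi> * (2 * q_fun \<mu> \<nu> \<sigma> t - 1) = 2 * ((1 - \<xi>) * G t + \<xi> * Q t) - 1"
      unfolding g Q_def by (simp add: algebra_simps)
    ultimately have "(1 - \<xi>) * g_fun \<mu> \<nu> \<sigma> t + \<xi> * (2 * q_fun \<mu> \<nu> \<sigma> t - 1) = 2 * (U t - ((1 - \<xi>) * Y t + \<xi> * P' t)) - 1"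
      by (simp only:)
    then show ?thesis
      by (simp only:) (simp add: algebra_simps)
  qed (simp add: lam(4))
  then have "(LINT t:{0..1}|lborel. lam t * ((1 - \<xi>) * g_fun \<mu> \<nu> \<sigma> t + \<xi> * (2 * q_fun \<mu> \<nu> \<sigma> t - 1)))
     = (LINT t:{0..1}|lborel. 2 * (lam t * U t) - 2 * ((1 - \<xi>) * (lam t * Y t) + \<xi> * (lam t * P' t)) - lam t)"
    by (intro set_lebesgue_integral_cong) auto
  also have "\<dots> = 2 * (LINT t:{0..1}|lborel. lam t * U t)
     - 2 * ((1 - \<xi>) * (LINT t:{0..1}|lborel. lam t * Y t) + \<xi> * (LINT t:{0..1}|lborel. lam t * P' t)) - 1"
  proof -
    note i = set_integrable_mult_right[OF Y_int] set_integrable_mult_right[OF P'_int] set_integrable_mult_right[OF U_int]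
      set_integral_add(1) set_integral_diff(1) set_integrable_mult_right lam(1)
    show ?thesis
      by (subst set_integral_diff(2), (intro i)+, subst set_integral_diff(2), (intro i)+,
          subst (2) set_integral_mult_right, subst set_integral_add(2), (intro i)+) (simp add: lam(3))
  qed
  finally show ?thesis
    using nonneg \<open>?R = _\<close> by simp
qed

section \<open>Power series of the integral transform\<close>

lemma summable_norm_unit_disc:
  fixes c :: "nat \<Rightarrow> complex"
  assumes c: "\<And>z. norm z < 1 \<Longrightarrow> summable (\<lambda>n. c n * z ^ n)" and r: "0 \<le> r" "r < 1"
  shows "summable (\<lambda>n. norm (c n) * r ^ n)"
proof -
  obtain R where R: "r < R" "R < 1"
    using dense[OF r(2)] by blast
  then have "summable (\<lambda>n. norm (c n * of_real r ^ n))"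
    using r c[of "of_real R"] by (intro powser_insidea[of c "of_real R"]) auto
  then show ?thesis
    using r by (simp add: norm_mult norm_power)
qed

lemma sums_deriv_unit_disc:
  fixes f :: "complex \<Rightarrow> complex" and c :: "nat \<Rightarrow> complex"
  assumes f: "\<And>z. norm z < 1 \<Longrightarrow> (\<lambda>n. c n * z ^ n) sums f z" and z: "norm z < 1"
  shows "f field_differentiable at z"
    and "(\<lambda>n. of_nat (Suc n) * c (Suc n) * z ^ n) sums deriv f z"
proof -
  have "((\<lambda>z. \<Sum>n. c n * z ^ n) has_field_derivative (\<Sum>n. diffs c n * z ^ n)) (at z)"
    using f z by (intro termdiffs_strong'[of 1]) (auto simp: sums_iff)
  then have "(f has_field_derivative (\<Sum>n. diffs c n * z ^ n)) (at z)"
    by (rule has_field_derivative_transform_within_open[OF _ open_ball[of 0 1]])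
       (use f z in \<open>auto simp: sums_iff\<close>)
  then show df: "f field_differentiable at z"
    by (auto simp: field_differentiable_def)
  have "(\<lambda>n. diffs c n * z ^ n) sums deriv f z"
    by (rule termdiffs_sums_strong[OF f]) (use df z in \<open>auto simp: field_differentiable_derivI\<close>)
  then show "(\<lambda>n. of_nat (Suc n) * c (Suc n) * z ^ n) sums deriv f z"
    by (simp add: diffs_def)
qed

lemma sums_times_deriv_unit_disc:
  fixes f :: "complex \<Rightarrow> complex" and c :: "nat \<Rightarrow> complex"
  assumes f: "\<And>z. norm z < 1 \<Longrightarrow> (\<lambda>n. c n * z ^ n) sums f z" and z: "norm z < 1"
  shows "(\<lambda>n. of_nat n * c n * z ^ n) sums (z * deriv f z)"
proof -
  have "(\<lambda>n. z * (of_nat (Suc n) * c (Suc n) * z ^ n)) sums (z * deriv f z)"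
    by (intro sums_mult sums_deriv_unit_disc(2)[OF f z])
  then have "(\<lambda>n. of_nat (Suc n) * c (Suc n) * z ^ Suc n) sums (z * deriv f z)"
    by (simp only: power_Suc mult_ac)
  then show ?thesis
    by (subst (asm) sums_Suc_iff) simp
qed

text \<open>
  The factor \<open>1/t\<close> lowers the exponent of \<open>t\<close> by one; at \<open>n = 0\<close>, where \<open>n - 1\<close> is truncated, the
  coefficient vanishes.
\<close>

lemma V_op_sums:
  fixes f :: "complex \<Rightarrow> complex" and c :: "nat \<Rightarrow> complex"
  assumes f: "\<And>z. norm z < 1 \<Longrightarrow> (\<lambda>n. c n * z ^ n) sums f z" and c0: "c 0 = 0"
    and lam: "set_integrable lborel {0..1} lam" and z: "norm z < 1"
  shows "(\<lambda>n. of_real (LINT t:{0..1}|lborel. lam t * t ^ (n - 1)) * c n * z ^ n) sums V_op lam f z"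
proof -
  have sf: "summable (\<lambda>n. norm (c (Suc n) * z ^ Suc n))"
    using summable_norm_unit_disc[of c "norm z"] f z
    by (subst summable_Suc_iff) (auto simp: sums_iff norm_mult norm_power)
  note moments = power_series_moments[OF lam sf]
  have point: "of_real (lam t) * (f (of_real t * z) / of_real t) = lam t *\<^sub>R (\<Sum>n. t ^ n *\<^sub>R (c (Suc n) * z ^ Suc n))"
    if t: "t \<in> {0<..1}" for t
  proof -
    have "norm (of_real t * z) < 1"
      using t z by (auto simp: norm_mult intro: le_less_trans[OF mult_left_le_one_le])
    from f[OF this] have "(\<lambda>n. c (Suc n) * (of_real t * z) ^ Suc n) sums f (of_real t * z)"
      by (subst sums_Suc_iff) (simp add: c0)
    then have "(\<lambda>n. c (Suc n) * (of_real t * z) ^ Suc n / of_real t) sums (f (of_real t * z) / of_real t)"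
      by (rule sums_divide)
    moreover have "c (Suc n) * (of_real t * z) ^ Suc n / of_real t = t ^ n *\<^sub>R (c (Suc n) * z ^ Suc n)" for n
      using t by (simp add: power_mult_distrib scaleR_conv_of_real)
    ultimately show ?thesis
      by (simp add: sums_iff scaleR_conv_of_real)
  qed
  have "V_op lam f z = (LINT t:{0<..1}|lborel. of_real (lam t) * (f (of_real t * z) / of_real t))"
    unfolding V_op_def by (rule set_integral_discrete_difference[where X = "{0}"]) auto
  also have "\<dots> = (LINT t:{0<..1}|lborel. lam t *\<^sub>R (\<Sum>n. t ^ n *\<^sub>R (c (Suc n) * z ^ Suc n)))"
    using point by (intro set_lebesgue_integral_cong) auto
  also have "\<dots> = (LINT t:{0..1}|lborel. lam t *\<^sub>R (\<Sum>n. t ^ n *\<^sub>R (c (Suc n) * z ^ Suc n)))"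
    by (rule set_integral_discrete_difference[where X = "{0}"]) auto
  finally have "(\<lambda>n. (LINT t:{0..1}|lborel. lam t * t ^ n) *\<^sub>R (c (Suc n) * z ^ Suc n)) sums V_op lam f z"
    using moments(2) by simp
  then have "(\<lambda>n. of_real (LINT t:{0..1}|lborel. lam t * t ^ (Suc n - 1)) * c (Suc n) * z ^ Suc n) sums V_op lam f z"
    by (simp add: scaleR_conv_of_real mult.assoc)
  then show ?thesis
    by (subst (asm) sums_Suc_iff) (simp add: c0)
qed

text \<open>
  The derivative is continuous without zeros, so its sign is constant, and a positive sign would keep
  \<open>lam\<close> away from its limit \<open>0\<close> at the right end.
\<close>

lemma decreasing_weight:
  fixes lam lam' lam'' :: "real \<Rightarrow> real"
  assumes lam: "\<And>t. t \<in> {0..1} \<Longrightarrow> 0 \<le> lam t" "lam 1 = 0" "continuous (at_left 1) lam"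
    and lam': "\<And>t. t \<in> {0<..<1} \<Longrightarrow> (lam has_real_derivative lam' t) (at t)"
    and lam'': "\<And>t. t \<in> {0<..<1} \<Longrightarrow> (lam' has_real_derivative lam'' t) (at t)"
    and nz: "\<And>t. t \<in> {0<..<1} \<Longrightarrow> lam' t \<noteq> 0" and t: "t \<in> {0<..<1}"
  shows "lam' t \<le> 0"
proof (rule ccontr)
  assume "\<not> lam' t \<le> 0"
  then have pos: "0 < lam' t"
    by simp
  have pos': "0 < lam' v" if v: "t \<le> v" "v < 1" for v
  proof (rule ccontr)
    assume "\<not> 0 < lam' v"
    moreover have "continuous_on {t..v} lam'"
      by (intro continuous_at_imp_continuous_on ballI DERIV_isCont[OF lam'']) (use v t in auto)
    ultimately obtain x where "t \<le> x" "x \<le> v" "lam' x = 0"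
      using IVT2'[of lam' v 0 t] pos v by auto
    then show False
      using nz[of x] t v by auto
  qed
  define u where "u = (1 + t) / 2"
  have u: "t < u" "u < 1"
    using t by (auto simp: u_def)
  have "\<exists>z>t. z < u \<and> lam u - lam t = (u - t) * lam' z"
    using u t by (intro MVT2 lam') auto
  then obtain x where x: "t < x" "x < u" "lam u - lam t = (u - t) * lam' x"
    by blast
  moreover have "0 < (u - t) * lam' x"
    using x u by (intro mult_pos_pos pos') auto
  ultimately have "lam t < lam u"
    by linarith
  then have lu: "0 < lam u"
    using lam(1)[of t] t by simp
  have "(lam \<longlongrightarrow> 0) (at_left 1)"
    using lam(2,3) by (simp add: continuous_within)
  then have "eventually (\<lambda>v. lam v < lam u) (at_left 1)"
    using lu by (rule order_tendstoD)
  moreover have "eventually (\<lambda>v. u < v \<and> v < 1) (at_left 1)"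
    unfolding eventually_at_left[OF u(2)] using u by blast
  ultimately have "eventually (\<lambda>v. lam v < lam u \<and> u < v \<and> v < 1) (at_left 1)"
    by (rule eventually_conj)
  then obtain v where v: "lam v < lam u" "u < v" "v < 1"
    using eventually_happens[OF _] trivial_limit_at_left_real by blast
  have "lam u \<le> lam v"
  proof (rule DERIV_nonneg_imp_nondecreasing[of u v lam])
    fix x assume "u \<le> x" "x \<le> v"
    then have "t \<le> x" "x < 1" "x \<in> {0<..<1}"
      using u v t by auto
    then show "\<exists>y. (lam has_real_derivative y) (at x) \<and> 0 \<le> y"
      using lam' pos' less_imp_le by blast
  qed (use v in simp)
  then show False
    using v by simp
qed

text \<open>
  If the quotient had real part at most \<open>\<sigma>\<close>, then \<open>\<kappa> = -k/N\<close> would lie in the disc: the inversion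
  \<open>p \<mapsto> -1/p\<close> maps the half-plane \<open>Re p \<le> -1/s\<close> into the disc with diameter \<open>[0, s]\<close>.
\<close>

lemma starlike_half_plane:
  fixes k N :: complex and \<sigma> s :: real
  assumes \<sigma>: "\<sigma> < 1" and s: "s = 1 / (1 - \<sigma>)"
    and nz: "\<And>\<kappa>. norm (\<kappa> - of_real (s / 2)) \<le> s / 2 \<Longrightarrow> k + \<kappa> * N \<noteq> 0"
  shows "k \<noteq> 0" and "\<sigma> < Re ((k + N) / k)"
proof -
  have s0: "s > 0"
    using \<sigma> by (simp add: s)
  show k: "k \<noteq> 0"
    using nz[of 0] s0 by simp
  define p where "p = N / k"
  show "\<sigma> < Re ((k + N) / k)"
  proof (rule ccontr)
    assume "\<not> \<sigma> < Re ((k + N) / k)"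
    moreover have "(k + N) / k = 1 + p"
      using k by (simp add: p_def add_divide_distrib)
    ultimately have "Re p \<le> \<sigma> - 1"
      by simp
    also have "\<sigma> - 1 = - (1 / s)"
      using \<sigma> by (simp add: s)
    finally have p: "1 \<le> - (s * Re p)"
      using s0 by (simp add: field_simps)
    then have p0: "p \<noteq> 0"
      by auto
    define \<kappa> where "\<kappa> = - 1 / p"
    have "norm (1 + of_real (s / 2) * p) \<le> s / 2 * norm p"
    proof (rule power2_le_imp_le)
      have "(norm (1 + of_real (s / 2) * p))\<^sup>2 = 1 + s * Re p + (s / 2)\<^sup>2 * (norm p)\<^sup>2"
        unfolding cmod_power2 by (simp add: power2_eq_square algebra_simps)
      then show "(norm (1 + of_real (s / 2) * p))\<^sup>2 \<le> (s / 2 * norm p)\<^sup>2"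
        unfolding power_mult_distrib using p by linarith
    qed (use s0 in simp)
    moreover have "\<kappa> - of_real (s / 2) = - (1 + of_real (s / 2) * p) / p"
      using p0 by (simp add: \<kappa>_def field_simps)
    then have "norm (\<kappa> - of_real (s / 2)) = norm (1 + of_real (s / 2) * p) / norm p"
      by (simp only: norm_divide norm_minus_cancel)
    ultimately have "norm (\<kappa> - of_real (s / 2)) \<le> s / 2"
      using p0 by (simp only: divide_le_eq) simp
    moreover have "k + \<kappa> * N = 0"
      using p0 k by (simp add: \<kappa>_def p_def field_simps)
    ultimately show False
      using nz by blast
  qed
qed

section \<open>Inclusion of the transformed class in the Pascu class\<close>

theorem theorem3p3:
  fixes \<xi> \<alpha> \<gamma> \<mu> \<nu> \<sigma> \<beta> :: real
    and lam lam' lam'' :: "real \<Rightarrow> real"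
  assumes "0 < \<xi>" and "\<xi> \<le> 1" and "\<alpha> \<ge> 0" and "\<gamma> > 0"
    and "\<nu> \<ge> \<mu>" and "\<mu> \<ge> 1" and "\<mu> + \<nu> = \<alpha> - \<gamma>" and "\<mu> * \<nu> = \<gamma>"
    and "0 \<le> \<sigma>"
    and "\<sigma> \<le> 1 / 2 * ((1 / \<mu> - 1 / \<nu>) / (1 + 1 / \<mu> - 1 / \<nu>))"
    and "\<And>t. t \<in> {0..1} \<Longrightarrow> lam t \<ge> 0"
    and "set_integrable lborel {0..1} lam"
    and "\<And>t. t \<in> {0<..<1} \<Longrightarrow> (lam has_real_derivative lam' t) (at t)"
    and "\<And>t. t \<in> {0<..<1} \<Longrightarrow> (lam' has_real_derivative lam'' t) (at t)"
    and "(LINT t:{0..1}|lborel. lam t) = 1"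
    and "lam 1 = 0" and "continuous (at_left 1) lam"
    and "\<beta> < 1"
    and "\<beta> / (1 - \<beta>) =
           - (LINT t:{0..1}|lborel.
                lam t * ((1 - \<xi>) * g_fun \<mu> \<nu> \<sigma> t + \<xi> * (2 * q_fun \<mu> \<nu> \<sigma> t - 1)))"
    and "\<And>t. t \<in> {0<..<1} \<Longrightarrow> lam' t \<noteq> 0"
    and "\<And>t. t \<in> {0<..<1} \<Longrightarrow>
           t * lam'' t / lam' t \<ge> (1 / \<xi> - 2 + 2 / \<mu> - 1 / \<nu>) + (1 - 2 * \<sigma>) / ln (1 / t)"
  shows "V_op lam ` W_class \<beta> \<alpha> \<gamma> \<subseteq> pascu_class \<sigma> \<xi>"
proof (rule image_subsetI)
  fix f assume "f \<in> W_class \<beta> \<alpha> \<gamma>"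
  then have hol: "f holomorphic_on unit_disc" and f0: "f 0 = 0" and f1: "deriv f 0 = 1"
    and "\<exists>\<phi>::real. \<forall>z \<in> unit_disc.
     Re (exp (\<i> * of_real \<phi>) *
         (of_real (1 - \<alpha> + 2 * \<gamma>) * over_z f z + of_real (\<alpha> - 2 * \<gamma>) * deriv f z
          + of_real \<gamma> * z * deriv (deriv f) z - of_real \<beta>)) > 0"
    by (auto simp: W_class_def class_A_def)
  then obtain \<phi> :: real where \<phi>: "\<And>z. norm z < 1 \<Longrightarrow>
     Re (exp (\<i> * of_real \<phi>) *
         (of_real (1 - \<alpha> + 2 * \<gamma>) * over_z f z + of_real (\<alpha> - 2 * \<gamma>) * deriv f z
          + of_real \<gamma> * z * deriv (deriv f) z - of_real \<beta>)) > 0"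
    unfolding Ball_def mem_ball_0 by blast
  define a where "a n = (deriv ^^ n) f 0 / fact n" for n
  have a0: "a 0 = 0" and a1: "a (Suc 0) = 1"
    by (simp_all add: a_def f0 f1)
  have f: "(\<lambda>n. a n * z ^ n) sums f z" if "norm z < 1" for z
    using holomorphic_power_series[OF hol, of z] that by (simp add: a_def)
  define L where "L n = (LINT t:{0..1}|lborel. lam t * t ^ n)" for n
  have L0: "L 0 = 1"
    using assms(15) by (simp add: L_def)
  define m where "m n = 1 / \<mu> * (1 / \<nu>) / ((real n + 1 / \<mu>) * (real n + 1 / \<nu>))" for n
  have \<mu>\<nu>: "0 < \<mu>" "0 < \<nu>"
    using assms(5,6) by auto
  \<comment> \<open>The factors relating \<open>f\<close> to the half-plane function \<open>H\<close> cancel against the moments \<open>m\<^sub>n\<close>.\<close>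
  have m_eq: "m n * ((1 + \<mu> * real n) * (1 + \<nu> * real n)) = 1" for n
  proof -
    have "real n + 1 / \<mu> = (1 + \<mu> * real n) / \<mu>" "real n + 1 / \<nu> = (1 + \<nu> * real n) / \<nu>"
      using \<mu>\<nu> by (simp_all add: field_simps)
    moreover have "1 + \<mu> * real n > 0" "1 + \<nu> * real n > 0"
      using \<mu>\<nu> by (auto intro: add_pos_nonneg)
    ultimately show ?thesis
      using \<mu>\<nu> by (simp add: m_def)
  qed
  have m_bounds: "0 \<le> m n" "m n \<le> 1" for n
  proof -
    have "1 \<le> (1 + \<mu> * real n) * (1 + \<nu> * real n)"
      using \<mu>\<nu> mult_mono[of 1 "1 + \<mu> * real n" 1 "1 + \<nu> * real n"] by simp
    moreover show "0 \<le> m n"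
      using \<mu>\<nu> by (simp add: m_def)
    ultimately have "m n * 1 \<le> m n * ((1 + \<mu> * real n) * (1 + \<nu> * real n))"
      by (intro mult_left_mono)
    then show "m n \<le> 1"
      using m_eq[of n] by simp
  qed
  have \<sigma>: "\<sigma> \<le> 1/4" "\<sigma> < 1"
  proof -
    define d where "d = 1 / \<mu> - 1 / \<nu>"
    have d: "0 \<le> d" "d \<le> 1"
      using assms(5,6) \<mu>\<nu> by (auto simp: d_def frac_le intro: order_trans[of _ "1 / \<mu>"])
    \<comment> \<open>\<open>d/(1 + d)\<close> increases in \<open>d\<close>, so its largest value \<open>1/2\<close> is attained at \<open>d = 1\<close>.\<close>
    have "\<sigma> \<le> 1 / 2 * (d / (1 + d))"
      using assms(10) by (simp only: d_def add_diff_eq)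
    also have "d / (1 + d) \<le> 1 / 2"
      using d by (simp add: field_simps)
    finally show "\<sigma> \<le> 1/4"
      by simp
    then show "\<sigma> < 1"
      by simp
  qed
  define s where "s = 1 / (1 - \<sigma>)"
  have lam'_nonpos: "lam' t \<le> 0" if "t \<in> {0<..<1}" for t
    by (rule decreasing_weight[OF assms(11,16,17,13,14,20) that])

  define h where "h n = of_real ((1 + \<mu> * real n) * (1 + \<nu> * real n)) * a (Suc n)" for n
  have H: "(\<lambda>n. h n * z ^ n) sums (of_real (1 - \<alpha> + 2 * \<gamma>) * over_z f z + of_real (\<alpha> - 2 * \<gamma>) * deriv f z
          + of_real \<gamma> * z * deriv (deriv f) z)" if z: "norm z < 1" for z
  proof -
    have 1: "(\<lambda>n. a (Suc n) * z ^ n) sums over_z f z"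
    proof (cases "z = 0")
      case True
      then show ?thesis
        using powser_sums_zero[of "\<lambda>n. a (Suc n)"] by (simp add: over_z_def f1 a1)
    next
      case False
      have "(\<lambda>n. a (Suc n) * z ^ Suc n) sums f z"
        using f[OF z] by (subst sums_Suc_iff) (simp add: a0)
      then have "(\<lambda>n. a (Suc n) * z ^ Suc n / z) sums (f z / z)"
        by (rule sums_divide)
      then show ?thesis
        using False by (simp add: over_z_def)
    qed
    have 2: "(\<lambda>n. of_nat (Suc n) * a (Suc n) * z ^ n) sums deriv f z" if "norm z < 1" for z
      by (rule sums_deriv_unit_disc(2)[OF f that])
    have 3: "(\<lambda>n. of_nat n * (of_nat (Suc n) * a (Suc n)) * z ^ n) sums (z * deriv (deriv f) z)"
      by (rule sums_times_deriv_unit_disc[OF 2 z])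
    have "(\<lambda>n. of_real (1 - \<alpha> + 2 * \<gamma>) * (a (Suc n) * z ^ n) + of_real (\<alpha> - 2 * \<gamma>) * (of_nat (Suc n) * a (Suc n) * z ^ n)
          + of_real \<gamma> * (of_nat n * (of_nat (Suc n) * a (Suc n)) * z ^ n)) sums
        (of_real (1 - \<alpha> + 2 * \<gamma>) * over_z f z + of_real (\<alpha> - 2 * \<gamma>) * deriv f z + of_real \<gamma> * (z * deriv (deriv f) z))"
      by (intro sums_add sums_mult 1 2[OF z] 3)
    moreover have "of_real (1 - \<alpha> + 2 * \<gamma>) * (a (Suc n) * z ^ n) + of_real (\<alpha> - 2 * \<gamma>) * (of_nat (Suc n) * a (Suc n) * z ^ n)
          + of_real \<gamma> * (of_nat n * (of_nat (Suc n) * a (Suc n)) * z ^ n) = h n * z ^ n" for n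
    proof -
      \<comment> \<open>With these values \<open>1 - \<alpha> + 2\<gamma> + (\<alpha> - 2\<gamma>)(n + 1) + \<gamma>n(n + 1) = (1 + \<mu>n)(1 + \<nu>n)\<close>.\<close>
      have \<alpha>: "\<alpha> = \<mu> + \<nu> + \<mu> * \<nu>" and \<gamma>: "\<gamma> = \<mu> * \<nu>"
        using assms(7,8) by auto
      show ?thesis
        unfolding h_def \<alpha> \<gamma> by (simp add: algebra_simps)
    qed
    ultimately show ?thesis
      by (simp add: mult.assoc)
  qed

  define F where "F = V_op lam f"
  define c where "c n = of_real (L (n - 1)) * a n" for n
  have F: "(\<lambda>n. c n * z ^ n) sums F z" if "norm z < 1" for z
    unfolding F_def c_def L_def by (rule V_op_sums[OF f a0 assms(12) that])
  have c0: "c 0 = 0" and c1: "c (Suc 0) = 1"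
    by (simp_all add: c_def a0 a1 L0)
  \<comment> \<open>Below, \<open>k\<close> is \<open>(\<xi>zF' + (1 - \<xi>)F)/z\<close> and \<open>N\<close> is \<open>zk'\<close>.\<close>
  define e where "e n = of_real (1 + \<xi> * real n) * c (Suc n)" for n
  define k where "k z = (\<Sum>n. e n * z ^ n)" for z
  define N where "N z = (\<Sum>n. of_nat n * e n * z ^ n)" for z
  have zF': "(\<lambda>n. of_nat n * c n * z ^ n) sums (z * deriv F z)" if "norm z < 1" for z
    by (rule sums_times_deriv_unit_disc[OF F that])
  have zF'': "(\<lambda>n. of_nat n * (of_nat n * c n) * z ^ n) sums (z * deriv (\<lambda>w. w * deriv F w) z)" if "norm z < 1" for z
    by (rule sums_times_deriv_unit_disc[OF zF' that])
  have denominator: "of_real \<xi> * (z * deriv F z) + of_real (1 - \<xi>) * F z = z * k z"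
    and numerator: "of_real \<xi> * (z * deriv (\<lambda>w. w * deriv F w) z) + of_real (1 - \<xi>) * (z * deriv F z) = z * (k z + N z)"
    and k_sum: "summable (\<lambda>n. e n * z ^ n)" and N_sum: "summable (\<lambda>n. of_nat n * e n * z ^ n)"
    if z: "norm z < 1" "z \<noteq> 0" for z
  proof -
    have shift: "g' sums x" if "g sums x" "g 0 = 0" "\<And>n. g (Suc n) = g' n" for g g' :: "nat \<Rightarrow> complex" and x
    proof -
      have "(\<lambda>n. g (Suc n)) sums x"
        using that by (subst sums_Suc_iff) simp
      then show ?thesis
        by (simp only: that(3))
    qed
    define D where "D = of_real \<xi> * (z * deriv F z) + of_real (1 - \<xi>) * F z"
    define M where "M = of_real \<xi> * (z * deriv (\<lambda>w. w * deriv F w) z) + of_real (1 - \<xi>) * (z * deriv F z)"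
    have "(\<lambda>n. of_real \<xi> * (of_nat n * c n * z ^ n) + of_real (1 - \<xi>) * (c n * z ^ n)) sums D"
      unfolding D_def by (intro sums_add sums_mult F zF' z)
    then have "(\<lambda>n. z * (e n * z ^ n)) sums D"
      by (rule shift) (simp_all add: c0 e_def algebra_simps)
    then have "(\<lambda>n. z * (e n * z ^ n) / z) sums (D / z)"
      by (rule sums_divide)
    then have D: "(\<lambda>n. e n * z ^ n) sums (D / z)"
      using z(2) by simp
    have "(\<lambda>n. of_real \<xi> * (of_nat n * (of_nat n * c n) * z ^ n) + of_real (1 - \<xi>) * (of_nat n * c n * z ^ n)) sums M"
      unfolding M_def by (intro sums_add sums_mult zF'' zF' z)
    then have "(\<lambda>n. z * (e n * z ^ n + of_nat n * e n * z ^ n)) sums M"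
      by (rule shift) (simp_all add: c0 e_def algebra_simps)
    then have "(\<lambda>n. z * (e n * z ^ n + of_nat n * e n * z ^ n) / z) sums (M / z)"
      by (rule sums_divide)
    then have M: "(\<lambda>n. e n * z ^ n + of_nat n * e n * z ^ n) sums (M / z)"
      using z(2) by simp
    from sums_diff[OF M D] have N: "(\<lambda>n. of_nat n * e n * z ^ n) sums (M / z - D / z)"
      by simp
    show "summable (\<lambda>n. e n * z ^ n)" "summable (\<lambda>n. of_nat n * e n * z ^ n)"
      using D N by (auto simp: sums_iff)
    have kN: "k z = D / z" "N z = M / z - D / z"
      using D N by (simp_all add: k_def N_def sums_iff)
    show "of_real \<xi> * (z * deriv F z) + of_real (1 - \<xi>) * F z = z * k z"
      unfolding D_def[symmetric] kN using z(2) by simp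
    show "of_real \<xi> * (z * deriv (\<lambda>w. w * deriv F w) z) + of_real (1 - \<xi>) * (z * deriv F z) = z * (k z + N z)"
      unfolding M_def[symmetric] kN using z(2) by simp
  qed

  have nonzero: "k z + \<kappa> * N z \<noteq> 0"
    if \<kappa>: "norm (\<kappa> - of_real (s / 2)) \<le> s / 2" and z: "norm z < 1" "z \<noteq> 0" for \<kappa> z
  proof -
    \<comment> \<open>\<open>k + \<kappa>N\<close> is the Hadamard product of \<open>H\<close> with the series of coefficients \<open>C n = L n * u n\<close>.\<close>
    define u where "u n = of_real (m n * (1 + \<xi> * real n)) * (1 + \<kappa> * of_nat n)" for n
    have u_sum: "summable (\<lambda>n. norm (u n * w ^ n))" if w: "norm w < 1" for w
    proof (rule summable_comparison_test)
      show "summable (\<lambda>n. (real n + 1) * (1 + norm \<kappa> * real n) * norm w ^ n)"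
        using convexity_kernel_sums[of "norm w" "norm \<kappa>"] w by (simp add: sums_iff)
      have "norm (u n * w ^ n) \<le> (real n + 1) * (1 + norm \<kappa> * real n) * norm w ^ n" for n
      proof -
        have "m n * (1 + \<xi> * real n) \<le> 1 * (real n + 1)"
          using m_bounds[of n] assms(1,2) mult_right_mono[of \<xi> 1 "real n"] by (intro mult_mono) auto
        moreover have "norm (1 + \<kappa> * of_nat n) \<le> 1 + norm \<kappa> * real n"
          by (rule order_trans[OF norm_triangle_ineq]) (simp add: norm_mult)
        moreover have "0 \<le> m n * (1 + \<xi> * real n)"
          using m_bounds[of n] assms(1) by simp
        ultimately show ?thesis
          unfolding u_def norm_mult norm_power norm_of_real
          by (intro mult_right_mono mult_mono) auto
      qed
      then show "\<exists>N. \<forall>n\<ge>N. norm (norm (u n * w ^ n)) \<le> (real n + 1) * (1 + norm \<kappa> * real n) * norm w ^ n"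
        by auto
    qed
    define C where "C n = of_real (L n) * u n" for n
    have C_sums: "summable (\<lambda>n. C n * w ^ n)" if "norm w < 1" for w
      using power_series_moments(2)[OF assms(12) u_sum[OF that]]
      by (simp add: sums_iff C_def L_def scaleR_conv_of_real mult.assoc)
    have "(\<Sum>n. h n * C n * z ^ n) \<noteq> 0"
    proof (rule half_plane_convolution_nonzero[OF _ _ _ _ assms(18) _ _ z(1)])
      show "summable (\<lambda>n. norm (h n) * r ^ n)" if "0 \<le> r" "r < 1" for r
        by (rule summable_norm_unit_disc[OF _ that]) (use H in \<open>auto simp: sums_iff\<close>)
      show "summable (\<lambda>n. norm (C n) * r ^ n)" if "0 \<le> r" "r < 1" for r
        by (rule summable_norm_unit_disc[OF C_sums that])
      show "h 0 = 1"
        by (simp add: h_def a1)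
      show "C 0 = 1"
        using m_eq[of 0] by (simp add: C_def u_def L0)
      show "0 < Re (exp (\<i> * of_real \<phi>) * ((\<Sum>n. h n * w ^ n) - of_real \<beta>))" if "norm w < 1" for w
        using \<phi>[OF that] H[OF that] by (simp add: sums_iff)
      show "(1 - \<beta> / (1 - \<beta>)) / 2 \<le> Re (\<Sum>n. C n * w ^ n)" if w: "norm w < 1" for w
      proof -
        have "(1 - \<beta> / (1 - \<beta>)) / 2 \<le> (\<Sum>n. L n * (m n * (1 + \<xi> * real n) * Re ((1 + \<kappa> * of_nat n) * w ^ n)))"
          unfolding assms(19) L_def m_def diff_minus_eq_add
          by (rule weighted_g_q_integral_le[OF less_imp_le[OF assms(1)] assms(2,6,5,9) \<sigma>(1) s_def assms(12) _
                assms(15,16,13) lam'_nonpos \<kappa> w]) (simp add: assms(11))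
        moreover have "L n * (m n * (1 + \<xi> * real n) * Re ((1 + \<kappa> * of_nat n) * w ^ n)) = Re (C n * w ^ n)" for n
          by (simp add: C_def u_def algebra_simps)
        moreover have "(\<Sum>n. Re (C n * w ^ n)) = Re (\<Sum>n. C n * w ^ n)"
          by (rule Re_suminf[OF C_sums[OF w], symmetric])
        ultimately show ?thesis
          by (simp only:)
      qed
    qed
    moreover have "h n * C n * z ^ n = e n * z ^ n + \<kappa> * (of_nat n * e n * z ^ n)" for n
    proof -
      have "h n * C n = of_real (m n * ((1 + \<mu> * real n) * (1 + \<nu> * real n))) * (of_real (1 + \<xi> * real n) * (of_real (L n) * a (Suc n)) * (1 + \<kappa> * of_nat n))"
        unfolding h_def C_def u_def by (simp only: of_real_mult mult_ac)
      then show ?thesis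
        unfolding m_eq e_def c_def by (simp add: algebra_simps)
    qed
    moreover have "(\<Sum>n. e n * z ^ n + \<kappa> * (of_nat n * e n * z ^ n)) = k z + \<kappa> * N z"
      unfolding k_def N_def using k_sum[OF z] N_sum[OF z]
      by (simp add: suminf_add[symmetric] suminf_mult summable_mult)
    ultimately show ?thesis
      by simp
  qed

  have "F \<in> class_A"
  proof -
    have "F holomorphic_on unit_disc"
      using sums_deriv_unit_disc(1)[OF F] field_differentiable_at_within
      by (fastforce simp: holomorphic_on_def)
    moreover have "F 0 = 0"
      using F[of 0] powser_sums_zero[of c] sums_unique2 by (fastforce simp: c0)
    moreover have "deriv F 0 = 1"
      using sums_deriv_unit_disc(2)[OF F, of 0] powser_sums_zero[of "\<lambda>n. of_nat (Suc n) * c (Suc n)"] sums_unique2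
      by (fastforce simp: c1)
    ultimately show ?thesis
      by (simp add: class_A_def)
  qed
  moreover have "of_real \<xi> * (z * deriv F z) + of_real (1 - \<xi>) * F z \<noteq> 0 \<and>
     Re ((of_real \<xi> * (z * deriv (\<lambda>w. w * deriv F w) z) + of_real (1 - \<xi>) * (z * deriv F z))
         / (of_real \<xi> * (z * deriv F z) + of_real (1 - \<xi>) * F z)) > \<sigma>" if "z \<in> unit_disc - {0}" for z
  proof -
    have z: "norm z < 1" "z \<noteq> 0"
      using that by auto
    have "k z \<noteq> 0" "\<sigma> < Re ((k z + N z) / k z)"
      using starlike_half_plane[OF \<sigma>(2) s_def nonzero[OF _ z]] by auto
    then show ?thesis
      unfolding denominator[OF z] numerator[OF z] using z(2) by simp
  qed
  ultimately show "V_op lam f \<in> pascu_class \<sigma> \<xi>"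
    by (simp add: pascu_class_def F_def)
qed

end
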